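(* Let $T\ge 0$ be a random time with density $p_T$, independent of a standard Brownian motion $B$, let $X_1,\dots,X_n$ be i.i.d. copies of $X=B_T$, and let $p_{T,n}$ be the estimator defined in the context, with parameter $\gamma$ and bandwidths $h_n>0$, $h_n\to0$. Assume that $p_T\in\mathcal{D}(\beta,\gamma,L)$ for some $\beta>0$, $L>0$ and that $$\max\bigl((a_T+1)/2,\,3/4\bigr)<\gamma<b_T .$$ Then for some constant $D_{\gamma,L}$, $$\sup_{x\ge0}\mathbb{E}\Bigl[\bigl\{x^{\gamma}|p_T(x)-p_{T,n}(x)|\bigr\}^2\Bigr]\le D_{\gamma,L}\times\begin{cases} h_n^{2\beta}+\frac1n h_n^{2(\gamma-1)}e^{\pi/h_n}, & \gamma<1,\\ h_n^{2\beta}+\frac1n e^{\pi/h_n}, & \gamma\ge1.\end{cases}$$ Moreover, choosing $$h_n=\frac{\pi}{\log n-2(\beta+1-\gamma)\log\log n}\ \text{ if }\gamma<1,\qquad h_n=\frac{\pi}{\log n-2\beta\log\log n}\ \text{ if }\gamma\ge1,$$ one obtains $$\sup_{x\ge0}\sqrt{\mathbb{E}\Bigl[\bigl\{x^{\gamma}|p_T(x)-p_{T,n}(x)|\bigr\}^2\Bigr]}\lesssim\log^{-\beta}(n),\qquad n\to\infty.$$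
   Context: For a non-negative random variable $\xi$ with density $p_\xi$, the Mellin transform is $\mathcal{M}[p_\xi](z)=\mathbb{E}[\xi^{z-1}]=\int_0^\infty p_\xi(x)x^{z-1}\,dx$ for $z\in\mathcal{S}_\xi=\{z\in\mathbb{C}:\mathbb{E}[\xi^{\mathrm{Re}\,z-1}]<\infty\}$. It is assumed that $0\le a_T<1\le b_T$ are such that $\{z: a_T<\mathrm{Re}(z)<b_T\}\subset\mathcal{S}_T$. The class of functions is $$\mathcal{D}(\beta,\gamma,L)=\Bigl\{f:\int_{-\infty}^\infty|\mathcal{M}[f](\gamma+\mathrm{i}v)|\,(1+|v|^{\beta})\,dv<L\Bigr\}.$$ The empirical Mellin transform is $\mathcal{M}_n[p_{|X|}](z)=\frac1n\sum_{k=1}^n|X_k|^{z-1}$, $\mathrm{Re}(z)>1/2$. With the kernel $K(y)=1_{[-1,1]}(y)$ and bandwidths $h_n>0$ tending to $0$, the estimator of $p_T$ is $$p_{T,n}(x)=\frac{1}{\sqrt\pi}\int_{-\infty}^\infty x^{-\gamma-\mathrm{i}v}K(vh_n)\frac{\mathcal{M}_n[p_{|X|}](2(\gamma+\mathrm{i}v)-1)}{2^{\gamma+\mathrm{i}v}\,\Gamma(\gamma-1/2+\mathrm{i}v)}\,dv .$$ $A\lesssim B$ means that $A$ is bounded by a constant multiple of $B$, independently of the parameters involved, i.e. $A=O(B)$.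
   Formalization: For γ>1 it is also assumed that E[T^{2γ-2}]<∞ (2γ-1 in S_T), without which the variance can be infinite; the constant D may depend on the law of T, not only on γ and L; p_T(x) is the value of the continuous version of the density. *)

theory Defs
  imports "HOL-Probability.Probability"
begin

definition standard_brownian_motion :: "'a measure \<Rightarrow> (real \<Rightarrow> 'a \<Rightarrow> real) \<Rightarrow> bool" where
  "standard_brownian_motion M B \<longleftrightarrow>
     prob_space M \<and>
     (\<forall>t\<ge>0. B t \<in> borel_measurable M) \<and>
     (AE \<omega> in M. B 0 \<omega> = 0) \<and>
     (\<forall>\<omega>\<in>space M. continuous_on {0..} (\<lambda>t. B t \<omega>)) \<and>
     (\<forall>s t. 0 \<le> s \<and> s < t \<longrightarrow>
        distributed M lborel (\<lambda>\<omega>. B t \<omega> - B s \<omega>) (normal_density 0 (sqrt (t - s)))) \<and>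
     (\<forall>(m::nat) t. 0 \<le> t 0 \<and> (\<forall>i<m. t i \<le> t (Suc i)) \<longrightarrow>
        prob_space.indep_vars M (\<lambda>_. borel) (\<lambda>i \<omega>. B (t (Suc i)) \<omega> - B (t i) \<omega>) {..<m})"

definition independent_of_process ::
    "'a measure \<Rightarrow> ('a \<Rightarrow> real) \<Rightarrow> (real \<Rightarrow> 'a \<Rightarrow> real) \<Rightarrow> bool" where
  "independent_of_process M T B \<longleftrightarrow>
     prob_space.indep_set M
       (sets (vimage_algebra (space M) T borel))
       (sets (vimage_algebra (space M) (\<lambda>\<omega>. \<lambda>t\<in>{0..}. B t \<omega>) (Pi\<^sub>M {0..} (\<lambda>_. borel))))"

definition mellin :: "(real \<Rightarrow> real) \<Rightarrow> complex \<Rightarrow> complex" where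
  "mellin f z = (LINT x:{0<..}|lborel. complex_of_real (f x) * complex_of_real x powr (z - 1))"

text \<open>For a random variable with a density the event that it vanishes is null, so the library
  convention \<open>0 powr s = 0\<close> plays no role here.\<close>

definition mellin_domain :: "'a measure \<Rightarrow> ('a \<Rightarrow> real) \<Rightarrow> complex set" where
  "mellin_domain M \<xi> = {z. integrable M (\<lambda>\<omega>. \<xi> \<omega> powr (Re z - 1))}"

text \<open>The first condition says that the Mellin transform exists on the line
  \<open>Re z = \<gamma>\<close>; without it a function whose transform integral diverges would belong to the
  class because its Bochner integral is 0 by convention.\<close>

definition mellin_class :: "real \<Rightarrow> real \<Rightarrow> real \<Rightarrow> (real \<Rightarrow> real) set" where
  "mellin_class \<beta> \<gamma> L =
     {f. set_integrable lborel {0<..} (\<lambda>x. f x * x powr (\<gamma> - 1)) \<and>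
         (\<integral>\<^sup>+v. ennreal (cmod (mellin f (Complex \<gamma> v)) * (1 + \<bar>v\<bar> powr \<beta>)) \<partial>lborel) < ennreal L}"

text \<open>A density is determined only almost everywhere, whereas the risk is taken pointwise
  in \<open>x\<close>. A function in \<open>mellin_class\<close> has exactly one continuous version on the
  open half-line, and this is the version meant when it is evaluated at a point. The value at 0
  does not matter, since it is multiplied by \<open>0 powr \<gamma> = 0\<close>.\<close>

definition continuous_version :: "(real \<Rightarrow> real) \<Rightarrow> (real \<Rightarrow> real) \<Rightarrow> bool" where
  "continuous_version p q \<longleftrightarrow>
     continuous_on {0<..} q \<and> (AE x in lborel. 0 < x \<longrightarrow> q x = p x)"

definition empirical_mellin :: "nat \<Rightarrow> (nat \<Rightarrow> real) \<Rightarrow> complex \<Rightarrow> complex" where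
  "empirical_mellin n y z = (1 / of_nat n) * (\<Sum>k=1..n. complex_of_real \<bar>y k\<bar> powr (z - 1))"

definition kernel :: "real \<Rightarrow> real" where
  "kernel = indicat_real {-1..1}"

text \<open>The estimator at the point \<open>x\<close>, computed from the sample \<open>y 1, \<dots>, y n\<close> with
  bandwidth \<open>h\<close>. Its values are real but are kept in the complex numbers.\<close>

definition estimator :: "real \<Rightarrow> real \<Rightarrow> nat \<Rightarrow> (nat \<Rightarrow> real) \<Rightarrow> real \<Rightarrow> complex" where
  "estimator \<gamma> h n y x =
     complex_of_real (1 / sqrt pi) *
     (LINT v|lborel. complex_of_real x powr (- Complex \<gamma> v) * complex_of_real (kernel (v * h)) *
        (empirical_mellin n y (2 * Complex \<gamma> v - 1) /
         (2 powr (Complex \<gamma> v) * Gamma (Complex (\<gamma> - 1/2) v))))"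

definition weighted_sq_error ::
    "(real \<Rightarrow> real) \<Rightarrow> (nat \<Rightarrow> 'b \<Rightarrow> real) \<Rightarrow> real \<Rightarrow> real \<Rightarrow> nat \<Rightarrow> real \<Rightarrow> 'b \<Rightarrow> real" where
  "weighted_sq_error p X \<gamma> h n x \<omega> =
     (x powr \<gamma> * cmod (complex_of_real (p x) - estimator \<gamma> h n (\<lambda>k. X k \<omega>) x))\<^sup>2"

definition risk_rate :: "real \<Rightarrow> real \<Rightarrow> real \<Rightarrow> nat \<Rightarrow> real" where
  "risk_rate \<beta> \<gamma> h n =
     (if \<gamma> < 1 then h powr (2 * \<beta>) + 1 / real n * h powr (2 * (\<gamma> - 1)) * exp (pi / h)
      else h powr (2 * \<beta>) + 1 / real n * exp (pi / h))"

definition chosen_bandwidth :: "real \<Rightarrow> real \<Rightarrow> nat \<Rightarrow> real" where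
  "chosen_bandwidth \<beta> \<gamma> n =
     (if \<gamma> < 1 then pi / (ln (real n) - 2 * (\<beta> + 1 - \<gamma>) * ln (ln (real n)))
      else pi / (ln (real n) - 2 * \<beta> * ln (ln (real n))))"

end

theory Submission imports Defs begin

text \<open>
The estimator is a sample mean. The empirical Mellin transform is an average over the sample, so
$p_{T,n}(x) = n^{-1} \sum_k G_x(X_k)$, where $G_x(y)$ is the truncated inversion integral with
$|y|^{2z-2}$, $z = \gamma + iv$, in place of the empirical transform (\<open>estimator_eq_sample_mean\<close>).
The risk is therefore controlled by the bias $p_T(x) - E\,G_x(X)$ and by $n^{-1} E|G_x(X)|^2$.

\<^bold>\<open>Bias.\<close> Conditionally on \<open>T\<close>, the variable $B_T$ is $\sqrt T$ times a standard normal
variable, so that $E|X|^{2z-2} = M[p_T](z) \cdot 2^{z-1} \Gamma(z-1/2) / \sqrt\pi$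
(\<open>time_changed_brownian_motion_moment\<close>). The second factor is, up to a constant, what the
estimator divides by. Hence $E\,G_x(X)$ is the Mellin inversion integral of $M[p_T]$ cut off at
$|v| \le 1/h$. The full integral is the continuous version of $p_T$ (\<open>mellin_inversion\<close>, obtained
from Levy's inversion formula for the law of $\log T$ reweighted by $T^{\gamma-1}$), and beyond the
cut-off $|v|^\beta \ge h^{-\beta}$, so that the missing piece is at most $L h^\beta x^{-\gamma}$
(\<open>truncation_bias\<close>).

\<^bold>\<open>Variance.\<close> Pulling absolute values inside gives $x^\gamma |G_x(y)| \le |y|^{2\gamma-2} J(h)$
with $J(h) = \int_{|v| \le 1/h} |\Gamma(\gamma-1/2+iv)|^{-1} dv$. The moment $E|X|^{4\gamma-4}$ is
finite: $\gamma > 3/4$ takes care of the Gaussian factor and $2\gamma-1$ lies in the Mellin domain of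
\<open>T\<close>. What remains is a lower bound of order $|v|^{\min(0,\gamma-1)} e^{-\pi|v|/2}$ for
$|\Gamma(\gamma-1/2+iv)|$. Instead of Stirling's formula it is derived from Euler's product
\[ \Bigl(\frac{\Gamma(a)}{|\Gamma(a+iv)|}\Bigr)^2 = \prod_{k \ge 0} \Bigl(1 + \frac{v^2}{(a+k)^2}\Bigr). \]
Every factor is decreasing and log-convex in \<open>a\<close>, hence so is the product. At $a = 1/2, 1, 3/2$ it
has a closed form by the reflection formula. Monotonicity from $1/2$ settles $\gamma \ge 1$, and
log-convexity between $1$ and $3/2$ together with $\Gamma(z+1) = z\Gamma(z)$ settles $\gamma < 1$
with the right power of $|v|$. Integration gives $J(h)^2 = O(h^{2(\gamma-1)} e^{\pi/h})$, and
$O(e^{\pi/h})$ if $\gamma \ge 1$ (\<open>rGamma_line_integral_bound\<close>).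

All these bounds hold for each single $h > 0$ and $n \ge 1$ and their constants do not involve
$\beta$, so one constant serves all smoothness classes and all bandwidth sequences. The recommended
bandwidth makes $e^{\pi/h}/n$ a power of $\log n$, chosen to balance the two terms.
\<close>

section \<open>Decay of the Gamma function along vertical lines\<close>

text \<open>Euler's product for the modulus. The factor $n^{-z}$ in the defining limit of $1/\Gamma$ has the
  same modulus at \<open>a\<close> and at \<open>a + iv\<close>, so that in the quotient only the Pochhammer symbols
  survive.\<close>

lemma Gamma_ratio_LIMSEQ:
  fixes a v :: real
  assumes "a > 0"
  shows "(\<lambda>n. \<Prod>k\<le>n. 1 + v\<^sup>2 / (a + real k)\<^sup>2)
           \<longlonglongrightarrow> (Gamma a * cmod (rGamma (Complex a v)))\<^sup>2"
proof -
  let ?z = "Complex a v"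
  have "(\<lambda>n. (cmod (rGamma_series ?z n) / rGamma_series a n)\<^sup>2) \<longlonglongrightarrow> (cmod (rGamma ?z) / rGamma a)\<^sup>2"
    using assms by (intro tendsto_intros) (auto simp: rGamma_eq_zero_iff elim!: nonpos_Ints_cases)
  moreover have "(cmod (rGamma_series ?z n) / rGamma_series a n)\<^sup>2 = (\<Prod>k\<le>n. 1 + v\<^sup>2 / (a + real k)\<^sup>2)" for n
  proof -
    have 1: "cmod (exp (?z * of_real (ln (of_nat n)))) = exp (a * ln (real n))"
      by (simp add: norm_exp_eq_Re)
    have "cmod (rGamma_series ?z n) / rGamma_series a n = cmod (pochhammer ?z (n+1)) / pochhammer a (n+1)"
      unfolding rGamma_series_def norm_divide norm_mult 1 by (simp add: norm_fact)
    also have "\<dots> = (\<Prod>k\<le>n. cmod (?z + of_nat k) / (a + real k))"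
      unfolding pochhammer_prod prod_norm[symmetric] prod_dividef
      by (simp add: atLeast0LessThan lessThan_Suc_atMost)
    finally have "(cmod (rGamma_series ?z n) / rGamma_series a n)\<^sup>2 = (\<Prod>k\<le>n. (cmod (?z + of_nat k) / (a + real k))\<^sup>2)"
      by (simp add: prod_power_distrib)
    also have "\<dots> = (\<Prod>k\<le>n. 1 + v\<^sup>2 / (a + real k)\<^sup>2)"
    proof (rule prod.cong[OF refl])
      fix k
      have "?z + of_nat k = Complex (a + real k) v" by (simp add: complex_eq_iff)
      moreover have "a + real k > 0" using assms by simp
      ultimately show "(cmod (?z + of_nat k) / (a + real k))\<^sup>2 = 1 + v\<^sup>2 / (a + real k)\<^sup>2"
        by (simp add: power_divide cmod_def add_divide_distrib)
    qed
    finally show ?thesis .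
  qed
  ultimately show ?thesis by (simp add: Gamma_def divide_inverse mult.commute)
qed

text \<open>Hoelder's inequality for the pairs $(1,x)$ and $(1,y)$: after division by the right-hand side it is
  the sum of two instances of the weighted inequality of the means, whose upper bounds add up to 1.\<close>

lemma Holder_two_terms:
  fixes x y \<theta> :: real
  assumes "x \<ge> 0" "y \<ge> 0" "0 \<le> \<theta>" "\<theta> \<le> 1"
  shows "1 + x powr (1 - \<theta>) * y powr \<theta> \<le> (1 + x) powr (1 - \<theta>) * (1 + y) powr \<theta>"
proof (cases "x = 0 \<or> y = 0")
  case True
  have "1 \<le> (1 + x) powr (1 - \<theta>) * (1 + y) powr \<theta>"
    using mult_mono[of 1 "(1 + x) powr (1 - \<theta>)" 1 "(1 + y) powr \<theta>"] assms
    by (simp add: ge_one_powr_ge_zero)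
  with True show ?thesis by auto
next
  case False
  with assms have pos: "x > 0" "y > 0" by auto
  have 1: "(1 / (1 + x)) powr (1 - \<theta>) * (1 / (1 + y)) powr \<theta> \<le> (1 - \<theta>) * (1 / (1 + x)) + \<theta> * (1 / (1 + y))"
    using assms pos by (intro Youngs_inequality_0) auto
  have 2: "(x / (1 + x)) powr (1 - \<theta>) * (y / (1 + y)) powr \<theta> \<le> (1 - \<theta>) * (x / (1 + x)) + \<theta> * (y / (1 + y))"
    using assms pos by (intro Youngs_inequality_0) auto
  have 3: "(1 - \<theta>) * (1 / (1 + x)) + \<theta> * (1 / (1 + y)) + ((1 - \<theta>) * (x / (1 + x)) + \<theta> * (y / (1 + y))) = 1"
  proof -
    have "1 / (1 + x) + x / (1 + x) = 1" "1 / (1 + y) + y / (1 + y) = 1"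
      using pos by (simp_all add: add_divide_distrib[symmetric])
    then show ?thesis by (metis (no_types, lifting) add.commute add.left_commute diff_add_cancel distrib_left mult.right_neutral)
  qed
  let ?D = "(1 + x) powr (1 - \<theta>) * (1 + y) powr \<theta>"
  have D: "?D > 0" using pos by simp
  have "(1 + x powr (1 - \<theta>) * y powr \<theta>) / ?D \<le> 1"
    using 1 2 3 assms pos by (simp add: powr_divide add_divide_distrib)
  with D show ?thesis by (simp add: divide_le_eq)
qed

text \<open>By the weighted inequality of the means, $1/t$ is log-convex, and by Hoelder's inequality adding
  the constant 1 to a log-convex function keeps it log-convex.\<close>

lemma one_plus_inverse_square_log_convex:
  fixes s r v \<theta> :: real
  assumes "s > 0" "r > 0" "0 \<le> \<theta>" "\<theta> \<le> 1"
  shows "1 + v\<^sup>2 / ((1 - \<theta>) * s + \<theta> * r)\<^sup>2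
    \<le> (1 + v\<^sup>2 / s\<^sup>2) powr (1 - \<theta>) * (1 + v\<^sup>2 / r\<^sup>2) powr \<theta>"
proof -
  define a where "a = (1 - \<theta>) * s + \<theta> * r"
  let ?g = "s powr (1 - \<theta>) * r powr \<theta>"
  have g: "?g \<le> a" unfolding a_def
    using assms by (intro Youngs_inequality_0) auto
  have gpos: "?g > 0" using assms by simp
  have "(v\<^sup>2 / s\<^sup>2) powr (1 - \<theta>) * (v\<^sup>2 / r\<^sup>2) powr \<theta>
      = (v\<^sup>2) powr (1 - \<theta>) * (v\<^sup>2) powr \<theta> / (?g)\<^sup>2"
    using assms by (simp add: powr_divide power_mult_distrib powr_power[symmetric] powr_powr power2_eq_square powr_mult)
  also have "(v\<^sup>2) powr (1 - \<theta>) * (v\<^sup>2) powr \<theta> = v\<^sup>2"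
    by (subst powr_add[symmetric]) simp
  finally have e: "(v\<^sup>2 / s\<^sup>2) powr (1 - \<theta>) * (v\<^sup>2 / r\<^sup>2) powr \<theta> = v\<^sup>2 / (?g)\<^sup>2" .
  have "a\<^sup>2 > 0" "(?g)\<^sup>2 > 0" "(?g)\<^sup>2 \<le> a\<^sup>2"
    using g gpos by (auto intro!: power_mono zero_less_power)
  then have "v\<^sup>2 / a\<^sup>2 \<le> v\<^sup>2 / (?g)\<^sup>2"
    by (intro divide_left_mono mult_pos_pos) auto
  with Holder_two_terms[of "v\<^sup>2 / s\<^sup>2" "v\<^sup>2 / r\<^sup>2" \<theta>] e assms show ?thesis
    unfolding a_def by simp
qed

text \<open>Log-convexity passes from the factors to finite products and to the limit. It bounds
  $1/|\Gamma(a+iv)|$ at intermediate \<open>a\<close> by its values at two points, a substitute for the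
  three lines theorem.\<close>

lemma Gamma_ratio_log_convex:
  fixes s r v \<theta> :: real
  assumes "s > 0" "r > 0" "0 \<le> \<theta>" "\<theta> \<le> 1"
  defines "a \<equiv> (1 - \<theta>) * s + \<theta> * r"
  shows "(Gamma a * cmod (rGamma (Complex a v)))\<^sup>2
    \<le> (Gamma s * cmod (rGamma (Complex s v)))\<^sup>2 powr (1 - \<theta>)
      * (Gamma r * cmod (rGamma (Complex r v)))\<^sup>2 powr \<theta>"
proof -
  have a: "a > 0"
    using Youngs_inequality_0[of "1-\<theta>" \<theta> s r] assms
    by (smt (verit) mult_pos_pos powr_gt_zero)
  have nz: "Gamma t * cmod (rGamma (Complex t v)) \<noteq> 0" if "t > 0" for t
  proof -
    have "Complex t v \<notin> \<int>\<^sub>\<le>\<^sub>0" "t \<notin> \<int>\<^sub>\<le>\<^sub>0"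
      using that by (auto elim!: nonpos_Ints_cases simp: complex_eq_iff)
    then show ?thesis by (simp add: rGamma_eq_zero_iff Gamma_eq_zero_iff)
  qed
  show ?thesis
  proof (rule LIMSEQ_le)
    show "(\<lambda>n. \<Prod>k\<le>n. 1 + v\<^sup>2 / (a + real k)\<^sup>2) \<longlonglongrightarrow> (Gamma a * cmod (rGamma (Complex a v)))\<^sup>2"
      by (rule Gamma_ratio_LIMSEQ[OF a])
    show "(\<lambda>n. (\<Prod>k\<le>n. 1 + v\<^sup>2 / (s + real k)\<^sup>2) powr (1 - \<theta>) * (\<Prod>k\<le>n. 1 + v\<^sup>2 / (r + real k)\<^sup>2) powr \<theta>)
      \<longlonglongrightarrow> (Gamma s * cmod (rGamma (Complex s v)))\<^sup>2 powr (1 - \<theta>)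
      * (Gamma r * cmod (rGamma (Complex r v)))\<^sup>2 powr \<theta>"
      using nz assms by (intro tendsto_mult tendsto_powr tendsto_const Gamma_ratio_LIMSEQ) auto
    show "\<exists>N. \<forall>n\<ge>N. (\<Prod>k\<le>n. 1 + v\<^sup>2 / (a + real k)\<^sup>2)
        \<le> (\<Prod>k\<le>n. 1 + v\<^sup>2 / (s + real k)\<^sup>2) powr (1 - \<theta>) * (\<Prod>k\<le>n. 1 + v\<^sup>2 / (r + real k)\<^sup>2) powr \<theta>"
    proof (intro exI allI impI)
      fix n :: nat
      have "(\<Prod>k\<le>n. 1 + v\<^sup>2 / (a + real k)\<^sup>2)
          \<le> (\<Prod>k\<le>n. (1 + v\<^sup>2 / (s + real k)\<^sup>2) powr (1 - \<theta>) * (1 + v\<^sup>2 / (r + real k)\<^sup>2) powr \<theta>)"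
      proof (rule prod_mono, intro conjI)
        fix k
        have "a + real k = (1 - \<theta>) * (s + real k) + \<theta> * (r + real k)"
          by (simp add: a_def algebra_simps)
        then show "1 + v\<^sup>2 / (a + real k)\<^sup>2 \<le> (1 + v\<^sup>2 / (s + real k)\<^sup>2) powr (1 - \<theta>) * (1 + v\<^sup>2 / (r + real k)\<^sup>2) powr \<theta>"
          using one_plus_inverse_square_log_convex[of "s + real k" "r + real k" \<theta> v] assms by simp
      qed simp
      then show "(\<Prod>k\<le>n. 1 + v\<^sup>2 / (a + real k)\<^sup>2)
        \<le> (\<Prod>k\<le>n. 1 + v\<^sup>2 / (s + real k)\<^sup>2) powr (1 - \<theta>) * (\<Prod>k\<le>n. 1 + v\<^sup>2 / (r + real k)\<^sup>2) powr \<theta>"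
        by (simp add: prod.distrib prod_powr_distrib)
    qed
  qed
qed

lemma Gamma_ratio_antimono:
  fixes a b v :: real
  assumes "0 < a" "a \<le> b"
  shows "(Gamma b * cmod (rGamma (Complex b v)))\<^sup>2 \<le> (Gamma a * cmod (rGamma (Complex a v)))\<^sup>2"
proof (rule LIMSEQ_le[OF Gamma_ratio_LIMSEQ Gamma_ratio_LIMSEQ])
  show "\<exists>N. \<forall>n\<ge>N. (\<Prod>k\<le>n. 1 + v\<^sup>2 / (b + real k)\<^sup>2) \<le> (\<Prod>k\<le>n. 1 + v\<^sup>2 / (a + real k)\<^sup>2)"
    using assms by (intro exI allI impI prod_mono conjI add_left_mono divide_left_mono power_mono)
      (auto intro!: mult_pos_pos)
qed (use assms in auto)

lemma cos_i_times_of_real: "cos (\<i> * complex_of_real u) = of_real (cosh u)"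
  by (simp add: cos_exp_eq cosh_def exp_of_real scaleR_conv_of_real add.commute flip: of_real_minus)

lemma sin_i_times_of_real: "sin (\<i> * complex_of_real u) = \<i> * of_real (sinh u)"
  by (simp add: sin_i_times sinh_def exp_of_real scaleR_conv_of_real exp_minus)

text \<open>The reflection formula at $z = 1/2 + iv$, where $1 - z$ is the conjugate of \<open>z\<close>.\<close>

lemma norm_rGamma_half: "(cmod (rGamma (Complex (1/2) v)))\<^sup>2 = cosh (pi * v) / pi"
proof -
  let ?z = "Complex (1/2) v"
  have "complex_of_real ((cmod (rGamma ?z))\<^sup>2) = rGamma ?z * rGamma (1 - ?z)"
  proof -
    have "1 - ?z = cnj ?z" by (simp add: complex_eq_iff)
    then show ?thesis by (simp only: complex_norm_square cnj_rGamma)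
  qed
  also have "\<dots> = sin (of_real pi * ?z) / of_real pi" by (rule rGamma_reflection_complex)
  also have "of_real pi * ?z = complex_of_real pi / 2 + \<i> * of_real (pi * v)"
    by (simp add: complex_eq_iff)
  also have "sin (complex_of_real pi / 2 + \<i> * of_real (pi * v)) = of_real (cosh (pi * v))"
    by (simp add: sin_add cos_of_real_pi_half flip: cos_i_times_of_real)
  finally have "complex_of_real ((cmod (rGamma ?z))\<^sup>2) = of_real (cosh (pi * v) / pi)" by simp
  then show ?thesis by (simp only: of_real_eq_iff)
qed

text \<open>The reflection formula at $z = iv$; here $1 - z$ is the conjugate of $1 + z$, and
  $z / \Gamma(z+1) = 1/\Gamma(z)$ supplies the factor \<open>v\<close>.\<close>

lemma norm_rGamma_one: "pi * v * (cmod (rGamma (Complex 1 v)))\<^sup>2 = sinh (pi * v)"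
proof -
  let ?z = "\<i> * complex_of_real v"
  have z1: "Complex 1 v = 1 + ?z" "cnj (1 + ?z) = 1 - ?z" by (simp_all add: complex_eq_iff)
  have "\<i> * v * complex_of_real ((cmod (rGamma (1 + ?z)))\<^sup>2) = ?z * rGamma (?z + 1) * rGamma (1 - ?z)"
    unfolding complex_norm_square cnj_rGamma z1(2) by (simp add: add.commute)
  also have "?z * rGamma (?z + 1) = rGamma ?z" by (rule rGamma_plus1)
  also have "rGamma ?z * rGamma (1 - ?z) = sin (of_real pi * ?z) / of_real pi"
    by (rule rGamma_reflection_complex)
  also have "of_real pi * ?z = \<i> * of_real (pi * v)" by simp
  also have "sin (\<i> * of_real (pi * v)) = \<i> * of_real (sinh (pi * v))"
    by (rule sin_i_times_of_real)
  finally have "\<i> * complex_of_real (pi * v * (cmod (rGamma (1 + ?z)))\<^sup>2) = \<i> * of_real (sinh (pi * v))"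
    by (simp add: field_simps)
  then show ?thesis unfolding z1 by (simp only: mult_cancel_left of_real_eq_iff) simp
qed

text \<open>A form of $1 - e^{-w} \le \min(1,w)$ that is convenient in quotients.\<close>

lemma one_minus_exp_le:
  fixes w :: real
  assumes "w \<ge> 0"
  shows "1 - exp (- w) \<le> 2 * w / (1 + w)"
proof (cases "w \<le> 1")
  case True
  have "1 - exp (- w) \<le> w" using exp_ge_add_one_self[of "-w"] by simp
  also have "w \<le> 2 * w / (1 + w)" using assms True by (simp add: field_simps) (simp add: mult_left_le)
  finally show ?thesis .
next
  case False
  have "1 - exp (- w) \<le> 1" by simp
  also have "1 \<le> 2 * w / (1 + w)" using False by (simp add: field_simps)
  finally show ?thesis .
qed

lemma norm_rGamma_one_le: "(cmod (rGamma (Complex 1 v)))\<^sup>2 \<le> 2 * exp (pi * \<bar>v\<bar>) / (1 + \<bar>v\<bar>)"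
proof -
  have main: "(cmod (rGamma (Complex 1 v)))\<^sup>2 \<le> 2 * exp (pi * v) / (1 + v)" if "v \<ge> 0" for v
  proof (cases "v = 0")
    case True
    have "Complex 1 0 = 1" by (simp add: complex_eq_iff)
    with True show ?thesis by simp
  next
    case False
    define u where "u = pi * v"
    have u: "u > 0" "v \<le> 2 * u" using False that pi_ge_two 
      mult_right_mono[of 1 "2 * pi" v] by (auto simp: u_def)
    have "(cmod (rGamma (Complex 1 v)))\<^sup>2 = sinh u / u"
      using norm_rGamma_one[of v] u(1) unfolding u_def[symmetric] by (simp add: eq_divide_eq mult.commute)
    also have "sinh u / u = exp u * (1 - exp (- (2 * u))) / (2 * u)"
      by (simp add: sinh_def field_simps flip: exp_add)
    also have "\<dots> \<le> exp u * (2 * (2 * u) / (1 + 2 * u)) / (2 * u)"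
      using u by (intro divide_right_mono mult_left_mono one_minus_exp_le) auto
    also have "\<dots> = 2 * exp u / (1 + 2 * u)"
    proof -
      have "x * (2 * y / z) / y = 2 * x / z" if "y > 0" for x y z :: real using that by simp
      from this[of "2 * u" "exp u" "1 + 2 * u"] u(1) show ?thesis by simp
    qed
    also have "\<dots> \<le> 2 * exp u / (1 + v)" using u that by (intro divide_left_mono) auto
    finally show ?thesis by (simp add: u_def)
  qed
  have "cmod (rGamma (Complex 1 (-v))) = cmod (rGamma (Complex 1 v))" for v
  proof -
    have "Complex 1 (-v) = cnj (Complex 1 v)" by (simp add: complex_eq_iff)
    then show ?thesis by (simp flip: cnj_rGamma)
  qed
  then show ?thesis using main[of v] main[of "-v"] by (cases "v \<ge> 0") (auto simp: abs_if)
qed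

lemma cosh_le_exp_abs: "cosh (pi * v) \<le> exp (pi * \<bar>v :: real\<bar>)"
proof -
  have "exp (pi * v) \<le> exp (pi * \<bar>v\<bar>)" "exp (- (pi * v)) \<le> exp (pi * \<bar>v\<bar>)"
    using mult_left_mono[of v "\<bar>v\<bar>" pi] mult_left_mono[of "-v" "\<bar>v\<bar>" pi] by auto
  moreover have "(a + b) / 2 \<le> c" if "a \<le> c" "b \<le> c" for a b c :: real
    using that by simp
  ultimately show ?thesis unfolding cosh_field_def by blast
qed

lemma norm_rGamma_three_halves_le:
  "(Gamma (3/2) * cmod (rGamma (Complex (3/2) v)))\<^sup>2 \<le> 2 * exp (pi * \<bar>v\<bar>) / (1 + \<bar>v\<bar>)\<^sup>2"
proof -
  let ?z = "Complex (1/2) v"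
  have z: "?z + 1 = Complex (3/2) v" "?z \<noteq> 0" by (simp_all add: complex_eq_iff)
  have nz: "(cmod ?z)\<^sup>2 = 1/4 + v\<^sup>2" by (simp add: cmod_def power2_eq_square)
  have "?z * rGamma (Complex (3/2) v) = rGamma ?z"
    using rGamma_plus1[of ?z] z by simp
  then have "(cmod (?z * rGamma (Complex (3/2) v)))\<^sup>2 = cosh (pi * v) / pi"
    by (simp add: norm_rGamma_half)
  then have 1: "(1/4 + v\<^sup>2) * (cmod (rGamma (Complex (3/2) v)))\<^sup>2 = cosh (pi * v) / pi"
    by (simp add: norm_mult power_mult_distrib nz)
  have "(1/2 :: real) \<notin> \<int>\<^sub>\<le>\<^sub>0" by (auto elim!: nonpos_Ints_cases)
  then have "Gamma (3/2 :: real) = (1/2) * Gamma (1/2)"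
    using Gamma_plus1[of "1/2 :: real"] by simp
  then have g: "(Gamma (3/2 :: real))\<^sup>2 = pi / 4" by (simp only: Gamma_one_half_real power_mult_distrib) (simp add: power_divide)
  have pos: "1/4 + v\<^sup>2 > 0" by (simp add: add_pos_nonneg)
  have "(Gamma (3/2) * cmod (rGamma (Complex (3/2) v)))\<^sup>2 = cosh (pi * v) / (1 + 4 * v\<^sup>2)"
  proof -
    have "(cmod (rGamma (Complex (3/2) v)))\<^sup>2 = (cosh (pi * v) / pi) / (1/4 + v\<^sup>2)"
      using 1 pos by (simp add: eq_divide_eq mult.commute)
    moreover have "1 + 4 * v\<^sup>2 = 4 * (1/4 + v\<^sup>2)" by simp
    ultimately show ?thesis unfolding power_mult_distrib g by simp
  qed
  also have "\<dots> \<le> exp (pi * \<bar>v\<bar>) / (1 + 4 * v\<^sup>2)"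
    by (intro divide_right_mono cosh_le_exp_abs) (simp add: add_nonneg_nonneg)
  also have "\<dots> = 2 * exp (pi * \<bar>v\<bar>) / (2 * (1 + 4 * v\<^sup>2))" by (rule mult_divide_mult_cancel_left[symmetric]) simp
  also have "\<dots> \<le> 2 * exp (pi * \<bar>v\<bar>) / (1 + \<bar>v\<bar>)\<^sup>2"
  proof (rule divide_left_mono)
    have "0 \<le> (1 - \<bar>v\<bar>)\<^sup>2" by simp
    then have "(1 + \<bar>v\<bar>)\<^sup>2 \<le> 2 * (1 + \<bar>v\<bar>\<^sup>2)" by (simp add: power2_eq_square algebra_simps)
    also have "\<dots> \<le> 2 * (1 + 4 * v\<^sup>2)" by simp
    finally show "(1 + \<bar>v\<bar>)\<^sup>2 \<le> 2 * (1 + 4 * v\<^sup>2)" .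
    show "0 < 2 * (1 + 4 * v\<^sup>2) * (1 + \<bar>v\<bar>)\<^sup>2"
      by (intro mult_pos_pos zero_less_power add_pos_nonneg) auto
  qed simp
  finally show ?thesis .
qed

text \<open>Log-convexity cannot be used around \<open>a\<close> itself, since $\Gamma$ has a pole at 0. It is used at
  $a+1 = (1-2a) \cdot 1 + 2a \cdot 3/2$, where the end point bounds contribute the powers
  $(1+|v|)^{-(1-2a)}$ and $(1+|v|)^{-4a}$. The functional equation returns to \<open>a\<close> at the cost of
  $(1+|v|)^2$, which leaves the exponent $1 - 2a$ for the square.\<close>

lemma norm_rGamma_le_small:
  fixes a v :: real
  assumes "0 < a" "a \<le> 1/2"
  shows "cmod (rGamma (Complex a v))
    \<le> sqrt 2 / Gamma (a + 1) * (1 + \<bar>v\<bar>) powr (1/2 - a) * exp (pi * \<bar>v\<bar> / 2)"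
proof -
  let ?w = "1 + \<bar>v\<bar>" and ?E = "2 * exp (pi * \<bar>v\<bar>)"
  have G: "Gamma (a + 1) > 0" using assms by simp
  have e: "(1 - 2 * a) * 1 + 2 * a * (3/2) = a + 1" by (simp add: algebra_simps)
  have "(Gamma (a + 1) * cmod (rGamma (Complex (a + 1) v)))\<^sup>2
    \<le> (Gamma 1 * cmod (rGamma (Complex 1 v)))\<^sup>2 powr (1 - 2 * a)
      * (Gamma (3/2) * cmod (rGamma (Complex (3/2) v)))\<^sup>2 powr (2 * a)"
    using Gamma_ratio_log_convex[of 1 "3/2" "2 * a" v] assms unfolding e by simp
  also have "\<dots> \<le> (?E / ?w) powr (1 - 2 * a) * (?E / ?w\<^sup>2) powr (2 * a)"
    using norm_rGamma_one_le[of v] norm_rGamma_three_halves_le[of v] assms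
    by (intro mult_mono powr_mono2) auto
  also have "\<dots> = ?E * ?w powr (- 1 - 2 * a)"
  proof -
    have "(?E / ?w) powr (1 - 2 * a) * (?E / ?w\<^sup>2) powr (2 * a)
       = (?E powr (1 - 2 * a) * ?E powr (2 * a)) / (?w powr (1 - 2 * a) * (?w\<^sup>2) powr (2 * a))"
      by (simp add: powr_divide)
    also have "?E powr (1 - 2 * a) * ?E powr (2 * a) = ?E" by (subst powr_add[symmetric]) simp
    also have "?w\<^sup>2 = ?w powr 2" by simp
    also have "?w powr (1 - 2 * a) * (?w powr 2) powr (2 * a) = ?w powr (1 + 2 * a)"
      by (simp only: powr_powr powr_add[symmetric]) (simp add: add.commute)
    finally show ?thesis by (simp only: powr_minus_divide minus_add_distrib[symmetric] diff_conv_add_uminus) simp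
  qed
  finally have 1: "(Gamma (a + 1) * cmod (rGamma (Complex (a + 1) v)))\<^sup>2 \<le> ?E * ?w powr (- 1 - 2 * a)" .
  have "Complex a v * rGamma (Complex a v + 1) = rGamma (Complex a v)"
    by (rule rGamma_plus1)
  moreover have "Complex a v + 1 = Complex (a + 1) v" by (simp add: complex_eq_iff)
  ultimately have "cmod (rGamma (Complex a v)) = cmod (Complex a v) * cmod (rGamma (Complex (a + 1) v))"
    by (metis norm_mult)
  also have "cmod (Complex a v) \<le> ?w"
    using cmod_le[of "Complex a v"] assms by simp
  finally have 2: "cmod (rGamma (Complex a v)) \<le> ?w * cmod (rGamma (Complex (a + 1) v))"
    by (simp add: mult_right_mono)
  have "(Gamma (a + 1) * cmod (rGamma (Complex a v)))\<^sup>2 \<le> (?w * (Gamma (a + 1) * cmod (rGamma (Complex (a + 1) v))))\<^sup>2"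
    using 2 G by (intro power_mono) (auto simp: mult.left_commute)
  also have "\<dots> \<le> ?w\<^sup>2 * (?E * ?w powr (- 1 - 2 * a))"
    unfolding power_mult_distrib[of ?w] using 1 by (intro mult_left_mono) auto
  also have "\<dots> = (sqrt 2 * ?w powr (1/2 - a) * exp (pi * \<bar>v\<bar> / 2))\<^sup>2"
  proof -
    have "?w\<^sup>2 * ?w powr (- 1 - 2 * a) = ?w powr (1 - 2 * a)"
    proof -
      have "?w\<^sup>2 = ?w powr 2" by simp
      then show ?thesis by (simp only: powr_add[symmetric]) simp
    qed
    moreover have "(?w powr (1/2 - a))\<^sup>2 = ?w powr (1 - 2 * a)"
      by (simp add: powr_power algebra_simps)
    moreover have "(exp (pi * \<bar>v\<bar> / 2))\<^sup>2 = exp (pi * \<bar>v\<bar>)"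
      by (simp flip: exp_double)
    ultimately show ?thesis by (simp add: power_mult_distrib)
  qed
  finally have "Gamma (a + 1) * cmod (rGamma (Complex a v)) \<le> sqrt 2 * ?w powr (1/2 - a) * exp (pi * \<bar>v\<bar> / 2)"
    by (rule power2_le_imp_le) auto
  then show ?thesis using G by (simp add: field_simps)
qed

text \<open>To the right of $1/2$ monotonicity is enough, because at $1/2$ there is no power of \<open>v\<close>.\<close>

lemma norm_rGamma_le_large:
  fixes a v :: real
  assumes "1/2 \<le> a"
  shows "cmod (rGamma (Complex a v)) \<le> 1 / Gamma a * exp (pi * \<bar>v\<bar> / 2)"
proof -
  have G: "Gamma a > 0" using assms by simp
  have "(Gamma a * cmod (rGamma (Complex a v)))\<^sup>2 \<le> (Gamma (1/2) * cmod (rGamma (Complex (1/2) v)))\<^sup>2"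
    by (rule Gamma_ratio_antimono) (use assms in auto)
  also have "\<dots> = cosh (pi * v)" by (simp add: power_mult_distrib norm_rGamma_half Gamma_one_half_real)
  also have "\<dots> \<le> (exp (pi * \<bar>v\<bar> / 2))\<^sup>2" using cosh_le_exp_abs[of v] by (simp flip: exp_double)
  finally have "Gamma a * cmod (rGamma (Complex a v)) \<le> exp (pi * \<bar>v\<bar> / 2)"
    by (rule power2_le_imp_le) auto
  then show ?thesis using G by (simp add: field_simps)
qed

lemma norm_rGamma_line_bound:
  fixes \<gamma> :: real
  assumes "1/2 < \<gamma>"
  obtains K where "K > 0"
    "\<And>v. cmod (rGamma (Complex (\<gamma> - 1/2) v)) \<le> K * (1 + \<bar>v\<bar>) powr max 0 (1 - \<gamma>) * exp (pi * \<bar>v\<bar> / 2)"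
proof (cases "\<gamma> < 1")
  case True
  have m: "max 0 (1 - \<gamma>) = 1/2 - (\<gamma> - 1/2)" using True by simp
  show ?thesis
  proof (rule that)
    show "sqrt 2 / Gamma (\<gamma> - 1/2 + 1) > 0" using assms by simp
    show "cmod (rGamma (Complex (\<gamma> - 1/2) v))
        \<le> sqrt 2 / Gamma (\<gamma> - 1/2 + 1) * (1 + \<bar>v\<bar>) powr max 0 (1 - \<gamma>) * exp (pi * \<bar>v\<bar> / 2)" for v
      unfolding m by (rule norm_rGamma_le_small) (use assms True in auto)
  qed
next
  case False
  show ?thesis
  proof (rule that)
    show "1 / Gamma (\<gamma> - 1/2) > 0" using assms by simp
    show "cmod (rGamma (Complex (\<gamma> - 1/2) v))
        \<le> 1 / Gamma (\<gamma> - 1/2) * (1 + \<bar>v\<bar>) powr max 0 (1 - \<gamma>) * exp (pi * \<bar>v\<bar> / 2)" for v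
      using norm_rGamma_le_large[of "\<gamma> - 1/2" v] False by simp
  qed
qed

lemma continuous_on_rGamma_line: "continuous_on A (\<lambda>v. rGamma (Complex a v))"
  unfolding Complex_eq
  by (rule continuous_on_compose2[OF continuous_on_rGamma[of UNIV]]) (auto intro!: continuous_intros)

text \<open>The squared norm of the inversion kernel, uniformly in \<open>h\<close>. For large \<open>h\<close> the interval of
  integration is short, and the factor $1 - e^{-\pi/h}$ that comes from its length compensates the
  smallness of $h^{2(\gamma-1)}$.\<close>

lemma rGamma_line_integral_bound:
  fixes \<gamma> :: real
  assumes "1/2 < \<gamma>"
  obtains C where "C > 0"
    "\<And>h. h > 0 \<Longrightarrow> (LINT v:{-1/h..1/h}|lborel. cmod (rGamma (Complex (\<gamma> - 1/2) v)))\<^sup>2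
       \<le> C * (if \<gamma> < 1 then h powr (2 * (\<gamma> - 1)) * exp (pi / h) else exp (pi / h))"
proof -
  define p where "p = max 0 (1 - \<gamma>)"
  have p: "0 \<le> p" "p \<le> 1" using assms by (auto simp: p_def)
  obtain K where K: "K > 0"
    "\<And>v. cmod (rGamma (Complex (\<gamma> - 1/2) v)) \<le> K * (1 + \<bar>v\<bar>) powr p * exp (pi * \<bar>v\<bar> / 2)"
    using norm_rGamma_line_bound[OF assms] unfolding p_def by metis
  have J: "(LINT v:{-w..w}|lborel. cmod (rGamma (Complex (\<gamma> - 1/2) v))) \<le> 8 * K * w powr p * exp (pi * w / 2)"
    if w: "w > 0" for w
  proof -
    \<comment> \<open>The sum of both exponentials is a smooth majorant of $e^{\pi|v|/2}$; near $w = 0$ its integral is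
      still of order \<open>w\<close>.\<close>
    let ?g = "\<lambda>v. K * (1 + w) powr p * (exp (pi / 2 * v) + exp (- (pi / 2 * v)))"
    let ?G = "\<lambda>v. K * (1 + w) powr p * (2 / pi * (exp (pi / 2 * v) - exp (- (pi / 2 * v))))"
    have int: "has_bochner_integral lborel (\<lambda>v. ?g v * indicator {-w..w} v) (?G w - ?G (-w))"
      by (rule has_bochner_integral_FTC_Icc_real)
        (use w in \<open>auto intro!: derivative_eq_intros continuous_intros simp: field_simps\<close>)
    have "(LINT v:{-w..w}|lborel. cmod (rGamma (Complex (\<gamma> - 1/2) v))) \<le> (LINT v:{-w..w}|lborel. ?g v)"
    proof (rule set_integral_mono)
      show "set_integrable lborel {-w..w} (\<lambda>v. cmod (rGamma (Complex (\<gamma> - 1/2) v)))"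
        by (intro borel_integrable_atLeastAtMost' continuous_intros continuous_on_rGamma_line)
      show "set_integrable lborel {-w..w} ?g"
        by (intro borel_integrable_atLeastAtMost' continuous_intros)
      fix v assume v: "v \<in> {-w..w}"
      have "exp (pi * \<bar>v\<bar> / 2) \<le> exp (pi / 2 * v) + exp (- (pi / 2 * v))"
        by (cases "v \<ge> 0") (simp_all add: abs_if mult.commute)
      moreover have "(1 + \<bar>v\<bar>) powr p \<le> (1 + w) powr p"
        using v p by (intro powr_mono2) auto
      ultimately have "K * (1 + \<bar>v\<bar>) powr p * exp (pi * \<bar>v\<bar> / 2) \<le> ?g v"
        using K(1) by (intro mult_mono) auto
      with K(2)[of v] show "cmod (rGamma (Complex (\<gamma> - 1/2) v)) \<le> ?g v" by linarith
    qed
    also have "\<dots> = ?G w - ?G (-w)"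
      using has_bochner_integral_integral_eq[OF int]
      by (simp only: set_lebesgue_integral_def real_scaleR_def mult.commute[of "indicator _ _"])
    also have "\<dots> = 4 / pi * K * (1 + w) powr p * exp (pi * w / 2) * (1 - exp (- (pi * w)))"
      by (simp add: field_simps flip: exp_add)
    also have "\<dots> \<le> 4 / pi * K * (1 + w) powr p * exp (pi * w / 2) * (2 * pi * (w / (1 + w)))"
    proof (rule mult_left_mono)
      have "1 - exp (- (pi * w)) \<le> 2 * (pi * w) / (1 + pi * w)" by (rule one_minus_exp_le) (use w in simp)
      also have "\<dots> \<le> 2 * (pi * w) / (1 + w)"
        using w pi_ge_two mult_right_mono[of 1 pi w] by (intro divide_left_mono mult_pos_pos add_pos_pos) auto
      finally show "1 - exp (- (pi * w)) \<le> 2 * pi * (w / (1 + w))" by simp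
    qed (use K w in auto)
    also have "\<dots> = 8 * K * exp (pi * w / 2) * ((1 + w) powr p * (w / (1 + w)))"
      by simp
    \<comment> \<open>$(1+w)^p \, \frac{w}{1+w} = w^p \bigl(\frac{w}{1+w}\bigr)^{1-p} \le w^p$\<close>
    also have "\<dots> \<le> 8 * K * exp (pi * w / 2) * w powr p"
    proof (rule mult_left_mono)
      have "w / (1 + w) = (w / (1 + w)) powr p * (w / (1 + w)) powr (1 - p)"
        using w by (subst powr_add[symmetric]) simp
      also have "\<dots> \<le> (w / (1 + w)) powr p * 1"
        using w p by (intro mult_left_mono powr_le1) auto
      also have "\<dots> = w powr p / (1 + w) powr p"
        using w by (simp add: powr_divide)
      finally have "w / (1 + w) \<le> w powr p / (1 + w) powr p" .
      then have "(1 + w) powr p * (w / (1 + w)) \<le> (1 + w) powr p * (w powr p / (1 + w) powr p)"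
        by (rule mult_left_mono) simp
      then show "(1 + w) powr p * (w / (1 + w)) \<le> w powr p" using w by simp
    qed (use K in auto)
    finally show ?thesis by (simp add: mult_ac)
  qed
  show ?thesis
  proof (rule that)
    show "(8 * K)\<^sup>2 > 0" using K(1) by simp
    fix h :: real assume h: "h > 0"
    let ?J = "LINT v:{-1/h..1/h}|lborel. cmod (rGamma (Complex (\<gamma> - 1/2) v))"
    have nonneg: "0 \<le> ?J" unfolding set_lebesgue_integral_def
      by (rule Bochner_Integration.integral_nonneg) simp
    have "?J \<le> 8 * K * (1/h) powr p * exp (pi * (1/h) / 2)" using J[of "1/h"] h by simp
    then have "?J\<^sup>2 \<le> (8 * K * (1/h) powr p * exp (pi * (1/h) / 2))\<^sup>2"
      using nonneg by (intro power_mono)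
    also have "\<dots> = (8 * K)\<^sup>2 * ((1/h) powr (2 * p) * exp (pi / h))"
    proof -
      have "((1/h) powr p)\<^sup>2 = (1/h) powr (2 * p)"
        unfolding power2_eq_square by (simp only: powr_add[symmetric] mult_2)
      moreover have "(exp (pi * (1/h) / 2))\<^sup>2 = exp (pi / h)"
        by (simp flip: exp_double)
      ultimately show ?thesis by (simp only: power_mult_distrib mult.assoc)
    qed
    also have "(1/h) powr (2 * p) * exp (pi / h) = (if \<gamma> < 1 then h powr (2 * (\<gamma> - 1)) * exp (pi / h) else exp (pi / h))"
      using h by (auto simp: p_def powr_divide powr_minus_divide[symmetric] algebra_simps)
    finally show "?J\<^sup>2 \<le> (8 * K)\<^sup>2 * (if \<gamma> < 1 then h powr (2 * (\<gamma> - 1)) * exp (pi / h) else exp (pi / h))" .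
  qed
qed

section \<open>Mellin inversion\<close>

text \<open>The positive and the negative part of \<open>u\<close> are densities of two finite measures with the same
  distribution function.\<close>

lemma AE_zero_if_integrals_zero:
  fixes u :: "real \<Rightarrow> real"
  assumes int: "set_integrable lborel {a<..b} u"
    and zero: "\<And>x. a < x \<Longrightarrow> x \<le> b \<Longrightarrow> (LINT y:{a<..x}|lborel. u y) = 0"
  shows "AE x in lborel. x \<in> {a<..b} \<longrightarrow> u x = 0"
proof -
  define w where "w x = indicator {a<..b} x * u x" for x
  define f where "f x = max 0 (w x)" for x
  define g where "g x = max 0 (- w x)" for x
  have w: "integrable lborel w"
    using int by (simp add: set_integrable_def w_def[abs_def])
  have f: "integrable lborel f" and g: "integrable lborel g"
    unfolding f_def[abs_def] g_def[abs_def] using w by (auto intro!: integrable_max)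
  have nonneg: "0 \<le> f x" "0 \<le> g x" for x by (auto simp: f_def g_def)
  have [measurable]: "f \<in> borel_measurable borel" "g \<in> borel_measurable borel"
    using borel_measurable_integrable[OF f] borel_measurable_integrable[OF g] by simp_all
  have fin: "finite_borel_measure (density lborel (\<lambda>x. ennreal (k x)))"
    if "integrable lborel k" "\<And>x. 0 \<le> k x" for k :: "real \<Rightarrow> real"
  proof -
    from that(1) have [measurable]: "k \<in> borel_measurable borel"
      using borel_measurable_integrable[OF that(1)] by simp
    have "emeasure (density lborel (\<lambda>x. ennreal (k x))) UNIV = ennreal (integral\<^sup>L lborel k)"
      using that by (simp add: emeasure_density nn_integral_eq_integral)
    then show ?thesis
      by (auto simp: finite_borel_measure_def finite_borel_measure_axioms_def intro!: finite_measureI)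
  qed
  have em: "emeasure (density lborel (\<lambda>x. ennreal (k x))) {..x} = ennreal (\<integral>y. k y * indicator {..x} y \<partial>lborel)"
    if "integrable lborel k" "\<And>x. 0 \<le> k x" for k :: "real \<Rightarrow> real" and x
  proof -
    from that(1) have [measurable]: "k \<in> borel_measurable borel"
      using borel_measurable_integrable[OF that(1)] by simp
    have "emeasure (density lborel (\<lambda>x. ennreal (k x))) {..x} = (\<integral>\<^sup>+y. ennreal (k y * indicator {..x} y) \<partial>lborel)"
      by (simp add: emeasure_density ennreal_mult'' ennreal_indicator)
    also have "\<dots> = ennreal (\<integral>y. k y * indicator {..x} y \<partial>lborel)"
      using that by (intro nn_integral_eq_integral) (auto intro!: integrable_real_mult_indicator)
    finally show ?thesis .
  qed
  have eq: "(\<integral>y. f y * indicator {..x} y \<partial>lborel) = (\<integral>y. g y * indicator {..x} y \<partial>lborel)" for x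
  proof -
    have "(\<integral>y. f y * indicator {..x} y \<partial>lborel) - (\<integral>y. g y * indicator {..x} y \<partial>lborel)
        = (\<integral>y. w y * indicator {..x} y \<partial>lborel)"
    proof (subst Bochner_Integration.integral_diff[symmetric])
      show "integrable lborel (\<lambda>y. f y * indicator {..x} y)" "integrable lborel (\<lambda>y. g y * indicator {..x} y)"
        using f g by (auto intro: integrable_real_mult_indicator)
      have "f y * indicator {..x} y - g y * indicator {..x} y = w y * indicator {..x} y" for y
        by (simp add: f_def g_def indicator_def max_def)
      then show "(\<integral>y. f y * indicator {..x} y - g y * indicator {..x} y \<partial>lborel)
        = (\<integral>y. w y * indicator {..x} y \<partial>lborel)" by simp
    qed
    also have "\<dots> = (LINT y:{a<..min b x}|lborel. u y)"
      unfolding set_lebesgue_integral_def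
      by (intro Bochner_Integration.integral_cong) (auto simp: w_def indicator_def)
    also have "\<dots> = 0"
    proof (cases "a < min b x")
      case True then show ?thesis by (intro zero) auto
    next
      case False
      then have e: "{a<..min b x} = {}" by auto
      show ?thesis unfolding e by (simp add: set_lebesgue_integral_def)
    qed
    finally show ?thesis by simp
  qed
  have "density lborel (\<lambda>x. ennreal (f x)) = density lborel (\<lambda>x. ennreal (g x))"
  proof (rule cdf_unique')
    show "cdf (density lborel (\<lambda>x. ennreal (f x))) = cdf (density lborel (\<lambda>x. ennreal (g x)))"
      unfolding cdf_def measure_def using em[OF f nonneg(1)] em[OF g nonneg(2)] eq by auto
  qed (use fin f g nonneg in auto)
  then have "AE x in lborel. ennreal (f x) = ennreal (g x)"
    by (subst (asm) sigma_finite_measure.density_unique_iff[OF lborel.sigma_finite_measure_axioms]) auto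
  then show ?thesis
  proof (eventually_elim, intro impI)
    fix x assume "ennreal (f x) = ennreal (g x)" "x \<in> {a<..b}"
    then show "u x = 0" using nonneg[of x] by (auto simp: f_def g_def w_def max_def split: if_splits)
  qed
qed

text \<open>With an integrable characteristic function the symmetric limit in Levy's formula is an ordinary
  integral, by dominated convergence.\<close>

lemma (in real_distribution) Levy_Inversion_integrable:
  assumes ab: "a \<le> b" and char: "integrable lborel (char M)"
    and atoms: "measure M {a} = 0" "measure M {b} = 0"
  shows "complex_of_real (measure M {a<..b})
    = 1 / (2 * pi) * (CLBINT t. (iexp (-(t * a)) - iexp (-(t * b))) / (\<i> * t) * char M t)"
proof (rule LIMSEQ_unique[OF Levy_Inversion[OF ab atoms]])
  let ?F = "\<lambda>t::real. (iexp (-(t * a)) - iexp (-(t * b))) / (\<i> * t) * char M t"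
  have bound: "cmod (?F t) \<le> (b - a) * cmod (char M t)" for t
  proof (cases "t = 0")
    case False
    have "cmod ((iexp (t * (- a)) - iexp (t * (- b))) / (\<i> * t)) \<le> - a - - b"
      using ab False by (intro Levy_Inversion_aux2) auto
    then show ?thesis unfolding norm_mult by (intro mult_right_mono) auto
  qed (use ab in simp)
  have "(\<lambda>n. (CLBINT t. indicator {- real n<..<real n} t *\<^sub>R ?F t)) \<longlonglongrightarrow> (CLBINT t. ?F t)"
  proof (rule integral_dominated_convergence)
    show "integrable lborel (\<lambda>t. (b - a) * cmod (char M t))" using char by auto
    \<comment> \<open>The truncated integrands are eventually constant at every point.\<close>
    show "AE t in lborel. (\<lambda>n. indicator {- real n<..<real n} t *\<^sub>R ?F t) \<longlonglongrightarrow> ?F t"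
    proof (intro AE_I2 tendsto_eventually)
      fix t :: real
      obtain N :: nat where "\<bar>t\<bar> < real N" using reals_Archimedean2 by blast
      then show "\<forall>\<^sub>F n in sequentially. indicator {- real n<..<real n} t *\<^sub>R ?F t = ?F t"
        by (intro eventually_sequentiallyI[of N]) (auto simp: indicator_def)
    qed
    show "AE t in lborel. norm (indicator {- real n<..<real n} t *\<^sub>R ?F t) \<le> (b - a) * cmod (char M t)" for n
      using bound ab by (auto simp: indicator_def)
  qed measurable
  then have "(\<lambda>n. CLBINT t=-real n..real n. ?F t) \<longlonglongrightarrow> (CLBINT t. ?F t)"
    by (simp add: interval_lebesgue_integral_def set_lebesgue_integral_def)
  then show "(\<lambda>T. 1 / (2 * pi) * (CLBINT t=-T..T. ?F t)) \<longlonglongrightarrow> 1 / (2 * pi) * (CLBINT t. ?F t)"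
    by (intro tendsto_intros) simp
qed

lemma of_real_powr_line:
  assumes "x > 0"
  shows "complex_of_real x powr (Complex c v) = of_real (x powr c) * iexp (v * ln x)"
  using assms by (simp add: powr_def Ln_of_real Complex_eq exp_add[symmetric] exp_of_real[symmetric] algebra_simps)

lemma of_real_powr_uminus_line:
  assumes "x > 0"
  shows "complex_of_real x powr (- Complex c v) = of_real (x powr (- c)) * iexp (- (v * ln x))"
proof -
  have "- Complex c v = Complex (- c) (- v)" by (simp add: complex_eq_iff)
  then show ?thesis using of_real_powr_line[OF assms, of "- c" "- v"] by simp
qed

text \<open>On a vertical line the Mellin transform is a Fourier transform in the variable $\ln x$.\<close>

lemma mellin_on_line:
  "mellin f (Complex c v)
    = (CLBINT x. of_real (indicator {0<..} x * (f x * x powr (c - 1))) * iexp (v * ln x))"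
  unfolding mellin_def set_lebesgue_integral_def
proof (intro Bochner_Integration.integral_cong refl)
  fix x :: real
  have "Complex c v - 1 = Complex (c - 1) v" by (simp add: complex_eq_iff)
  then show "indicator {0<..} x *\<^sub>R (complex_of_real (f x) * complex_of_real x powr (Complex c v - 1))
    = of_real (indicator {0<..} x * (f x * x powr (c - 1))) * iexp (v * ln x)"
    by (cases "x > 0") (auto simp: of_real_powr_line)
qed

lemma mellin_on_line_measurable:
  assumes [measurable]: "f \<in> borel_measurable borel"
  shows "(\<lambda>v. mellin f (Complex \<gamma> v)) \<in> borel_measurable borel"
  unfolding mellin_on_line by measurable

text \<open>The increment quotient of Levy's formula as an integral over the interval $(e^a, e^b]$ of the
  original variable. Keeping that variable avoids a change of variables for sets of measure zero.\<close>

lemma iexp_diff_eq_integral: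
  assumes "a \<le> b" "t \<noteq> 0"
  shows "(iexp (-(t * a)) - iexp (-(t * b))) / (\<i> * t)
    = (CLBINT x. indicator {exp a<..exp b} x *\<^sub>R (of_real (1 / x) * iexp (- (t * ln x))))"
proof -
  let ?g = "\<lambda>x. of_real (1 / x) * iexp (- (t * ln x))"
  let ?G = "\<lambda>x. - iexp (- (t * ln x)) / (\<i> * t)"
  have pos: "0 < x" if "exp a \<le> x" for x
    using that exp_gt_zero[of a] by linarith
  have "has_bochner_integral lborel (\<lambda>x. indicator {exp a..exp b} x *\<^sub>R ?g x) (?G (exp b) - ?G (exp a))"
  proof (rule has_bochner_integral_FTC_Icc)
    fix x assume x: "exp a \<le> x" "x \<le> exp b"
    show "(?G has_vector_derivative ?g x) (at x within {exp a..exp b})"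
    proof -
      have "((\<lambda>x. - (t * ln x)) has_real_derivative - (t / x)) (at x within {exp a..exp b})"
        using pos[OF x(1)] by (auto intro!: derivative_eq_intros)
      then have "((\<lambda>x. complex_of_real (- (t * ln x))) has_vector_derivative of_real (- (t / x))) (at x within {exp a..exp b})"
        by (intro has_vector_derivative_of_real) (simp add: has_real_derivative_iff_has_vector_derivative)
      moreover have "((\<lambda>z. - exp (\<i> * z) / (\<i> * t)) has_field_derivative - exp (\<i> * z) / t) (at z within S)" for z S
        using assms(2) by (auto intro!: derivative_eq_intros)
      ultimately have "((\<lambda>z. - exp (\<i> * z) / (\<i> * t)) \<circ> (\<lambda>x. complex_of_real (- (t * ln x))) has_vector_derivative
          of_real (- (t / x)) * (- iexp (- (t * ln x)) / t)) (at x within {exp a..exp b})"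
        by (rule field_vector_diff_chain_within)
      then show ?thesis using assms(2) by (simp add: o_def)
    qed
  next
    show "continuous_on {exp a..exp b} ?g"
      using pos by (auto intro!: continuous_intros)
  qed (use assms in simp)
  then have "(CLBINT x. indicator {exp a..exp b} x *\<^sub>R ?g x) = ?G (exp b) - ?G (exp a)"
    by (rule has_bochner_integral_integral_eq)
  also have "\<dots> = (iexp (-(t * a)) - iexp (-(t * b))) / (\<i> * t)"
    by (simp add: diff_divide_distrib)
  also have "(CLBINT x. indicator {exp a..exp b} x *\<^sub>R ?g x) = (CLBINT x. indicator {exp a<..exp b} x *\<^sub>R ?g x)"
    using AE_lborel_singleton[of "exp a"]
    by (intro integral_cong_AE) (auto simp: indicator_def)
  finally show ?thesis ..
qed

definition mellin_inverse :: "real \<Rightarrow> (real \<Rightarrow> complex) \<Rightarrow> real \<Rightarrow> complex" where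
  "mellin_inverse \<gamma> g x = 1 / (2 * pi) * (CLBINT v. complex_of_real x powr (- Complex \<gamma> v) * g v)"

lemma mellin_inverse_eq:
  assumes "x > 0"
  shows "mellin_inverse \<gamma> g x = of_real (x powr (- \<gamma>)) * (1 / (2 * pi) * (CLBINT v. iexp (- (v * ln x)) * g v))"
  by (simp add: mellin_inverse_def of_real_powr_uminus_line[OF assms] mult.assoc)

text \<open>In the variable $\ln x$ it is an inverse Fourier transform of an integrable function, which is
  continuous by dominated convergence.\<close>

lemma continuous_on_mellin_inverse:
  assumes g: "integrable lborel g"
  shows "continuous_on {0<..} (mellin_inverse \<gamma> g)"
proof -
  define F where "F y = (CLBINT v. iexp (- (v * y)) * g v)" for y
  have [measurable]: "g \<in> borel_measurable borel" using borel_measurable_integrable[OF g] by simp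
  have "continuous_on UNIV F"
    unfolding continuous_on_sequentially F_def o_def
  proof (intro allI ballI impI, elim conjE)
    fix s :: "nat \<Rightarrow> real" and y assume "s \<longlonglongrightarrow> y"
    then have lim: "(\<lambda>n. iexp (- (v * s n)) * g v) \<longlonglongrightarrow> iexp (- (v * y)) * g v" for v
      by (intro tendsto_intros)
    show "(\<lambda>n. CLBINT v. iexp (- (v * s n)) * g v) \<longlonglongrightarrow> (CLBINT v. iexp (- (v * y)) * g v)"
    proof (rule integral_dominated_convergence[where w="\<lambda>v. cmod (g v)"])
      show "AE v in lborel. (\<lambda>n. iexp (- (v * s n)) * g v) \<longlonglongrightarrow> iexp (- (v * y)) * g v"
        using lim by simp
      show "AE v in lborel. cmod (iexp (- (v * s n)) * g v) \<le> cmod (g v)" for n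
        by (simp add: norm_mult)
    qed (use g in auto)
  qed
  then have "continuous_on {0<..} (\<lambda>x. F (ln x))"
    by (rule continuous_on_compose2) (auto intro!: continuous_intros)
  then have "continuous_on {0<..} (\<lambda>x. of_real (x powr (- \<gamma>)) * (1 / (2 * pi) * F (ln x)))"
    by (intro continuous_intros) auto
  moreover have "mellin_inverse \<gamma> g x = of_real (x powr (- \<gamma>)) * (1 / (2 * pi) * F (ln x))" if "x \<in> {0<..}" for x
    using mellin_inverse_eq[of x \<gamma> g] that by (simp add: F_def)
  ultimately show ?thesis using continuous_on_cong[OF refl] by (metis (no_types, lifting))
qed

text \<open>The transform of a real function satisfies $\overline{M(\gamma+iv)} = M(\gamma-iv)$, so that
  conjugation amounts to the substitution $v \mapsto -v$.\<close>

lemma mellin_inverse_mellin_real: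
  assumes "x > 0"
  shows "mellin_inverse \<gamma> (\<lambda>v. mellin f (Complex \<gamma> v)) x
    = of_real (Re (mellin_inverse \<gamma> (\<lambda>v. mellin f (Complex \<gamma> v)) x))"
proof -
  let ?m = "\<lambda>v. mellin f (Complex \<gamma> v)"
  have m: "cnj (?m v) = ?m (- v)" for v
    unfolding mellin_on_line Bochner_Integration.integral_cnj[symmetric] by (simp add: exp_cnj)
  have "cnj (CLBINT v. iexp (- (v * ln x)) * ?m v) = (CLBINT v. cnj (iexp (- (v * ln x)) * ?m v))"
    by (rule Bochner_Integration.integral_cnj[symmetric])
  also have "\<dots> = (CLBINT v. iexp (v * ln x) * ?m (- v))"
    by (simp add: m exp_cnj)
  also have "\<dots> = (CLBINT v. iexp (- (v * ln x)) * ?m v)"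
    using lborel_integral_real_affine[of "-1" "\<lambda>v. iexp (- (v * ln x)) * ?m v" 0] by simp
  finally have "cnj (mellin_inverse \<gamma> ?m x) = mellin_inverse \<gamma> ?m x"
    unfolding mellin_inverse_eq[OF assms] by simp
  then show ?thesis by (simp add: complex_eq_iff)
qed

text \<open>The image under \<open>ln\<close> of the probability measure with density proportional to
  $f(x) x^{\gamma-1}$ has the characteristic function $M[f](\gamma+iv)/c$. Levy's formula gives the
  mass of $(e^a, e^b]$ as an integral of that function, and Fubini's theorem turns it into
  $\int_{e^a}^{e^b} x^{\gamma-1} P(x)\,dx$ for the inversion integral \<open>P\<close>. Two functions with equal
  integrals over all these intervals agree almost everywhere.\<close>

theorem mellin_inversion:
  fixes f :: "real \<Rightarrow> real"
  assumes f[measurable]: "f \<in> borel_measurable borel" and nonneg: "\<And>x. 0 \<le> f x"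
    and int: "set_integrable lborel {0<..} (\<lambda>x. f x * x powr (\<gamma> - 1))"
    and mint: "integrable lborel (\<lambda>v. mellin f (Complex \<gamma> v))"
  shows "AE x in lborel. 0 < x \<longrightarrow> complex_of_real (f x) = mellin_inverse \<gamma> (\<lambda>v. mellin f (Complex \<gamma> v)) x"
proof -
  let ?m = "\<lambda>v. mellin f (Complex \<gamma> v)"
  define w where "w x = indicator {0<..} x * (f x * x powr (\<gamma> - 1))" for x
  define c where "c = integral\<^sup>L lborel w"
  have w_int: "integrable lborel w" using int by (simp add: set_integrable_def w_def[abs_def])
  have w_meas[measurable]: "w \<in> borel_measurable borel" unfolding w_def[abs_def] by measurable
  have m_meas[measurable]: "?m \<in> borel_measurable borel" using borel_measurable_integrable[OF mint] by simp
  have w_nonneg: "0 \<le> w x" for x using nonneg by (simp add: w_def)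
  have mellin_w: "?m t = (CLBINT x. of_real (w x) * iexp (t * ln x))" for t
    unfolding mellin_on_line w_def ..
  show ?thesis
  proof (cases "c = 0")
    case True
    have "AE x in lborel. w x = 0"
      using integral_nonneg_eq_0_iff_AE[OF w_int] w_nonneg True by (simp add: c_def)
    then have ae: "AE x in lborel. 0 < x \<longrightarrow> f x = 0"
      by eventually_elim (auto simp: w_def)
    have "?m t = 0" for t
    proof -
      have "?m t = (CLBINT x::real. 0)"
        unfolding mellin_w using \<open>AE x in lborel. w x = 0\<close> by (intro integral_cong_AE) auto
      then show ?thesis by simp
    qed
    then have "mellin_inverse \<gamma> ?m x = 0" for x by (simp add: mellin_inverse_def)
    with ae show ?thesis by simp
  next
    case False
    have "c \<ge> 0" unfolding c_def using w_nonneg by (intro Bochner_Integration.integral_nonneg) auto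
    with False have c: "c > 0" by simp
    define D where "D = density lborel (\<lambda>x. ennreal (w x / c))"
    have D_sets[measurable_cong]: "sets D = sets borel" by (simp add: D_def)
    define \<mu> where "\<mu> = distr D borel ln"
    have emD: "emeasure D A = ennreal ((LBINT x. indicator A x * w x) / c)" if [measurable]: "A \<in> sets borel" for A
    proof -
      have "emeasure D A = (\<integral>\<^sup>+x. ennreal (indicator A x * w x / c) \<partial>lborel)"
        unfolding D_def by (subst emeasure_density) (auto intro!: nn_integral_cong simp: indicator_def)
      also have "\<dots> = ennreal (LBINT x. indicator A x * w x / c)"
        using w_int w_nonneg c integrable_real_mult_indicator[OF _ w_int, of A]
        by (intro nn_integral_eq_integral) (auto simp: mult.commute)
      finally show ?thesis by simp
    qed
    have "emeasure D (space D) = 1"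
      using emD[of UNIV] c by (simp add: D_def c_def)
    then interpret D: prob_space D by (rule prob_spaceI)
    interpret M: real_distribution \<mu>
      unfolding \<mu>_def by (rule D.real_distribution_distr) simp
    \<comment> \<open>The density \<open>w\<close> vanishes off the positive half-line, so the values of \<open>ln\<close> there are
      irrelevant.\<close>
    have charM: "char \<mu> t = ?m t / c" for t
    proof -
      have "char \<mu> t = (CLINT x|D. iexp (t * ln x))"
        unfolding char_def \<mu>_def by (subst integral_distr) auto
      also have "\<dots> = (CLBINT x. (w x / c) *\<^sub>R iexp (t * ln x))"
        unfolding D_def using c w_nonneg by (subst integral_density) auto
      also have "\<dots> = (CLBINT x. of_real (w x) * iexp (t * ln x) / c)"
        by (intro Bochner_Integration.integral_cong refl) (simp add: scaleR_conv_of_real)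
      also have "\<dots> = ?m t / c" by (simp add: mellin_w)
      finally show ?thesis .
    qed
    have char_int: "integrable lborel (char \<mu>)" using mint by (simp add: charM[abs_def])
    have measM: "measure \<mu> A = (LBINT x. indicator (ln -` A) x * w x) / c" if [measurable]: "A \<in> sets borel" for A
    proof -
      have "ln -` A \<in> sets (borel :: real measure)" using measurable_sets_borel[of ln borel A] by simp
      then have "emeasure \<mu> A = ennreal ((LBINT x. indicator (ln -` A) x * w x) / c)"
        unfolding \<mu>_def using emD[of "ln -` A"] by (subst emeasure_distr) (auto simp: D_def)
      then show ?thesis
        using c w_nonneg by (simp add: measure_def Bochner_Integration.integral_nonneg)
    qed
    have atoms: "measure \<mu> {a} = 0" for a
    proof -
      have "(LBINT x. indicator (ln -` {a}) x * w x) = (LBINT x::real. 0)"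
        using AE_lborel_singleton[of "exp a"]
        by (intro integral_cong_AE) (auto simp: indicator_def w_def)
      then show ?thesis by (simp add: measM)
    qed
    have key: "(CLBINT x. indicator {exp a<..exp b} x *\<^sub>R of_real (w x))
       = (CLBINT x. indicator {exp a<..exp b} x *\<^sub>R (of_real (x powr (\<gamma> - 1)) * mellin_inverse \<gamma> ?m x))"
       (is "?L = ?R") and key_int: "integrable lborel (\<lambda>x. indicator {exp a<..exp b} x *\<^sub>R (of_real (x powr (\<gamma> - 1)) * mellin_inverse \<gamma> ?m x))" (is ?I)
      if ab: "a \<le> b" for a b
    proof -
      let ?K = "\<lambda>t x. indicator {exp a<..exp b} x *\<^sub>R (of_real (1 / x) * iexp (- (t * ln x))) * ?m t :: complex"
      have pos: "0 < x" if "exp a < x" for x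
        using that exp_gt_zero[of a] by linarith
      have fub: "integrable (lborel \<Otimes>\<^sub>M lborel) (\<lambda>(t, x). ?K t x)"
      proof (rule lborel_pair.Fubini_integrable)
        show "(\<lambda>(t, x). ?K t x) \<in> borel_measurable (lborel \<Otimes>\<^sub>M lborel)" by measurable
        have "integrable lborel (\<lambda>t. cmod (?m t) * (LBINT x. indicator {exp a<..exp b} x * \<bar>1 / x\<bar>))"
          using mint by (intro integrable_mult_left integrable_norm)
        moreover have "(LBINT x. norm (case (t, x) of (t, x) \<Rightarrow> ?K t x)) = cmod (?m t) * (LBINT x. indicator {exp a<..exp b} x * \<bar>1 / x\<bar>)" for t
          by (subst integral_mult_right_zero[symmetric]) (auto intro!: Bochner_Integration.integral_cong simp: norm_mult norm_divide)
        ultimately show "integrable lborel (\<lambda>t. LBINT x. norm (case (t, x) of (t, x) \<Rightarrow> ?K t x))" by simp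
        show "AE t in lborel. integrable lborel (\<lambda>x. case (t, x) of (t, x) \<Rightarrow> ?K t x)"
        proof (intro AE_I2)
          fix t :: real
          have "set_integrable lborel {exp a..exp b} (\<lambda>x. of_real (1 / x) * iexp (- (t * ln x)))"
            using exp_gt_zero[of a] by (intro borel_integrable_atLeastAtMost' continuous_intros) (auto simp: not_le)
          then have "set_integrable lborel {exp a<..exp b} (\<lambda>x. of_real (1 / x) * iexp (- (t * ln x)))"
            by (rule set_integrable_subset) auto
          then show "integrable lborel (\<lambda>x. case (t, x) of (t, x) \<Rightarrow> ?K t x)"
            unfolding set_integrable_def by (simp only: prod.case) (rule integrable_mult_left)
        qed
      qed
      have inner: "(CLBINT t. ?K t x) = of_real (2 * pi) * (indicator {exp a<..exp b} x *\<^sub>R (of_real (x powr (\<gamma> - 1)) * mellin_inverse \<gamma> ?m x))" for x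
      proof (cases "x \<in> {exp a<..exp b}")
        case True
        then have x: "x > 0" using pos by auto
        have "(CLBINT t. ?K t x) = (CLBINT t. of_real (1 / x) * (iexp (- (t * ln x)) * ?m t))"
          using True by (intro Bochner_Integration.integral_cong refl) simp
        also have "\<dots> = of_real (1 / x) * (CLBINT t. iexp (- (t * ln x)) * ?m t)" by simp
        also have "\<dots> = of_real (2 * pi) * (of_real (x powr (\<gamma> - 1)) * mellin_inverse \<gamma> ?m x)"
        proof -
          have "1 / x = x powr (\<gamma> - 1) * x powr (- \<gamma>)"
            using x powr_add[of x "\<gamma> - 1" "- \<gamma>"] by (simp add: powr_neg_one)
          then have "complex_of_real (1 / x) = of_real (x powr (\<gamma> - 1)) * of_real (x powr (- \<gamma>))"
            by (simp only: of_real_mult)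
          then show ?thesis unfolding mellin_inverse_eq[OF x] by simp
        qed
        finally show ?thesis using True by simp
      qed simp
      have 1: "integrable lborel (\<lambda>x. CLBINT t. ?K t x)"
        using lborel_pair.integrable_snd[OF fub] .
      then have "integrable lborel (\<lambda>x. of_real (2 * pi) * (indicator {exp a<..exp b} x *\<^sub>R (of_real (x powr (\<gamma> - 1)) * mellin_inverse \<gamma> ?m x)))"
        unfolding inner .
      then have "integrable lborel (\<lambda>x. of_real (1 / (2 * pi)) * (of_real (2 * pi) * (indicator {exp a<..exp b} x *\<^sub>R (of_real (x powr (\<gamma> - 1)) * mellin_inverse \<gamma> ?m x))))"
        by (rule integrable_mult_right)
      moreover have "of_real (1 / (2 * pi)) * (of_real (2 * pi) * c) = c" for c :: complex by simp
      ultimately show ?I by (simp only:)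
      have "ln -` {a<..b} \<inter> {0<..} = {exp a<..exp b}"
      proof (intro set_eqI iffI)
        fix x assume "x \<in> ln -` {a<..b} \<inter> {0<..}"
        then have x: "x > 0" "a < ln x" "ln x \<le> b" by auto
        have "exp a < exp (ln x)" "exp (ln x) \<le> exp b"
          using x by (simp_all only: exp_less_cancel_iff exp_le_cancel_iff)
        then show "x \<in> {exp a<..exp b}" using x(1) by simp
      next
        fix x assume x: "x \<in> {exp a<..exp b}"
        then have "x > 0" using pos by auto
        with x have "exp a < exp (ln x)" "exp (ln x) \<le> exp b" by simp_all
        then have "a < ln x" "ln x \<le> b" by (simp_all only: exp_less_cancel_iff exp_le_cancel_iff)
        then show "x \<in> ln -` {a<..b} \<inter> {0<..}" using \<open>x > 0\<close> by simp
      qed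
      then have "indicator (ln -` {a<..b}) x * w x = indicator {exp a<..exp b} x * w x" for x
        by (auto simp: indicator_def w_def set_eq_iff)
      then have "(\<lambda>x. indicator (ln -` {a<..b}) x * w x) = (\<lambda>x. indicator {exp a<..exp b} x * w x)" ..
      then have r1: "complex_of_real (measure \<mu> {a<..b}) = ?L / c"
        by (simp add: measM scaleR_conv_of_real flip: of_real_mult)
      have r2: "complex_of_real (measure \<mu> {a<..b}) = 1 / (2 * pi) * (CLBINT t. (iexp (-(t * a)) - iexp (-(t * b))) / (\<i> * t) * char \<mu> t)"
        by (rule M.Levy_Inversion_integrable[OF ab char_int atoms atoms])
      have r3: "(CLBINT t. (iexp (-(t * a)) - iexp (-(t * b))) / (\<i> * t) * char \<mu> t) = (CLBINT t. (CLBINT x. ?K t x)) / c"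
      proof -
        have "(CLBINT t. (iexp (-(t * a)) - iexp (-(t * b))) / (\<i> * t) * char \<mu> t) = (CLBINT t. (CLBINT x. ?K t x) / c)"
        proof (rule integral_cong_AE)
          show "AE t in lborel. (iexp (-(t * a)) - iexp (-(t * b))) / (\<i> * t) * char \<mu> t = (CLBINT x. ?K t x) / c"
            using AE_lborel_singleton[of 0]
          proof eventually_elim
            case (elim t)
            show ?case unfolding iexp_diff_eq_integral[OF ab elim] charM integral_mult_left_zero by simp
          qed
        qed measurable
        then show ?thesis by simp
      qed
      have r4: "(CLBINT t. (CLBINT x. ?K t x)) = (CLBINT x. (CLBINT t. ?K t x))"
        by (rule lborel_pair.Fubini_integral[symmetric, OF fub])
      have r5: "(CLBINT x. (CLBINT t. ?K t x)) = of_real (2 * pi) * ?R"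
        unfolding inner by (rule integral_mult_right_zero)
      have cancel: "l = r" if "l / complex_of_real c = complex_of_real (1 / (2 * pi)) * (of_real (2 * pi) * r / c)" for l r :: complex
        using that c by simp
      have "?L / c = complex_of_real (measure \<mu> {a<..b})" by (rule r1[symmetric])
      also have "\<dots> = complex_of_real (1 / (2 * pi)) * (of_real (2 * pi) * ?R / c)"
        unfolding r2 r3 r4 r5 by (rule refl)
      finally show "?L = ?R" by (rule cancel)
    qed
    define P where "P x = Re (mellin_inverse \<gamma> ?m x)" for x
    have P: "mellin_inverse \<gamma> ?m x = of_real (P x)" if "x > 0" for x
      using mellin_inverse_mellin_real[OF that] by (simp add: P_def)
    have eq: "AE x in lborel. x \<in> {exp a<..exp b} \<longrightarrow> w x - x powr (\<gamma> - 1) * P x = 0" for a b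
    proof (rule AE_zero_if_integrals_zero)
      have ind: "indicator {exp a<..z} x *\<^sub>R (of_real (x powr (\<gamma> - 1)) * mellin_inverse \<gamma> ?m x)
          = of_real (indicator {exp a<..z} x * (x powr (\<gamma> - 1) * P x))" for x z
      proof (cases "x \<in> {exp a<..z}")
        case True
        then have "x > 0" using exp_gt_zero[of a] by (auto intro: less_trans simp del: exp_gt_zero)
        then show ?thesis using True by (simp add: P)
      qed simp
      have Pint: "integrable lborel (\<lambda>x. indicator {exp a<..exp b} x * (x powr (\<gamma> - 1) * P x))" if "a \<le> b" for b
        using integrable_Re[OF key_int[OF that]] unfolding ind by (simp only: Re_complex_of_real)
      have wint: "integrable lborel (\<lambda>x. indicator {exp a<..z} x * w x)" for z
        using integrable_real_mult_indicator[OF _ w_int, of "{exp a<..z}"] by (simp add: mult.commute)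
      show "set_integrable lborel {exp a<..exp b} (\<lambda>x. w x - x powr (\<gamma> - 1) * P x)"
      proof (cases "a \<le> b")
        case True
        show ?thesis unfolding set_integrable_def
          using Bochner_Integration.integrable_diff[OF wint Pint[OF True]] by (simp add: right_diff_distrib)
      qed (simp add: set_integrable_def)
      fix z assume z: "exp a < z" "z \<le> exp b"
      then have "z > 0" using exp_gt_zero[of a] by linarith
      define b' where "b' = ln z"
      have zb: "z = exp b'" using \<open>z > 0\<close> by (simp add: b'_def)
      with z have ab: "a \<le> b'" by simp
      have "complex_of_real (LBINT x. indicator {exp a<..z} x * w x) = of_real (LBINT x. indicator {exp a<..z} x * (x powr (\<gamma> - 1) * P x))"
        using key[OF ab, folded zb] unfolding ind by (simp add: scaleR_conv_of_real flip: of_real_mult)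
      then have "(LBINT x. indicator {exp a<..z} x * w x) = (LBINT x. indicator {exp a<..z} x * (x powr (\<gamma> - 1) * P x))"
        by (simp only: of_real_eq_iff)
      then show "(LINT x:{exp a<..z}|lborel. w x - x powr (\<gamma> - 1) * P x) = 0"
        using Bochner_Integration.integral_diff[OF wint Pint[OF ab], of z] zb
        by (simp add: set_lebesgue_integral_def right_diff_distrib)
    qed
    \<comment> \<open>Countably many intervals exhaust the half-line.\<close>
    have "AE x in lborel. \<forall>n::nat. x \<in> {exp (- real n)<..exp (real n)} \<longrightarrow> w x - x powr (\<gamma> - 1) * P x = 0"
      unfolding AE_all_countable using eq by blast
    then show ?thesis
    proof (eventually_elim, intro impI)
      fix x :: real assume *: "\<forall>n::nat. x \<in> {exp (- real n)<..exp (real n)} \<longrightarrow> w x - x powr (\<gamma> - 1) * P x = 0" and x: "0 < x"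
      obtain n :: nat where "\<bar>ln x\<bar> < real n" using reals_Archimedean2 by blast
      then have "- real n < ln x" "ln x < real n" by auto
      then have "exp (- real n) < exp (ln x)" "exp (ln x) < exp (real n)" by auto
      then have "w x - x powr (\<gamma> - 1) * P x = 0" using * x by auto
      then have "f x = P x" using x by (simp add: w_def)
      then show "complex_of_real (f x) = mellin_inverse \<gamma> ?m x" using P[OF x] by simp
    qed
  qed
qed

section \<open>Brownian motion at an independent time\<close>

text \<open>A continuous process is the pointwise limit of its discretisations on the grids of mesh
  $1/(n+1)$, which depend on time only through a countable index. The time is clipped at 0 so that the
  map is defined on the whole line.\<close>

lemma continuous_process_jointly_measurable:
  fixes B :: "real \<Rightarrow> 'a \<Rightarrow> real"
  assumes meas: "\<And>t. 0 \<le> t \<Longrightarrow> B t \<in> borel_measurable M'"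
    and cont: "\<And>\<omega>. \<omega> \<in> space M' \<Longrightarrow> continuous_on {0..} (\<lambda>t. B t \<omega>)"
  shows "(\<lambda>(t, \<omega>). B (max 0 t) \<omega>) \<in> borel_measurable (borel \<Otimes>\<^sub>M M')"
proof (rule borel_measurable_LIMSEQ_metric)
  let ?s = "\<lambda>n t. real (nat \<lceil>t * real (Suc n)\<rceil>) / real (Suc n)"
  show "(\<lambda>x. case x of (t, \<omega>) \<Rightarrow> B (?s n t) \<omega>) \<in> borel_measurable (borel \<Otimes>\<^sub>M M')" for n
  proof -
    have "(\<lambda>x. B (real (nat \<lceil>fst x * real (Suc n)\<rceil>) / real (Suc n)) (snd x)) \<in> borel_measurable (borel \<Otimes>\<^sub>M M')"
    proof (rule measurable_compose_countable[where f="\<lambda>k x. B (real k / real (Suc n)) (snd x)"])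
      show "(\<lambda>x. B (real k / real (Suc n)) (snd x)) \<in> borel_measurable (borel \<Otimes>\<^sub>M M')" for k
        by (rule measurable_compose[OF measurable_snd meas]) simp
    qed measurable
    then show ?thesis by (simp add: case_prod_beta)
  qed
  fix x assume "x \<in> space ((borel :: real measure) \<Otimes>\<^sub>M M')"
  then obtain t \<omega> where x: "x = (t, \<omega>)" and \<omega>: "\<omega> \<in> space M'" by (auto simp: space_pair_measure)
  have lim: "(\<lambda>n. ?s n t) \<longlonglongrightarrow> max 0 t"
  proof (rule real_tendsto_sandwich[where f="\<lambda>n. max 0 t" and h="\<lambda>n. max 0 t + 1 / real (Suc n)"])
    have "max 0 t \<le> ?s n t" "?s n t \<le> max 0 t + 1 / real (Suc n)" for n
    proof -
      have "real (nat \<lceil>t * real (Suc n)\<rceil>) = max 0 (real_of_int \<lceil>t * real (Suc n)\<rceil>)"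
        by (simp add: max_def)
      moreover have "max 0 t * real (Suc n) \<le> max 0 (real_of_int \<lceil>t * real (Suc n)\<rceil>)"
        using le_of_int_ceiling[of "t * real (Suc n)"] by (simp add: max_def)
      moreover have "max 0 (real_of_int \<lceil>t * real (Suc n)\<rceil>) \<le> max 0 t * real (Suc n) + 1"
        using of_int_ceiling_le_add_one[of "t * real (Suc n)"] mult_nonneg_nonneg[of t "real (Suc n)"]
          mult_nonpos_nonneg[of t "real (Suc n)"]
        by (cases "t \<ge> 0") (auto simp del: of_nat_Suc)
      ultimately have "max 0 t * real (Suc n) \<le> real (nat \<lceil>t * real (Suc n)\<rceil>)"
          "real (nat \<lceil>t * real (Suc n)\<rceil>) \<le> max 0 t * real (Suc n) + 1" by linarith+
      moreover have "real (Suc n) > 0" by simp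
      ultimately show "max 0 t \<le> ?s n t" "?s n t \<le> max 0 t + 1 / real (Suc n)"
        by (simp_all only: pos_le_divide_eq pos_divide_le_eq distrib_right nonzero_eq_divide_eq) simp_all
    qed
    then show "\<forall>\<^sub>F n in sequentially. max 0 t \<le> ?s n t" "\<forall>\<^sub>F n in sequentially. ?s n t \<le> max 0 t + 1 / real (Suc n)"
      by auto
    have "(\<lambda>n. max 0 t + 1 / real (Suc n)) \<longlonglongrightarrow> max 0 t + 0"
      by (intro tendsto_intros LIMSEQ_Suc[OF lim_1_over_n])
    then show "(\<lambda>n. max 0 t + 1 / real (Suc n)) \<longlonglongrightarrow> max 0 t" by simp
  qed simp
  have "(\<lambda>n. B (?s n t) \<omega>) \<longlonglongrightarrow> B (max 0 t) \<omega>"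
    by (rule continuous_on_tendsto_compose[OF cont[OF \<omega>] lim]) auto
  then show "(\<lambda>n. case x of (t, \<omega>) \<Rightarrow> B (?s n t) \<omega>) \<longlonglongrightarrow> (case x of (t, \<omega>) \<Rightarrow> B (max 0 t) \<omega>)"
    by (simp add: x)
qed

text \<open>The case $t = 0$ is the degenerate one, where the process starts at 0 almost surely.\<close>

lemma brownian_motion_marginal:
  assumes BM: "standard_brownian_motion M B" and t: "0 \<le> t"
  shows "distr M borel (B t) = distr std_normal_distribution borel (\<lambda>y. sqrt t * y)"
proof -
  have M: "prob_space M" and meas: "\<And>t. 0 \<le> t \<Longrightarrow> B t \<in> borel_measurable M" and B0: "AE \<omega> in M. B 0 \<omega> = 0"
    and incr: "\<And>s t. 0 \<le> s \<Longrightarrow> s < t \<Longrightarrow> distributed M lborel (\<lambda>\<omega>. B t \<omega> - B s \<omega>) (normal_density 0 (sqrt (t - s)))"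
    using BM by (auto simp: standard_brownian_motion_def)
  interpret prob_space M by (rule M)
  have [measurable]: "B t \<in> borel_measurable M" "B 0 \<in> borel_measurable M" using meas t by auto
  show ?thesis
  proof (cases "t = 0")
    case True
    interpret N: prob_space std_normal_distribution by (rule prob_space_normal_density) simp
    have "distr M borel (B t) = distr M borel (\<lambda>_. 0)"
      using B0 True by (intro distr_cong_AE) auto
    also have "\<dots> = return borel 0" by (rule distr_const) simp
    also have "\<dots> = distr std_normal_distribution borel (\<lambda>y. sqrt t * y)"
      using True N.distr_const[of 0 borel] by simp
    finally show ?thesis .
  next
    case False
    with t have t: "0 < t" by simp
    interpret N: prob_space std_normal_distribution by (rule prob_space_normal_density) simp
    have "distributed M lborel (\<lambda>\<omega>. B t \<omega> - B 0 \<omega>) (normal_density 0 (sqrt t))"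
      using incr[of 0 t] t by simp
    then have "distr M lborel (\<lambda>\<omega>. B t \<omega> - B 0 \<omega>) = density lborel (normal_density 0 (sqrt t))"
      by (simp add: distributed_def)
    moreover have "distr M lborel (\<lambda>\<omega>. B t \<omega> - B 0 \<omega>) = distr M borel (B t)"
    proof -
      have "distr M lborel (\<lambda>\<omega>. B t \<omega> - B 0 \<omega>) = distr M borel (\<lambda>\<omega>. B t \<omega> - B 0 \<omega>)"
        by (rule distr_cong) auto
      also have "\<dots> = distr M borel (B t)" using B0 by (intro distr_cong_AE) auto
      finally show ?thesis .
    qed
    moreover have "distr std_normal_distribution borel (\<lambda>y. sqrt t * y) = density lborel (normal_density 0 (sqrt t))"
    proof -
      have "distributed std_normal_distribution lborel (\<lambda>y. y) std_normal_density"
        unfolding distributed_def by (auto simp: distr_id2)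
      from N.normal_density_affine[OF this, of "sqrt t" 0] t
      have "distributed std_normal_distribution lborel (\<lambda>y. sqrt t * y) (normal_density 0 (sqrt t))" by simp
      then have "distr std_normal_distribution lborel (\<lambda>y. sqrt t * y) = density lborel (normal_density 0 (sqrt t))"
        by (simp add: distributed_def)
      moreover have "distr std_normal_distribution lborel (\<lambda>y. sqrt t * y) = distr std_normal_distribution borel (\<lambda>y. sqrt t * y)"
        by (rule distr_cong) auto
      ultimately show ?thesis by simp
    qed
    ultimately show ?thesis by simp
  qed
qed

text \<open>Independence says that the pair of \<open>T\<close> and the identity, the latter with values in the
  sigma-algebra generated by the paths, has a product law. Fubini's theorem for this product fixes the
  value of \<open>T\<close>, and for a fixed time the marginal of Brownian motion is a scaled normal law.\<close>

theorem time_changed_brownian_motion_law: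
  assumes BM: "standard_brownian_motion M B"
    and T[measurable]: "T \<in> borel_measurable M" and T0: "\<forall>\<omega>\<in>space M. 0 \<le> T \<omega>"
    and indep: "independent_of_process M T B"
  shows "(\<lambda>\<omega>. B (T \<omega>) \<omega>) \<in> borel_measurable M"
    and "distr M borel (\<lambda>\<omega>. B (T \<omega>) \<omega>)
      = distr (distr M borel T \<Otimes>\<^sub>M std_normal_distribution) borel (\<lambda>(t, y). sqrt t * y)"
proof -
  have M: "prob_space M" and meas: "\<And>t. 0 \<le> t \<Longrightarrow> B t \<in> borel_measurable M"
    and cont: "\<And>\<omega>. \<omega> \<in> space M \<Longrightarrow> continuous_on {0..} (\<lambda>t. B t \<omega>)"
    using BM by (auto simp: standard_brownian_motion_def)
  interpret prob_space M by (rule M)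
  interpret N: prob_space std_normal_distribution by (rule prob_space_normal_density) simp
  define path where "path = (\<lambda>\<omega>. \<lambda>t\<in>{0..}. B t \<omega>)"
  define F where "F = vimage_algebra (space M) path (Pi\<^sub>M {0..} (\<lambda>_. borel))"
  have path: "path \<in> measurable M (Pi\<^sub>M {0..} (\<lambda>_. borel))"
    unfolding path_def by (rule measurable_restrict) (use meas in auto)
  have space_F[simp]: "space F = space M" by (simp add: F_def)
  have id_F[measurable]: "(\<lambda>\<omega>. \<omega>) \<in> measurable M F"
    unfolding F_def by (rule measurable_vimage_algebra2) (use path measurable_space[OF path] in auto)
  have B_F: "B t \<in> borel_measurable F" if "0 \<le> t" for t
  proof -
    have "path \<in> measurable F (Pi\<^sub>M {0..} (\<lambda>_. borel))"
      unfolding F_def using measurable_space[OF path] by (intro measurable_vimage_algebra1) auto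
    from measurable_compose[OF this measurable_component_singleton[of t]] that
    have "(\<lambda>\<omega>. path \<omega> t) \<in> borel_measurable F" by simp
    then show ?thesis using that by (simp add: path_def cong: measurable_cong)
  qed
  have joint[measurable]: "(\<lambda>(t, \<omega>). B (max 0 t) \<omega>) \<in> borel_measurable (borel \<Otimes>\<^sub>M F)"
    by (rule continuous_process_jointly_measurable) (use B_F cont in auto)
  have pairm[measurable]: "(\<lambda>\<omega>. (T \<omega>, \<omega>)) \<in> measurable M (borel \<Otimes>\<^sub>M F)" by measurable
  have BT: "B (T \<omega>) \<omega> = (\<lambda>(t, \<omega>). B (max 0 t) \<omega>) (T \<omega>, \<omega>)" if "\<omega> \<in> space M" for \<omega>
    using T0 that by (auto simp: max_def)
  have "(\<lambda>\<omega>. (\<lambda>(t, \<omega>). B (max 0 t) \<omega>) (T \<omega>, \<omega>)) \<in> borel_measurable M" by measurable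
  then show BT_meas: "(\<lambda>\<omega>. B (T \<omega>) \<omega>) \<in> borel_measurable M"
    using BT by (subst measurable_cong) auto
  have sub: "sets F \<subseteq> sets M" 
  proof
    fix A assume A: "A \<in> sets F"
    from measurable_sets[OF id_F A] show "A \<in> sets M" using sets.sets_into_space[OF A]
      by (auto simp: Int_absorb2 vimage_def)
  qed
  interpret PT: prob_space "distr M borel T" by (rule prob_space_distr) simp
  interpret PF: prob_space "distr M F (\<lambda>\<omega>. \<omega>)" by (rule prob_space_distr) simp
  have prod: "distr M borel T \<Otimes>\<^sub>M distr M F (\<lambda>\<omega>. \<omega>) = distr M (borel \<Otimes>\<^sub>M F) (\<lambda>\<omega>. (T \<omega>, \<omega>))"
  proof (rule pair_measure_eqI)
    fix A C assume "A \<in> sets (distr M borel T)" and "C \<in> sets (distr M F (\<lambda>\<omega>. \<omega>))"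
    then have [measurable]: "A \<in> sets borel" "C \<in> sets F" by auto
    have C: "C \<in> sets M" "C \<subseteq> space M"
      using sub sets.sets_into_space[of C F] by auto
    have "T -` A \<inter> space M \<in> sets (vimage_algebra (space M) T borel)"
      by (rule in_vimage_algebra) simp
    moreover have "C \<in> sets (vimage_algebra (space M) path (Pi\<^sub>M {0..} (\<lambda>_. borel)))"
      using \<open>C \<in> sets F\<close> by (simp add: F_def)
    ultimately have "prob ((T -` A \<inter> space M) \<inter> C) = prob (T -` A \<inter> space M) * prob C"
      using indep unfolding independent_of_process_def path_def by (intro indep_setD)
    moreover have "(\<lambda>\<omega>. (T \<omega>, \<omega>)) -` (A \<times> C) \<inter> space M = (T -` A \<inter> space M) \<inter> C"
      by auto
    moreover have "(\<lambda>\<omega>. \<omega>) -` C \<inter> space M = C" using C by auto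
    ultimately show "emeasure (distr M borel T) A * emeasure (distr M F (\<lambda>\<omega>. \<omega>)) C
      = emeasure (distr M (borel \<Otimes>\<^sub>M F) (\<lambda>\<omega>. (T \<omega>, \<omega>))) (A \<times> C)"
      by (simp add: emeasure_distr emeasure_eq_measure ennreal_mult)
  qed (auto intro: PT.sigma_finite_measure_axioms PF.sigma_finite_measure_axioms cong: sets_pair_measure_cong)
  have PT0: "AE t in distr M borel T. 0 \<le> t"
    by (subst AE_distr_iff) (use T0 in auto)
  show "distr M borel (\<lambda>\<omega>. B (T \<omega>) \<omega>)
      = distr (distr M borel T \<Otimes>\<^sub>M std_normal_distribution) borel (\<lambda>(t, y). sqrt t * y)"
  proof (rule measure_eqI)
    fix A assume "A \<in> sets (distr M borel (\<lambda>\<omega>. B (T \<omega>) \<omega>))"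
    then have A[measurable]: "A \<in> sets borel" by simp
    have "emeasure (distr M borel (\<lambda>\<omega>. B (T \<omega>) \<omega>)) A = (\<integral>\<^sup>+\<omega>. indicator A (B (T \<omega>) \<omega>) \<partial>M)"
      using BT_meas by (subst nn_integral_distr[symmetric]) (auto simp: nn_integral_indicator)
    also have "\<dots> = (\<integral>\<^sup>+\<omega>. indicator A ((\<lambda>(t, \<omega>). B (max 0 t) \<omega>) (T \<omega>, \<omega>)) \<partial>M)"
      using BT by (intro nn_integral_cong) auto
    also have "\<dots> = (\<integral>\<^sup>+x. indicator A ((\<lambda>(t, \<omega>). B (max 0 t) \<omega>) x) \<partial>distr M (borel \<Otimes>\<^sub>M F) (\<lambda>\<omega>. (T \<omega>, \<omega>)))"
      by (subst nn_integral_distr) auto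
    also have "\<dots> = (\<integral>\<^sup>+t. \<integral>\<^sup>+\<omega>. indicator A (B (max 0 t) \<omega>) \<partial>distr M F (\<lambda>\<omega>. \<omega>) \<partial>distr M borel T)"
      unfolding prod[symmetric] by (subst PF.nn_integral_fst[symmetric]) (auto simp: measurable_distr_eq1 cong: measurable_cong_sets)
    also have "\<dots> = (\<integral>\<^sup>+t. \<integral>\<^sup>+y. indicator A (sqrt t * y) \<partial>std_normal_distribution \<partial>distr M borel T)"
    proof (rule nn_integral_cong_AE, use PT0 in eventually_elim)
      fix t :: real assume t: "0 \<le> t"
      have [measurable]: "B t \<in> borel_measurable M" "B t \<in> borel_measurable F" using meas B_F t by auto
      have "(\<integral>\<^sup>+\<omega>. indicator A (B (max 0 t) \<omega>) \<partial>distr M F (\<lambda>\<omega>. \<omega>)) = (\<integral>\<^sup>+\<omega>. indicator A (B t \<omega>) \<partial>M)"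
        using t by (subst nn_integral_distr) (auto simp: max_def)
      also have "\<dots> = (\<integral>\<^sup>+y. indicator A y \<partial>distr M borel (B t))"
        by (subst nn_integral_distr) auto
      also have "\<dots> = (\<integral>\<^sup>+y. indicator A (sqrt t * y) \<partial>std_normal_distribution)"
        unfolding brownian_motion_marginal[OF BM t] by (subst nn_integral_distr) auto
      finally show "(\<integral>\<^sup>+\<omega>. indicator A (B (max 0 t) \<omega>) \<partial>distr M F (\<lambda>\<omega>. \<omega>)) = (\<integral>\<^sup>+y. indicator A (sqrt t * y) \<partial>std_normal_distribution)" .
    qed
    also have "\<dots> = (\<integral>\<^sup>+x. indicator A ((\<lambda>(t, y). sqrt t * y) x) \<partial>(distr M borel T \<Otimes>\<^sub>M std_normal_distribution))"
      by (subst N.nn_integral_fst[symmetric]) auto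
    also have "\<dots> = emeasure (distr (distr M borel T \<Otimes>\<^sub>M std_normal_distribution) borel (\<lambda>(t, y). sqrt t * y)) A"
      by (subst nn_integral_distr[symmetric, where M'=borel]) (auto simp: nn_integral_indicator)
    finally show "emeasure (distr M borel (\<lambda>\<omega>. B (T \<omega>) \<omega>)) A
      = emeasure (distr (distr M borel T \<Otimes>\<^sub>M std_normal_distribution) borel (\<lambda>(t, y). sqrt t * y)) A" .
  qed simp
qed

section \<open>Absolute moments\<close>

lemma (in pair_sigma_finite) integral_tensor_product:
  fixes f :: "'a \<Rightarrow> complex" and g :: "'b \<Rightarrow> complex"
  assumes f: "integrable M1 f" and g: "integrable M2 g"
  shows "integrable (M1 \<Otimes>\<^sub>M M2) (\<lambda>(x, y). f x * g y)"
    and "(\<integral>(x, y). f x * g y \<partial>(M1 \<Otimes>\<^sub>M M2)) = (\<integral>x. f x \<partial>M1) * (\<integral>y. g y \<partial>M2)"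
proof -
  note [measurable] = borel_measurable_integrable[OF f] borel_measurable_integrable[OF g]
  show int: "integrable (M1 \<Otimes>\<^sub>M M2) (\<lambda>(x, y). f x * g y)"
  proof (rule Fubini_integrable)
    show "(\<lambda>(x, y). f x * g y) \<in> borel_measurable (M1 \<Otimes>\<^sub>M M2)" by measurable
    show "integrable M1 (\<lambda>x. \<integral>y. norm (case (x, y) of (x, y) \<Rightarrow> f x * g y) \<partial>M2)"
      using f by (simp add: norm_mult)
    show "AE x in M1. integrable M2 (\<lambda>y. case (x, y) of (x, y) \<Rightarrow> f x * g y)"
      using g by simp
  qed
  have "(\<integral>(x, y). f x * g y \<partial>(M1 \<Otimes>\<^sub>M M2)) = (\<integral>x. (\<integral>y. f x * g y \<partial>M2) \<partial>M1)"
    using integral_fst'[OF int] by simp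
  then show "(\<integral>(x, y). f x * g y \<partial>(M1 \<Otimes>\<^sub>M M2)) = (\<integral>x. f x \<partial>M1) * (\<integral>y. g y \<partial>M2)" by simp
qed

lemma borel_measurable_of_real_powr[measurable]:
  "(\<lambda>x. complex_of_real x powr z) \<in> borel_measurable borel"
proof -
  have "complex_of_real x powr z = (if x = 0 then 0 else if x > 0 then exp (z * of_real (ln x))
      else exp (z * (of_real (ln (- x)) + \<i> * of_real pi)))" for x
    using Ln_minus[of "complex_of_real (- x)"] Ln_of_real[of "- x"] Ln_of_real[of x]
    by (cases "x > 0") (simp_all add: powr_def)
  then show ?thesis by (subst measurable_cong) (auto intro: measurable_If)
qed

text \<open>The substitution $u = y^2/2$ in Euler's integral for $\Gamma(z-1/2)$.\<close>

lemma gaussian_half_line_moment: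
  assumes z: "Re z > 1/2"
  shows "has_bochner_integral lborel
    (\<lambda>y. indicator {0..} y *\<^sub>R (complex_of_real y powr (2 * z - 2) * of_real (exp (- y\<^sup>2 / 2))))
    (2 powr (z - 3/2) * Gamma (z - 1/2))"
proof -
  let ?g = "\<lambda>u. complex_of_real u powr (z - 1/2 - 1) / of_real (exp u)"
  let ?f = "\<lambda>y. complex_of_real y powr (2 * z - 2) * of_real (exp (- y\<^sup>2 / 2))"
  have z': "Re (z - 1/2) > 0" using z by simp
  have img: "(\<lambda>y::real. y\<^sup>2 / 2) ` {0<..} = {0<..}"
  proof (intro equalityI subsetI)
    fix u :: real assume "u \<in> {0<..}"
    then show "u \<in> (\<lambda>y. y\<^sup>2 / 2) ` {0<..}" by (intro image_eqI[of _ _ "sqrt (2 * u)"]) auto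
  qed auto
  have inj: "inj_on (\<lambda>y::real. y\<^sup>2 / 2) {0<..}"
    by (rule inj_onI) (auto simp: power2_eq_iff)
  have "?g absolutely_integrable_on (\<lambda>y::real. y\<^sup>2 / 2) ` {0<..} \<and> integral ((\<lambda>y::real. y\<^sup>2 / 2) ` {0<..}) ?g = Gamma (z - 1/2)"
    unfolding img using absolutely_integrable_Gamma_integral'[OF z'] Gamma_integral_complex'[OF z']
    by (simp add: integral_unique)
  moreover have "((\<lambda>y. y\<^sup>2 / 2) has_real_derivative y) (at y within {0<..})" for y
    by (auto intro!: derivative_eq_intros)
  ultimately have "(\<lambda>y. \<bar>y\<bar> *\<^sub>R ?g (y\<^sup>2 / 2)) absolutely_integrable_on {0<..} \<and>
      integral {0<..} (\<lambda>y. \<bar>y\<bar> *\<^sub>R ?g (y\<^sup>2 / 2)) = Gamma (z - 1/2)"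
    using inj by (subst has_absolute_integral_change_of_variables_real[where g="\<lambda>y. y\<^sup>2 / 2"]) simp_all
  then have sub: "(\<lambda>y. \<bar>y\<bar> *\<^sub>R ?g (y\<^sup>2 / 2)) absolutely_integrable_on {0<..}"
      "integral {0<..} (\<lambda>y. \<bar>y\<bar> *\<^sub>R ?g (y\<^sup>2 / 2)) = Gamma (z - 1/2)"
    by (rule conjunct1, rule conjunct2)
  have eq: "2 powr (z - 3/2) * (\<bar>y\<bar> *\<^sub>R ?g (y\<^sup>2 / 2)) = ?f y" if "y > 0" for y
  proof -
    define l where "l = complex_of_real (ln y)"
    define c where "c = complex_of_real (ln 2)"
    have u: "ln (y\<^sup>2 / 2) = 2 * ln y - ln 2" using that by (simp add: ln_div ln_realpow)
    have "complex_of_real (y\<^sup>2 / 2) powr (z - 1/2 - 1) = exp ((z - 1/2 - 1) * of_real (ln (y\<^sup>2 / 2)))"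
      using that Ln_of_real[of "y\<^sup>2 / 2"] by (simp add: powr_def del: of_real_divide of_real_power)
    then have 1: "complex_of_real (y\<^sup>2 / 2) powr (z - 1/2 - 1) = exp ((z - 3/2) * (2 * l - c))"
      unfolding u by (simp add: l_def c_def)
    have 2: "2 powr (z - 3/2) = exp ((z - 3/2) * c)"
      using Ln_of_real[of 2] by (simp add: powr_def c_def)
    have 3: "complex_of_real y = exp l"
      using that by (simp add: l_def exp_of_real)
    have 4: "complex_of_real y powr (2 * z - 2) = exp ((2 * z - 2) * l)"
      using that by (simp add: powr_def Ln_of_real l_def)
    have 5: "complex_of_real (exp (- y\<^sup>2 / 2)) = 1 / of_real (exp (y\<^sup>2 / 2))"
      by (simp add: exp_minus field_simps)
    have "2 powr (z - 3/2) * (\<bar>y\<bar> *\<^sub>R ?g (y\<^sup>2 / 2))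
      = (exp ((z - 3/2) * c) * (exp l * exp ((z - 3/2) * (2 * l - c)))) / of_real (exp (y\<^sup>2 / 2))"
      using that unfolding 1 2 by (simp add: scaleR_conv_of_real 3)
    also have "exp ((z - 3/2) * c) * (exp l * exp ((z - 3/2) * (2 * l - c))) = exp ((2 * z - 2) * l)"
      unfolding exp_add[symmetric] by (rule arg_cong[where f=exp]) (simp add: field_simps)
    also have "exp ((2 * z - 2) * l) / of_real (exp (y\<^sup>2 / 2)) = ?f y"
      unfolding 4 5 by simp
    finally show ?thesis .
  qed
  have abs: "(\<lambda>y. 2 powr (z - 3/2) * (\<bar>y\<bar> *\<^sub>R ?g (y\<^sup>2 / 2))) absolutely_integrable_on {0<..}"
    using sub(1) by (rule set_integrable_mult_right)
  then have leb: "set_integrable lebesgue {0<..} ?f"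
    by (rule set_integrable_cong[THEN iffD1, rotated -1]) (use eq in auto)
  have meas: "(\<lambda>y. indicator {0<..} y *\<^sub>R ?f y) \<in> borel_measurable lborel" by measurable
  have int: "integrable lborel (\<lambda>y. indicator {0<..} y *\<^sub>R ?f y)"
    using leb integrable_completion[OF meas] unfolding set_integrable_def by simp
  have "(LBINT y. indicator {0<..} y *\<^sub>R ?f y) = (LINT y:{0<..}|lebesgue. ?f y)"
    using integral_completion[OF meas] by (simp add: set_lebesgue_integral_def)
  also have "\<dots> = integral {0<..} ?f" by (rule set_lebesgue_integral_eq_integral(2)[OF leb])
  also have "\<dots> = integral {0<..} (\<lambda>y. 2 powr (z - 3/2) * (\<bar>y\<bar> *\<^sub>R ?g (y\<^sup>2 / 2)))"
    by (rule Henstock_Kurzweil_Integration.integral_cong) (use eq in auto)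
  also have "\<dots> = 2 powr (z - 3/2) * Gamma (z - 1/2)"
    using sub(2) by (simp only: integral_mult_right)
  finally have "has_bochner_integral lborel (\<lambda>y. indicator {0<..} y *\<^sub>R ?f y) (2 powr (z - 3/2) * Gamma (z - 1/2))"
    using int by (simp add: has_bochner_integral_iff)
  also have "(\<lambda>y. indicator {0<..} y *\<^sub>R ?f y) = (\<lambda>y. indicator {0..} y *\<^sub>R ?f y)"
    by (auto simp: indicator_def fun_eq_iff)
  finally show ?thesis .
qed

lemma gaussian_absolute_moment:
  assumes z: "Re z > 1/2"
  shows "has_bochner_integral std_normal_distribution (\<lambda>y. complex_of_real \<bar>y\<bar> powr (2 * z - 2))
     (2 powr (z - 1) * Gamma (z - 1/2) / of_real (sqrt pi))"
proof -
  let ?f = "\<lambda>y. complex_of_real \<bar>y\<bar> powr (2 * z - 2) * of_real (exp (- y\<^sup>2 / 2))"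
  have "has_bochner_integral lborel (\<lambda>y. indicator {0..} y *\<^sub>R ?f y) (2 powr (z - 3/2) * Gamma (z - 1/2))"
    using gaussian_half_line_moment[OF z]
    by (rule has_bochner_integral_cong[THEN iffD1, rotated -1]) (auto simp: indicator_def)
  then have "has_bochner_integral lborel ?f (2 *\<^sub>R (2 powr (z - 3/2) * Gamma (z - 1/2)))"
    by (rule has_bochner_integral_even_function) auto
  then have "has_bochner_integral lborel (\<lambda>y. of_real (1 / sqrt (2 * pi)) * ?f y)
      (of_real (1 / sqrt (2 * pi)) * (2 *\<^sub>R (2 powr (z - 3/2) * Gamma (z - 1/2))))"
    by (rule has_bochner_integral_mult_right)
  moreover have "of_real (1 / sqrt (2 * pi)) * ?f y = std_normal_density y *\<^sub>R (complex_of_real \<bar>y\<bar> powr (2 * z - 2))" for y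
    by (simp add: std_normal_density_def scaleR_conv_of_real)
  moreover have "of_real (1 / sqrt (2 * pi)) * (2 *\<^sub>R (2 powr (z - 3/2) * Gamma (z - 1/2))) = 2 powr (z - 1) * Gamma (z - 1/2) / of_real (sqrt pi)"
  proof -
    have "2 powr (z - 1) = 2 powr (z - 3/2) * complex_of_real (sqrt 2)"
    proof -
      have "complex_of_real (sqrt 2) = 2 powr (1/2)"
        using powr_of_real[of 2 "1/2"] by (simp add: powr_half_sqrt)
      then show ?thesis by (simp add: powr_add[symmetric])
    qed
    moreover have "of_real (1 / sqrt (2 * pi)) * 2 = complex_of_real (sqrt 2 / sqrt pi)"
    proof -
      have "1 / sqrt (2 * pi) * 2 = sqrt 2 / sqrt pi"
        using real_sqrt_mult_self[of 2] by (simp add: real_sqrt_mult field_simps)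
      then show ?thesis by (metis of_real_mult of_real_numeral)
    qed
    ultimately show ?thesis by (simp add: scaleR_conv_of_real mult.assoc[symmetric])
  qed
  ultimately show ?thesis
    by (simp add: has_bochner_integral_density)
qed

lemma of_real_powr_scaling:
  assumes "0 \<le> t"
  shows "complex_of_real \<bar>sqrt t * y\<bar> powr (2 * w) = complex_of_real t powr w * complex_of_real \<bar>y\<bar> powr (2 * w)"
proof (cases "t = 0 \<or> y = 0")
  case False
  with assms have "t > 0" "\<bar>y\<bar> > 0" by auto
  then show ?thesis
    by (simp add: powr_def abs_mult Ln_of_real ln_mult ln_sqrt exp_add[symmetric] algebra_simps del: of_real_mult zero_less_abs_iff)
qed auto

text \<open>Since $|\sqrt t\,y|^{2z-2} = t^{z-1} |y|^{2z-2}$, the moment factorises over the product law. For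
  $T$ with density \<open>p\<close> the first factor is the Mellin transform of \<open>p\<close>.\<close>

theorem time_changed_brownian_motion_moment:
  assumes BM: "standard_brownian_motion M B"
    and T[measurable]: "T \<in> borel_measurable M" and T0: "\<forall>\<omega>\<in>space M. 0 \<le> T \<omega>"
    and indep: "independent_of_process M T B"
    and z: "Re z > 1/2" and int: "integrable M (\<lambda>\<omega>. T \<omega> powr (Re z - 1))"
  shows "has_bochner_integral (distr M borel (\<lambda>\<omega>. B (T \<omega>) \<omega>)) (\<lambda>x. complex_of_real \<bar>x\<bar> powr (2 * z - 2))
    ((\<integral>\<omega>. complex_of_real (T \<omega>) powr (z - 1) \<partial>M) * (2 powr (z - 1) * Gamma (z - 1/2) / of_real (sqrt pi)))"
proof -
  have M: "prob_space M" using BM by (simp add: standard_brownian_motion_def)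
  interpret prob_space M by (rule M)
  interpret N: prob_space std_normal_distribution by (rule prob_space_normal_density) simp
  interpret PT: prob_space "distr M borel T" by (rule prob_space_distr) simp
  interpret P: pair_sigma_finite "distr M borel T" std_normal_distribution ..
  have PT0: "AE t in distr M borel T. 0 \<le> t"
    by (subst AE_distr_iff) (use T0 in auto)
  have "integrable M (\<lambda>\<omega>. complex_of_real (T \<omega>) powr (z - 1))"
  proof (rule Bochner_Integration.integrable_bound[OF int])
    show "AE \<omega> in M. norm (complex_of_real (T \<omega>) powr (z - 1)) \<le> norm (T \<omega> powr (Re z - 1))"
      using T0 by (intro AE_I2) (simp add: norm_powr_real_powr)
  qed measurable
  then have f: "integrable (distr M borel T) (\<lambda>t. complex_of_real t powr (z - 1))"
    by (subst integrable_distr_eq) auto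
  have g: "integrable std_normal_distribution (\<lambda>y. complex_of_real \<bar>y\<bar> powr (2 * z - 2))"
    and gi: "(\<integral>y. complex_of_real \<bar>y\<bar> powr (2 * z - 2) \<partial>std_normal_distribution) = 2 powr (z - 1) * Gamma (z - 1/2) / of_real (sqrt pi)"
    using gaussian_absolute_moment[OF z] by (simp_all add: has_bochner_integral_iff)
  have "has_bochner_integral (distr M borel T \<Otimes>\<^sub>M std_normal_distribution)
      (\<lambda>(t, y). complex_of_real t powr (z - 1) * complex_of_real \<bar>y\<bar> powr (2 * z - 2))
      ((\<integral>\<omega>. complex_of_real (T \<omega>) powr (z - 1) \<partial>M) * (2 powr (z - 1) * Gamma (z - 1/2) / of_real (sqrt pi)))"
    unfolding has_bochner_integral_iff
    using P.integral_tensor_product[OF f g] by (simp add: gi integral_distr)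
  moreover have "AE x in distr M borel T \<Otimes>\<^sub>M std_normal_distribution.
      (\<lambda>(t, y). complex_of_real t powr (z - 1) * complex_of_real \<bar>y\<bar> powr (2 * z - 2)) x
      = complex_of_real \<bar>case x of (t, y) \<Rightarrow> sqrt t * y\<bar> powr (2 * z - 2)"
  proof (rule P.AE_pair_measure)
    show "AE t in distr M borel T. AE y in std_normal_distribution.
      (\<lambda>(t, y). complex_of_real t powr (z - 1) * complex_of_real \<bar>y\<bar> powr (2 * z - 2)) (t, y)
      = complex_of_real \<bar>case (t, y) of (t, y) \<Rightarrow> sqrt t * y\<bar> powr (2 * z - 2)"
      using PT0
    proof eventually_elim
      fix t :: real assume "0 \<le> t"
      from of_real_powr_scaling[OF this, of _ "z - 1"] show "AE y in std_normal_distribution.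
      (\<lambda>(t, y). complex_of_real t powr (z - 1) * complex_of_real \<bar>y\<bar> powr (2 * z - 2)) (t, y)
      = complex_of_real \<bar>case (t, y) of (t, y) \<Rightarrow> sqrt t * y\<bar> powr (2 * z - 2)"
        by (simp add: algebra_simps)
    qed
  qed measurable
  ultimately have "has_bochner_integral (distr M borel T \<Otimes>\<^sub>M std_normal_distribution)
      (\<lambda>x. complex_of_real \<bar>case x of (t, y) \<Rightarrow> sqrt t * y\<bar> powr (2 * z - 2))
      ((\<integral>\<omega>. complex_of_real (T \<omega>) powr (z - 1) \<partial>M) * (2 powr (z - 1) * Gamma (z - 1/2) / of_real (sqrt pi)))"
    by (subst has_bochner_integral_cong_AE[symmetric]) auto
  then show ?thesis
    unfolding time_changed_brownian_motion_law(2)[OF BM T T0 indep]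
    by (intro has_bochner_integral_distr) auto
qed

text \<open>The Mellin transform integrates over the open half-line only; the value $T = 0$ contributes
  nothing on the left because \<open>0 powr s = 0\<close>.\<close>

lemma expectation_powr_eq_mellin:
  assumes T0: "\<forall>\<omega>\<in>space M. 0 \<le> T \<omega>" and p: "\<forall>x. 0 \<le> p x"
    and dist: "distributed M lborel T (\<lambda>x. ennreal (p x))"
  shows "(\<integral>\<omega>. complex_of_real (T \<omega>) powr (z - 1) \<partial>M) = mellin p z"
proof -
  let ?g = "\<lambda>t. indicator {0<..} t *\<^sub>R complex_of_real t powr (z - 1)"
  have [measurable]: "p \<in> borel_measurable borel"
    using distributed_real_measurable[OF _ dist] p by simp
  have [measurable]: "T \<in> measurable M lborel" using dist by (simp add: distributed_def)
  have "(\<integral>t. p t *\<^sub>R ?g t \<partial>lborel) = (\<integral>t. ?g t \<partial>density lborel (\<lambda>x. ennreal (p x)))"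
    using p by (subst integral_density) auto
  also have "density lborel (\<lambda>x. ennreal (p x)) = distr M lborel T"
    using dist by (simp add: distributed_def)
  also have "(\<integral>t. ?g t \<partial>distr M lborel T) = (\<integral>\<omega>. ?g (T \<omega>) \<partial>M)"
    by (rule integral_distr) measurable
  also have "\<dots> = (\<integral>\<omega>. complex_of_real (T \<omega>) powr (z - 1) \<partial>M)"
    using T0 by (intro Bochner_Integration.integral_cong) (auto simp: indicator_def le_less)
  also have "(\<integral>t. p t *\<^sub>R ?g t \<partial>lborel) = mellin p z"
    unfolding mellin_def set_lebesgue_integral_def
    by (intro Bochner_Integration.integral_cong) (auto simp: scaleR_conv_of_real)
  finally show ?thesis by simp
qed

section \<open>Mean square error of a sample mean\<close>

text \<open>Bienayme's identity: in the expansion of the square of the centred sum the mixed terms vanish by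
  independence. The variance is then bounded by the second moment.\<close>

lemma (in prob_space) sample_mean_variance_real:
  fixes Y :: "nat \<Rightarrow> 'a \<Rightarrow> real"
  assumes indep: "indep_vars (\<lambda>_. borel) Y {1..n}" and n: "n \<ge> 1"
    and sq: "\<And>k. k \<in> {1..n} \<Longrightarrow> integrable M (\<lambda>\<omega>. (Y k \<omega>)\<^sup>2)"
    and mean: "\<And>k. k \<in> {1..n} \<Longrightarrow> expectation (Y k) = m"
    and second: "\<And>k. k \<in> {1..n} \<Longrightarrow> expectation (\<lambda>\<omega>. (Y k \<omega>)\<^sup>2) = s"
  shows "integrable M (\<lambda>\<omega>. ((1 / real n) * (\<Sum>k=1..n. Y k \<omega>) - m)\<^sup>2)"
    and "expectation (\<lambda>\<omega>. ((1 / real n) * (\<Sum>k=1..n. Y k \<omega>) - m)\<^sup>2) \<le> s / real n"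
proof -
  define Z where "Z k \<omega> = Y k \<omega> - m" for k \<omega>
  have Y_meas[measurable]: "Y k \<in> borel_measurable M" if "k \<in> {1..n}" for k
    using indep that by (auto simp: indep_vars_def)
  have Y_int: "integrable M (Y k)" if "k \<in> {1..n}" for k
    using square_integrable_imp_integrable[OF Y_meas[OF that] sq[OF that]] .
  have Z_int: "integrable M (Z k)" if "k \<in> {1..n}" for k
    unfolding Z_def using Y_int[OF that] by simp
  have Z_mean: "expectation (Z k) = 0" if "k \<in> {1..n}" for k
    unfolding Z_def using Y_int[OF that] mean[OF that] by (simp add: prob_space)
  have Z_indep: "indep_vars (\<lambda>_. borel) Z {1..n}"
    unfolding Z_def by (rule indep_vars_compose2[OF indep]) measurable
  have Z_sq_eq: "(Z k \<omega>)\<^sup>2 = (Y k \<omega>)\<^sup>2 - 2 * m * Y k \<omega> + m\<^sup>2" for k \<omega>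
    by (simp add: Z_def power2_diff)
  have Z_sq: "integrable M (\<lambda>\<omega>. (Z k \<omega>)\<^sup>2)" "expectation (\<lambda>\<omega>. (Z k \<omega>)\<^sup>2) \<le> s" if "k \<in> {1..n}" for k
  proof -
    show "integrable M (\<lambda>\<omega>. (Z k \<omega>)\<^sup>2)"
      unfolding Z_sq_eq using sq[OF that] Y_int[OF that] by simp
    have "expectation (\<lambda>\<omega>. (Z k \<omega>)\<^sup>2) = s - 2 * m * m + m\<^sup>2"
      unfolding Z_sq_eq using sq[OF that] Y_int[OF that] mean[OF that] second[OF that]
      by (simp add: prob_space)
    then show "expectation (\<lambda>\<omega>. (Z k \<omega>)\<^sup>2) \<le> s" by (simp add: power2_eq_square)
  qed
  have cross: "integrable M (\<lambda>\<omega>. Z i \<omega> * Z j \<omega>)" "expectation (\<lambda>\<omega>. Z i \<omega> * Z j \<omega>) = (if i = j then expectation (\<lambda>\<omega>. (Z i \<omega>)\<^sup>2) else 0)"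
    if ij: "i \<in> {1..n}" "j \<in> {1..n}" for i j
  proof -
    have "integrable M (\<lambda>\<omega>. Z i \<omega> * Z j \<omega>) \<and> expectation (\<lambda>\<omega>. Z i \<omega> * Z j \<omega>) = 0" if "i \<noteq> j"
    proof -
      have ind: "indep_vars (\<lambda>_. borel) Z {i, j}"
        using indep_vars_subset[OF Z_indep] ij by auto
      have "integrable M (\<lambda>\<omega>. \<Prod>k\<in>{i,j}. Z k \<omega>)"
        using Z_int ij by (intro indep_vars_integrable[OF _ ind]) auto
      moreover have "expectation (\<lambda>\<omega>. \<Prod>k\<in>{i,j}. Z k \<omega>) = (\<Prod>k\<in>{i,j}. expectation (Z k))"
        using Z_int ij by (intro indep_vars_lebesgue_integral[OF _ ind]) auto
      ultimately show ?thesis using that Z_mean ij by simp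
    qed
    then show "integrable M (\<lambda>\<omega>. Z i \<omega> * Z j \<omega>)" "expectation (\<lambda>\<omega>. Z i \<omega> * Z j \<omega>) = (if i = j then expectation (\<lambda>\<omega>. (Z i \<omega>)\<^sup>2) else 0)"
      using Z_sq(1)[OF ij(1)] by (cases "i = j"; simp add: power2_eq_square)+
  qed
  have eq: "((1 / real n) * (\<Sum>k=1..n. Y k \<omega>) - m)\<^sup>2 = (1 / (real n)\<^sup>2) * (\<Sum>i=1..n. \<Sum>j=1..n. Z i \<omega> * Z j \<omega>)" for \<omega>
  proof -
    have "(\<Sum>k=1..n. Z k \<omega>) = (\<Sum>k=1..n. Y k \<omega>) - real n * m"
      by (simp add: Z_def sum_subtractf)
    then have "(1 / real n) * (\<Sum>k=1..n. Y k \<omega>) - m = (1 / real n) * (\<Sum>k=1..n. Z k \<omega>)"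
      using n by (simp add: field_simps)
    then show ?thesis by (simp add: power_mult_distrib power_divide) (simp add: power2_eq_square sum_product)
  qed
  show "integrable M (\<lambda>\<omega>. ((1 / real n) * (\<Sum>k=1..n. Y k \<omega>) - m)\<^sup>2)"
    unfolding eq by (intro integrable_mult_right Bochner_Integration.integrable_sum cross)
  have "expectation (\<lambda>\<omega>. ((1 / real n) * (\<Sum>k=1..n. Y k \<omega>) - m)\<^sup>2)
     = (1 / (real n)\<^sup>2) * (\<Sum>i=1..n. \<Sum>j=1..n. expectation (\<lambda>\<omega>. Z i \<omega> * Z j \<omega>))"
    unfolding eq integral_mult_right_zero
    by (subst Bochner_Integration.integral_sum, intro Bochner_Integration.integrable_sum cross, assumption+,
        intro arg_cong2[where f="(*)"] sum.cong refl Bochner_Integration.integral_sum cross)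
  also have "(\<Sum>i=1..n. \<Sum>j=1..n. expectation (\<lambda>\<omega>. Z i \<omega> * Z j \<omega>)) = (\<Sum>i=1..n. expectation (\<lambda>\<omega>. (Z i \<omega>)\<^sup>2))"
  proof (intro sum.cong refl)
    fix i assume i: "i \<in> {1..n}"
    have "(\<Sum>j=1..n. expectation (\<lambda>\<omega>. Z i \<omega> * Z j \<omega>)) = (\<Sum>j=1..n. if i = j then expectation (\<lambda>\<omega>. (Z i \<omega>)\<^sup>2) else 0)"
      by (intro sum.cong refl cross(2) i)
    then show "(\<Sum>j=1..n. expectation (\<lambda>\<omega>. Z i \<omega> * Z j \<omega>)) = expectation (\<lambda>\<omega>. (Z i \<omega>)\<^sup>2)"
      using i by simp
  qed
  also have "\<dots> \<le> real n * s"
    using sum_mono[of "{1..n}" "\<lambda>i. expectation (\<lambda>\<omega>. (Z i \<omega>)\<^sup>2)" "\<lambda>_. s"] Z_sq(2) by simp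
  finally show "expectation (\<lambda>\<omega>. ((1 / real n) * (\<Sum>k=1..n. Y k \<omega>) - m)\<^sup>2) \<le> s / real n"
    using n by (simp add: power2_eq_square field_simps mult_left_mono)
qed

lemma (in prob_space) sample_mean_variance_complex:
  fixes X :: "nat \<Rightarrow> 'a \<Rightarrow> real" and G :: "real \<Rightarrow> complex"
  assumes indep: "indep_vars (\<lambda>_. borel) X {1..}" and n: "n \<ge> 1"
    and law: "\<And>k. k \<ge> 1 \<Longrightarrow> distr M borel (X k) = P"
    and G[measurable]: "G \<in> borel_measurable borel"
    and sq: "integrable P (\<lambda>y. (cmod (G y))\<^sup>2)"
  shows "integrable M (\<lambda>\<omega>. (cmod ((1 / of_nat n) * (\<Sum>k=1..n. G (X k \<omega>)) - (\<integral>y. G y \<partial>P)))\<^sup>2)"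
    and "expectation (\<lambda>\<omega>. (cmod ((1 / of_nat n) * (\<Sum>k=1..n. G (X k \<omega>)) - (\<integral>y. G y \<partial>P)))\<^sup>2)
      \<le> (\<integral>y. (cmod (G y))\<^sup>2 \<partial>P) / real n"
proof -
  have X[measurable]: "X k \<in> borel_measurable M" if "k \<ge> 1" for k
    using indep that by (auto simp: indep_vars_def)
  have P_sets[measurable_cong]: "sets P = sets borel" using law[of 1] by (metis le_refl sets_distr)
  interpret P: prob_space P using prob_space_distr[OF X[of 1]] law[of 1] by simp
  have ind: "indep_vars (\<lambda>_. borel) (\<lambda>k \<omega>. g (X k \<omega>)) {1..n}" if "g \<in> borel_measurable borel" for g :: "real \<Rightarrow> real"
    by (rule indep_vars_compose2[OF indep_vars_subset[OF indep]]) (use that in auto)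
  have ex: "integrable P g \<Longrightarrow> integrable M (\<lambda>\<omega>. g (X k \<omega>))" "expectation (\<lambda>\<omega>. g (X k \<omega>)) = (\<integral>y. g y \<partial>P)"
    if [measurable]: "g \<in> borel_measurable borel" and k: "k \<ge> 1" for g :: "real \<Rightarrow> real" and k
    using X[OF k] unfolding law[OF k, symmetric] by (simp_all add: integrable_distr_eq integral_distr)
  have sqRe: "integrable P (\<lambda>y. (Re (G y))\<^sup>2)" and sqIm: "integrable P (\<lambda>y. (Im (G y))\<^sup>2)"
  proof -
    have "(Re (G y))\<^sup>2 \<le> (cmod (G y))\<^sup>2" "(Im (G y))\<^sup>2 \<le> (cmod (G y))\<^sup>2" for y
      by (simp_all add: cmod_power2)
    then show "integrable P (\<lambda>y. (Re (G y))\<^sup>2)" "integrable P (\<lambda>y. (Im (G y))\<^sup>2)"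
      by (auto intro!: Bochner_Integration.integrable_bound[OF sq] simp del: power2_abs)
  qed
  have Gint: "integrable P G"
  proof -
    have "integrable P (\<lambda>y. cmod (G y))"
      by (rule P.square_integrable_imp_integrable[OF _ sq]) measurable
    then show ?thesis by (subst (asm) integrable_norm_iff) auto
  qed
  let ?A = "\<lambda>\<omega>. (1 / of_nat n) * (\<Sum>k=1..n. G (X k \<omega>)) - (\<integral>y. G y \<partial>P)"
  have A: "(cmod (?A \<omega>))\<^sup>2 = ((1 / real n) * (\<Sum>k=1..n. Re (G (X k \<omega>))) - (\<integral>y. Re (G y) \<partial>P))\<^sup>2
      + ((1 / real n) * (\<Sum>k=1..n. Im (G (X k \<omega>))) - (\<integral>y. Im (G y) \<partial>P))\<^sup>2" for \<omega>
  proof -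
    have 1: "1 / of_nat n = complex_of_real (1 / real n)" by simp
    have 2: "Re (of_real r * w) = r * Re w" "Im (of_real r * w) = r * Im w" for r w by simp_all
    have "Re (?A \<omega>) = (1 / real n) * (\<Sum>k=1..n. Re (G (X k \<omega>))) - (\<integral>y. Re (G y) \<partial>P)"
        "Im (?A \<omega>) = (1 / real n) * (\<Sum>k=1..n. Im (G (X k \<omega>))) - (\<integral>y. Im (G y) \<partial>P)"
      unfolding 1 minus_complex.simps 2 Re_sum Im_sum integral_Re[OF Gint] integral_Im[OF Gint] by (rule refl)+
    then show ?thesis by (simp only: cmod_power2)
  qed
  have gen: "integrable M (\<lambda>\<omega>. ((1 / real n) * (\<Sum>k=1..n. g (X k \<omega>)) - (\<integral>y. g y \<partial>P))\<^sup>2)"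
      "expectation (\<lambda>\<omega>. ((1 / real n) * (\<Sum>k=1..n. g (X k \<omega>)) - (\<integral>y. g y \<partial>P))\<^sup>2) \<le> (\<integral>y. (g y)\<^sup>2 \<partial>P) / real n"
    if g: "g \<in> borel_measurable borel" and gsq: "integrable P (\<lambda>y. (g y)\<^sup>2)" for g :: "real \<Rightarrow> real"
  proof -
    have g2: "(\<lambda>y. (g y)\<^sup>2) \<in> borel_measurable borel" using g by measurable
    have 1: "integrable M (\<lambda>\<omega>. (g (X k \<omega>))\<^sup>2)" "expectation (\<lambda>\<omega>. g (X k \<omega>)) = (\<integral>y. g y \<partial>P)"
      "expectation (\<lambda>\<omega>. (g (X k \<omega>))\<^sup>2) = (\<integral>y. (g y)\<^sup>2 \<partial>P)" if "k \<in> {1..n}" for k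
      using ex(1)[OF g2 _ gsq, of k] ex(2)[OF g, of k] ex(2)[OF g2, of k] that by simp_all
    show "integrable M (\<lambda>\<omega>. ((1 / real n) * (\<Sum>k=1..n. g (X k \<omega>)) - (\<integral>y. g y \<partial>P))\<^sup>2)"
      by (rule sample_mean_variance_real(1)[OF ind[OF g] n 1])
    show "expectation (\<lambda>\<omega>. ((1 / real n) * (\<Sum>k=1..n. g (X k \<omega>)) - (\<integral>y. g y \<partial>P))\<^sup>2) \<le> (\<integral>y. (g y)\<^sup>2 \<partial>P) / real n"
      by (rule sample_mean_variance_real(2)[OF ind[OF g] n 1])
  qed
  have "(\<lambda>y. Re (G y)) \<in> borel_measurable borel" by measurable
  note re = gen[OF this sqRe]
  have "(\<lambda>y. Im (G y)) \<in> borel_measurable borel" by measurable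
  note im = gen[OF this sqIm]
  show "integrable M (\<lambda>\<omega>. (cmod (?A \<omega>))\<^sup>2)" unfolding A by (intro Bochner_Integration.integrable_add re(1) im(1))
  have "expectation (\<lambda>\<omega>. (cmod (?A \<omega>))\<^sup>2) \<le> (\<integral>y. (Re (G y))\<^sup>2 \<partial>P) / real n + (\<integral>y. (Im (G y))\<^sup>2 \<partial>P) / real n"
    unfolding A using re(2) im(2) by (subst Bochner_Integration.integral_add[OF re(1) im(1)]) (rule add_mono)
  also have "\<dots> = (\<integral>y. (cmod (G y))\<^sup>2 \<partial>P) / real n"
    using sqRe sqIm by (simp add: cmod_power2 add_divide_distrib)
  finally show "expectation (\<lambda>\<omega>. (cmod (?A \<omega>))\<^sup>2) \<le> (\<integral>y. (cmod (G y))\<^sup>2 \<partial>P) / real n" .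
qed

section \<open>The estimator as a sample mean and its bias\<close>

text \<open>The factor of the integrand of the estimator that does not depend on the data. It uses the entire
  function $1/\Gamma$, so that continuity in \<open>v\<close> is immediate.\<close>

definition estimator_weight :: "real \<Rightarrow> real \<Rightarrow> real \<Rightarrow> real \<Rightarrow> complex" where
  "estimator_weight \<gamma> h x v = complex_of_real x powr (- Complex \<gamma> v) * complex_of_real (kernel (v * h))
     * rGamma (Complex (\<gamma> - 1/2) v) / 2 powr (Complex \<gamma> v)"

text \<open>The contribution $G_x(y)$ of a single observation \<open>y\<close>.\<close>

definition estimator_summand :: "real \<Rightarrow> real \<Rightarrow> real \<Rightarrow> real \<Rightarrow> complex" where
  "estimator_summand \<gamma> h x y = of_real (1 / sqrt pi) *
     (CLBINT v. estimator_weight \<gamma> h x v * complex_of_real \<bar>y\<bar> powr (2 * Complex \<gamma> v - 2))"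

text \<open>Separates modulus and phase; the modulus does not depend on \<open>v\<close>.\<close>

lemma abs_powr_line:
  "complex_of_real \<bar>y\<bar> powr (2 * Complex \<gamma> v - 2) = of_real (\<bar>y\<bar> powr (2 * \<gamma> - 2)) * iexp (2 * v * ln \<bar>y\<bar>)"
proof (cases "y = 0")
  case False
  have "2 * Complex \<gamma> v - 2 = Complex (2 * \<gamma> - 2) (2 * v)" by (simp add: complex_eq_iff)
  then show ?thesis using of_real_powr_line[of "\<bar>y\<bar>" "2 * \<gamma> - 2" "2 * v"] False by simp
qed simp

lemma kernel_eq_indicator: "h > 0 \<Longrightarrow> kernel (v * h) = indicator {-1/h..1/h} v"
  by (auto simp: kernel_def indicator_def field_simps)

lemma estimator_weight_eq:
  assumes "h > 0" "x > 0"
  shows "estimator_weight \<gamma> h x v = indicator {-1/h..1/h} v *\<^sub>R (of_real (x powr (- \<gamma>) / 2 powr \<gamma>)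
    * (iexp (- (v * ln x)) * rGamma (Complex (\<gamma> - 1/2) v) / iexp (v * ln 2)))"
proof -
  note 1 = of_real_powr_uminus_line[OF assms(2)]
  have 2: "2 powr (Complex \<gamma> v) = complex_of_real (2 powr \<gamma>) * iexp (v * ln 2)"
    using of_real_powr_line[of 2 \<gamma> v] by simp
  show ?thesis unfolding estimator_weight_def 1 2 kernel_eq_indicator[OF assms(1)]
    by (simp add: scaleR_conv_of_real)
qed

lemma estimator_weight_integrable:
  assumes "h > 0" "x > 0"
  shows "integrable lborel (estimator_weight \<gamma> h x)"
    and "(LBINT v. cmod (estimator_weight \<gamma> h x v))
      = x powr (- \<gamma>) / 2 powr \<gamma> * (LINT v:{-1/h..1/h}|lborel. cmod (rGamma (Complex (\<gamma> - 1/2) v)))"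
proof -
  have "set_integrable lborel {-1/h..1/h} (\<lambda>v. of_real (x powr (- \<gamma>) / 2 powr \<gamma>)
    * (iexp (- (v * ln x)) * rGamma (Complex (\<gamma> - 1/2) v) / iexp (v * ln 2)))"
    by (intro borel_integrable_atLeastAtMost' continuous_intros continuous_on_rGamma_line) auto
  then show "integrable lborel (estimator_weight \<gamma> h x)"
    unfolding set_integrable_def by (simp only: estimator_weight_eq[OF assms, abs_def])
  have "cmod (estimator_weight \<gamma> h x v) = x powr (- \<gamma>) / 2 powr \<gamma> * (indicator {-1/h..1/h} v *\<^sub>R cmod (rGamma (Complex (\<gamma> - 1/2) v)))" for v
    unfolding estimator_weight_eq[OF assms] by (simp add: norm_mult norm_divide)
  then show "(LBINT v. cmod (estimator_weight \<gamma> h x v))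
      = x powr (- \<gamma>) / 2 powr \<gamma> * (LINT v:{-1/h..1/h}|lborel. cmod (rGamma (Complex (\<gamma> - 1/2) v)))"
    by (simp only: set_lebesgue_integral_def integral_mult_right_zero)
qed

lemma estimator_summand_integrand_integrable:
  assumes "h > 0" "x > 0"
  shows "integrable lborel (\<lambda>v. estimator_weight \<gamma> h x v * complex_of_real \<bar>y\<bar> powr (2 * Complex \<gamma> v - 2))"
proof (rule Bochner_Integration.integrable_bound)
  have [measurable]: "estimator_weight \<gamma> h x \<in> borel_measurable borel"
    using borel_measurable_integrable[OF estimator_weight_integrable(1)[OF assms]] by simp
  show "integrable lborel (\<lambda>v. \<bar>y\<bar> powr (2 * \<gamma> - 2) * cmod (estimator_weight \<gamma> h x v))"
    using estimator_weight_integrable(1)[OF assms] by simp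
  show "(\<lambda>v. estimator_weight \<gamma> h x v * complex_of_real \<bar>y\<bar> powr (2 * Complex \<gamma> v - 2)) \<in> borel_measurable lborel"
    unfolding abs_powr_line by measurable
qed (simp add: abs_powr_line norm_mult)

lemma estimator_eq_sample_mean:
  assumes "h > 0" "x > 0"
  shows "estimator \<gamma> h n y x = (1 / of_nat n) * (\<Sum>k=1..n. estimator_summand \<gamma> h x (y k))"
proof -
  let ?a = "\<lambda>v k. complex_of_real \<bar>y k\<bar> powr (2 * Complex \<gamma> v - 2)"
  have pt: "complex_of_real x powr (- Complex \<gamma> v) * complex_of_real (kernel (v * h)) *
        (empirical_mellin n y (2 * Complex \<gamma> v - 1) / (2 powr (Complex \<gamma> v) * Gamma (Complex (\<gamma> - 1/2) v)))
      = (1 / of_nat n) * (\<Sum>k=1..n. estimator_weight \<gamma> h x v * ?a v k)" for v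
  proof -
    have "2 * Complex \<gamma> v - 1 - 1 = 2 * Complex \<gamma> v - 2" by simp
    then have e: "empirical_mellin n y (2 * Complex \<gamma> v - 1) = (1 / of_nat n) * (\<Sum>k=1..n. ?a v k)"
      unfolding empirical_mellin_def by (simp only:)
    have "a * ((c * S) / (q * inverse r)) = c * ((a * r / q) * S)" for a c S q r :: complex
      by (simp add: divide_inverse)
    then show ?thesis
      unfolding e estimator_weight_def Gamma_def sum_distrib_left[symmetric] .
  qed
  have "(CLBINT v. (1 / of_nat n) * (\<Sum>k=1..n. estimator_weight \<gamma> h x v * ?a v k))
      = (1 / of_nat n) * (\<Sum>k=1..n. (CLBINT v. estimator_weight \<gamma> h x v * ?a v k))"
    unfolding integral_mult_right_zero
    by (simp only: Bochner_Integration.integral_sum[OF estimator_summand_integrand_integrable[OF assms]])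
  then have "estimator \<gamma> h n y x = of_real (1 / sqrt pi) * ((1 / of_nat n) * (\<Sum>k=1..n. (CLBINT v. estimator_weight \<gamma> h x v * ?a v k)))"
    unfolding estimator_def pt by (rule arg_cong)
  also have "\<dots> = (1 / of_nat n) * (\<Sum>k=1..n. estimator_summand \<gamma> h x (y k))"
    unfolding estimator_summand_def sum_distrib_left[symmetric] by (rule mult.left_commute)
  finally show ?thesis .
qed

lemma estimator_summand_measurable:
  assumes "h > 0" "x > 0"
  shows "estimator_summand \<gamma> h x \<in> borel_measurable borel"
proof -
  have [measurable]: "estimator_weight \<gamma> h x \<in> borel_measurable borel"
    using borel_measurable_integrable[OF estimator_weight_integrable(1)[OF assms]] by simp
  show ?thesis unfolding estimator_summand_def[abs_def] abs_powr_line by measurable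
qed

lemma norm_estimator_summand_le:
  assumes "h > 0" "x > 0"
  shows "cmod (estimator_summand \<gamma> h x y) \<le> 1 / sqrt pi * (LBINT v. cmod (estimator_weight \<gamma> h x v)) * \<bar>y\<bar> powr (2 * \<gamma> - 2)"
proof -
  have "cmod (CLBINT v. estimator_weight \<gamma> h x v * complex_of_real \<bar>y\<bar> powr (2 * Complex \<gamma> v - 2))
     \<le> (LBINT v. cmod (estimator_weight \<gamma> h x v * complex_of_real \<bar>y\<bar> powr (2 * Complex \<gamma> v - 2)))"
    by (rule integral_norm_bound)
  also have "\<dots> = (LBINT v. cmod (estimator_weight \<gamma> h x v)) * \<bar>y\<bar> powr (2 * \<gamma> - 2)"
    by (simp add: norm_mult abs_powr_line)
  finally have "1 / sqrt pi * cmod (CLBINT v. estimator_weight \<gamma> h x v * complex_of_real \<bar>y\<bar> powr (2 * Complex \<gamma> v - 2))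
     \<le> 1 / sqrt pi * ((LBINT v. cmod (estimator_weight \<gamma> h x v)) * \<bar>y\<bar> powr (2 * \<gamma> - 2))"
    by (rule mult_left_mono) simp
  moreover have "cmod (of_real (1 / sqrt pi)) = 1 / sqrt pi" by (simp only: norm_of_real) simp
  ultimately show ?thesis
    unfolding estimator_summand_def norm_mult by (simp only: mult.assoc)
qed

lemma estimator_summand_second_moment:
  assumes "h > 0" "x > 0" and P: "sets P = sets borel"
    and int: "integrable P (\<lambda>y. \<bar>y\<bar> powr (4 * \<gamma> - 4))"
  shows "integrable P (\<lambda>y. (cmod (estimator_summand \<gamma> h x y))\<^sup>2)"
    and "(\<integral>y. (cmod (estimator_summand \<gamma> h x y))\<^sup>2 \<partial>P)
      \<le> 1 / pi * (LBINT v. cmod (estimator_weight \<gamma> h x v))\<^sup>2 * (\<integral>y. \<bar>y\<bar> powr (4 * \<gamma> - 4) \<partial>P)"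
proof -
  let ?W = "LBINT v. cmod (estimator_weight \<gamma> h x v)"
  have b: "(cmod (estimator_summand \<gamma> h x y))\<^sup>2 \<le> 1 / pi * ?W\<^sup>2 * \<bar>y\<bar> powr (4 * \<gamma> - 4)" for y
  proof -
    have "(cmod (estimator_summand \<gamma> h x y))\<^sup>2 \<le> (1 / sqrt pi * ?W * \<bar>y\<bar> powr (2 * \<gamma> - 2))\<^sup>2"
      by (intro power_mono norm_estimator_summand_le assms) simp
    also have "(\<bar>y\<bar> powr (2 * \<gamma> - 2))\<^sup>2 = \<bar>y\<bar> powr (4 * \<gamma> - 4)"
      unfolding power2_eq_square by (simp only: powr_add[symmetric]) simp
    then have "(1 / sqrt pi * ?W * \<bar>y\<bar> powr (2 * \<gamma> - 2))\<^sup>2 = 1 / pi * ?W\<^sup>2 * \<bar>y\<bar> powr (4 * \<gamma> - 4)"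
      by (simp add: power_mult_distrib power_divide)
    finally show ?thesis .
  qed
  have rhs: "integrable P (\<lambda>y. 1 / pi * ?W\<^sup>2 * \<bar>y\<bar> powr (4 * \<gamma> - 4))"
    using int by (rule integrable_mult_right)
  have [measurable]: "estimator_summand \<gamma> h x \<in> borel_measurable P"
    using estimator_summand_measurable[OF assms(1,2)] P by (simp cong: measurable_cong_sets)
  show I: "integrable P (\<lambda>y. (cmod (estimator_summand \<gamma> h x y))\<^sup>2)"
    by (rule Bochner_Integration.integrable_bound[OF rhs]) (use b in \<open>auto simp: order.trans[OF _ abs_ge_self]\<close>)
  have "(\<integral>y. (cmod (estimator_summand \<gamma> h x y))\<^sup>2 \<partial>P) \<le> (\<integral>y. 1 / pi * ?W\<^sup>2 * \<bar>y\<bar> powr (4 * \<gamma> - 4) \<partial>P)"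
    by (rule integral_mono[OF I rhs b])
  then show "(\<integral>y. (cmod (estimator_summand \<gamma> h x y))\<^sup>2 \<partial>P)
      \<le> 1 / pi * ?W\<^sup>2 * (\<integral>y. \<bar>y\<bar> powr (4 * \<gamma> - 4) \<partial>P)"
    by (simp only: integral_mult_right_zero)
qed

text \<open>The Gamma factor and the power of 2 in the moments cancel against those in the weight, and
  $\pi^{-1/2} \cdot (2 \pi^{1/2})^{-1} = (2\pi)^{-1}$ is the constant of Mellin inversion.\<close>

lemma estimator_summand_mean:
  fixes m :: "real \<Rightarrow> complex"
  assumes "h > 0" "x > 0" and P: "sets P = sets borel" "prob_space P"
    and int: "integrable P (\<lambda>y. \<bar>y\<bar> powr (2 * \<gamma> - 2))" and \<gamma>: "1/2 < \<gamma>"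
    and moment: "\<And>v. (\<integral>y. complex_of_real \<bar>y\<bar> powr (2 * Complex \<gamma> v - 2) \<partial>P)
      = m v * (2 powr (Complex \<gamma> v - 1) * Gamma (Complex \<gamma> v - 1/2) / of_real (sqrt pi))"
  shows "(\<integral>y. estimator_summand \<gamma> h x y \<partial>P) = mellin_inverse \<gamma> (\<lambda>v. of_real (kernel (v * h)) * m v) x"
proof -
  interpret P: prob_space P by fact
  interpret Q: pair_sigma_finite lborel P ..
  note P(1)[measurable_cong]
  have [measurable]: "estimator_weight \<gamma> h x \<in> borel_measurable borel"
    using borel_measurable_integrable[OF estimator_weight_integrable(1)[OF assms(1,2)]] by simp
  have fub: "integrable (lborel \<Otimes>\<^sub>M P) (\<lambda>(v, y). estimator_weight \<gamma> h x v * complex_of_real \<bar>y\<bar> powr (2 * Complex \<gamma> v - 2))"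
    unfolding abs_powr_line
  proof (rule Q.Fubini_integrable)
    show "(\<lambda>(v, y). estimator_weight \<gamma> h x v * (of_real (\<bar>y\<bar> powr (2 * \<gamma> - 2)) * iexp (2 * v * ln \<bar>y\<bar>))) \<in> borel_measurable (lborel \<Otimes>\<^sub>M P)"
      by measurable
    show "integrable lborel (\<lambda>v. \<integral>y. norm (case (v, y) of (v, y) \<Rightarrow> estimator_weight \<gamma> h x v * (of_real (\<bar>y\<bar> powr (2 * \<gamma> - 2)) * iexp (2 * v * ln \<bar>y\<bar>))) \<partial>P)"
      using estimator_weight_integrable(1)[OF assms(1,2)] by (simp add: norm_mult)
    show "AE v in lborel. integrable P (\<lambda>y. case (v, y) of (v, y) \<Rightarrow> estimator_weight \<gamma> h x v * (of_real (\<bar>y\<bar> powr (2 * \<gamma> - 2)) * iexp (2 * v * ln \<bar>y\<bar>)))"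
    proof (rule AE_I2)
      fix v :: real
      have "integrable P (\<lambda>y. of_real (\<bar>y\<bar> powr (2 * \<gamma> - 2)) * iexp (2 * v * ln \<bar>y\<bar>))"
        by (rule Bochner_Integration.integrable_bound[OF int]) (auto simp: norm_mult)
      then show "integrable P (\<lambda>y. case (v, y) of (v, y) \<Rightarrow> estimator_weight \<gamma> h x v * (of_real (\<bar>y\<bar> powr (2 * \<gamma> - 2)) * iexp (2 * v * ln \<bar>y\<bar>)))"
        by simp
    qed
  qed
  have "(\<integral>y. estimator_summand \<gamma> h x y \<partial>P) = of_real (1 / sqrt pi) *
      (\<integral>y. (CLBINT v. estimator_weight \<gamma> h x v * complex_of_real \<bar>y\<bar> powr (2 * Complex \<gamma> v - 2)) \<partial>P)"
    unfolding estimator_summand_def by (rule integral_mult_right_zero)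
  also have "(\<integral>y. (CLBINT v. estimator_weight \<gamma> h x v * complex_of_real \<bar>y\<bar> powr (2 * Complex \<gamma> v - 2)) \<partial>P)
      = (CLBINT v. (\<integral>y. estimator_weight \<gamma> h x v * complex_of_real \<bar>y\<bar> powr (2 * Complex \<gamma> v - 2) \<partial>P))"
    by (rule Q.Fubini_integral[OF fub])
  also have "\<dots> = (CLBINT v. estimator_weight \<gamma> h x v * (m v * (2 powr (Complex \<gamma> v - 1) * Gamma (Complex \<gamma> v - 1/2) / of_real (sqrt pi))))"
    by (simp only: integral_mult_right_zero moment)
  also have "\<dots> = (CLBINT v. of_real (1 / (2 * sqrt pi)) * (complex_of_real x powr (- Complex \<gamma> v) * (of_real (kernel (v * h)) * m v)))"
  proof (intro Bochner_Integration.integral_cong refl)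
    fix v :: real
    have z: "Complex (\<gamma> - 1/2) v = Complex \<gamma> v - 1/2" by (simp add: complex_eq_iff)
    have "Complex \<gamma> v - 1/2 \<notin> \<int>\<^sub>\<le>\<^sub>0"
      using \<gamma> by (auto elim!: nonpos_Ints_cases simp: complex_eq_iff)
    then have g: "rGamma (Complex \<gamma> v - 1/2) * Gamma (Complex \<gamma> v - 1/2) = 1"
      by (simp add: Gamma_def rGamma_eq_zero_iff)
    have p: "2 powr (Complex \<gamma> v - 1) = 2 powr (Complex \<gamma> v) / (2 :: complex)"
      by (simp add: powr_diff)
    have nz: "2 powr (Complex \<gamma> v) \<noteq> (0 :: complex)" by simp
    have alg: "a * k * r / q * (m v * (q / 2 * G / s)) = 1 / (2 * s) * (a * (k * m v))"
      if "r * G = 1" "q \<noteq> 0" for a k r q G s :: complex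
    proof -
      have "a * k * r / q * (m v * (q / 2 * G / s)) = (r * G) * (1 / (2 * s) * (a * (k * m v)))"
        using that(2) by simp
      then show ?thesis using that(1) by simp
    qed
    have s: "complex_of_real (1 / (2 * sqrt pi)) = 1 / (2 * of_real (sqrt pi))" by simp
    show "estimator_weight \<gamma> h x v * (m v * (2 powr (Complex \<gamma> v - 1) * Gamma (Complex \<gamma> v - 1/2) / of_real (sqrt pi)))
      = of_real (1 / (2 * sqrt pi)) * (complex_of_real x powr (- Complex \<gamma> v) * (of_real (kernel (v * h)) * m v))"
      unfolding estimator_weight_def z p s by (rule alg[OF g nz])
  qed
  also have "\<dots> = of_real (1 / (2 * sqrt pi)) * (CLBINT v. complex_of_real x powr (- Complex \<gamma> v) * (of_real (kernel (v * h)) * m v))"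
    by (rule integral_mult_right_zero)
  also have "of_real (1 / sqrt pi) * (of_real (1 / (2 * sqrt pi)) * I) = 1 / (2 * pi) * I" for I :: complex
  proof -
    have "1 / sqrt pi * (1 / (2 * sqrt pi)) = 1 / (2 * pi)" by simp
    then show ?thesis by (metis mult.assoc of_real_mult)
  qed
  finally show ?thesis by (simp add: mellin_inverse_def)
qed

lemma integrable_of_weighted_norm:
  fixes m :: "real \<Rightarrow> complex"
  assumes m[measurable]: "m \<in> borel_measurable borel"
    and bound: "(\<integral>\<^sup>+v. ennreal (cmod (m v) * (1 + \<bar>v\<bar> powr \<beta>)) \<partial>lborel) < ennreal L"
  shows "integrable lborel (\<lambda>v. cmod (m v) * (1 + \<bar>v\<bar> powr \<beta>))" and "integrable lborel m"
proof -
  show B: "integrable lborel (\<lambda>v. cmod (m v) * (1 + \<bar>v\<bar> powr \<beta>))"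
    using bound by (intro integrableI_bounded) (auto simp: abs_mult intro: less_trans)
  show "integrable lborel m"
    by (rule Bochner_Integration.integrable_bound[OF B]) (auto simp: distrib_left)
qed

text \<open>The difference is the inversion integral over $|v| > 1/h$, where $1 \le (h|v|)^\beta$.\<close>

lemma truncation_bias:
  fixes m :: "real \<Rightarrow> complex"
  assumes h: "h > 0" and x: "x > 0" and \<beta>: "\<beta> > 0" and L: "L > 0"
    and m[measurable]: "m \<in> borel_measurable borel"
    and bound: "(\<integral>\<^sup>+v. ennreal (cmod (m v) * (1 + \<bar>v\<bar> powr \<beta>)) \<partial>lborel) < ennreal L"
  shows "x powr \<gamma> * cmod (mellin_inverse \<gamma> m x - mellin_inverse \<gamma> (\<lambda>v. of_real (kernel (v * h)) * m v) x) \<le> L * h powr \<beta>"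
proof -
  let ?B = "\<lambda>v. cmod (m v) * (1 + \<bar>v\<bar> powr \<beta>)"
  note B = integrable_of_weighted_norm(1)[OF m bound] and m_int = integrable_of_weighted_norm(2)[OF m bound]
  have BL: "(LBINT v. ?B v) \<le> L"
  proof -
    have "ennreal (LBINT v. ?B v) = (\<integral>\<^sup>+v. ennreal (?B v) \<partial>lborel)"
      by (rule nn_integral_eq_integral[symmetric, OF B]) simp
    then have "ennreal (LBINT v. ?B v) < ennreal L" using bound by simp
    then show ?thesis using L by (simp add: ennreal_less_iff[OF Bochner_Integration.integral_nonneg])
  qed
  have pt: "cmod (m v - of_real (kernel (v * h)) * m v) \<le> h powr \<beta> * ?B v" for v
  proof (cases "\<bar>v\<bar> * h \<le> 1")
    case True
    then have "\<bar>v * h\<bar> \<le> 1" using h by (simp add: abs_mult)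
    then have "kernel (v * h) = 1" by (simp add: kernel_def indicator_def abs_le_iff)
    then show ?thesis by simp
  next
    case False
    then have "\<not> \<bar>v * h\<bar> \<le> 1" using h by (simp add: abs_mult)
    then have k: "kernel (v * h) = 0" by (auto simp: kernel_def indicator_def)
    have "1 \<le> (\<bar>v\<bar> * h) powr \<beta>" using False \<beta> by (intro ge_one_powr_ge_zero) auto
    also have "\<dots> = h powr \<beta> * \<bar>v\<bar> powr \<beta>" using h by (simp add: powr_mult)
    also have "\<dots> \<le> h powr \<beta> * (1 + \<bar>v\<bar> powr \<beta>)" by (intro mult_left_mono) auto
    finally have "cmod (m v) * 1 \<le> cmod (m v) * (h powr \<beta> * (1 + \<bar>v\<bar> powr \<beta>))"
      by (intro mult_left_mono) auto
    then show ?thesis unfolding k by (simp add: mult_ac)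
  qed
  have km_int: "integrable lborel (\<lambda>v. of_real (kernel (v * h)) * m v)"
    by (rule Bochner_Integration.integrable_bound[OF m_int])
      (auto simp: norm_mult kernel_def indicator_def)
  have phase: "integrable lborel (\<lambda>v. iexp (- (v * ln x)) * g v)" if g: "integrable lborel g" for g :: "real \<Rightarrow> complex"
  proof -
    have [measurable]: "g \<in> borel_measurable borel" using borel_measurable_integrable[OF g] by simp
    show ?thesis by (rule Bochner_Integration.integrable_bound[OF g]) (auto simp: norm_mult)
  qed
  have "mellin_inverse \<gamma> m x - mellin_inverse \<gamma> (\<lambda>v. of_real (kernel (v * h)) * m v) x
     = of_real (x powr (- \<gamma>)) * (1 / (2 * pi) * (CLBINT v. iexp (- (v * ln x)) * (m v - of_real (kernel (v * h)) * m v)))"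
    unfolding mellin_inverse_eq[OF x]
    unfolding right_diff_distrib Bochner_Integration.integral_diff[OF phase[OF m_int] phase[OF km_int]] ..
  then have "x powr \<gamma> * cmod (mellin_inverse \<gamma> m x - mellin_inverse \<gamma> (\<lambda>v. of_real (kernel (v * h)) * m v) x)
     = (x powr \<gamma> * x powr (- \<gamma>)) * (1 / (2 * pi)) * cmod (CLBINT v. iexp (- (v * ln x)) * (m v - of_real (kernel (v * h)) * m v))"
    by (simp add: norm_mult norm_divide)
  also have "x powr \<gamma> * x powr (- \<gamma>) = 1" using x by (simp add: powr_minus)
  also have "1 * (1 / (2 * pi)) * cmod (CLBINT v. iexp (- (v * ln x)) * (m v - of_real (kernel (v * h)) * m v))
     \<le> 1 * 1 * (LBINT v. h powr \<beta> * ?B v)"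
  proof (intro mult_mono)
    show "1 / (2 * pi) \<le> 1" using pi_ge_two by simp
    have "cmod (CLBINT v. iexp (- (v * ln x)) * (m v - of_real (kernel (v * h)) * m v))
      \<le> (LBINT v. cmod (iexp (- (v * ln x)) * (m v - of_real (kernel (v * h)) * m v)))"
      by (rule integral_norm_bound)
    also have "\<dots> \<le> (LBINT v. h powr \<beta> * ?B v)"
    proof (rule integral_mono)
      show "integrable lborel (\<lambda>v. cmod (iexp (- (v * ln x)) * (m v - of_real (kernel (v * h)) * m v)))"
        by (intro integrable_norm phase Bochner_Integration.integrable_diff m_int km_int)
      show "integrable lborel (\<lambda>v. h powr \<beta> * ?B v)" using B by (rule integrable_mult_right)
    qed (use pt in \<open>simp add: norm_mult\<close>)
    finally show "cmod (CLBINT v. iexp (- (v * ln x)) * (m v - of_real (kernel (v * h)) * m v)) \<le> (LBINT v. h powr \<beta> * ?B v)" .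
  qed auto
  also have "\<dots> = h powr \<beta> * (LBINT v. ?B v)" by (simp only: integral_mult_right_zero mult_1)
  also have "\<dots> \<le> h powr \<beta> * L" by (intro mult_left_mono BL) simp
  finally show ?thesis by (simp add: mult.commute)
qed

section \<open>Risk bounds\<close>

text \<open>The square of the error is at most twice the squared bias plus twice the squared deviation of the
  sample mean from its expectation. The weight $x^\gamma$ cancels the modulus $x^{-\gamma}$ of the
  inversion kernel, which makes both terms independent of \<open>x\<close>.\<close>

lemma weighted_risk_bound:
  fixes X :: "nat \<Rightarrow> 'b \<Rightarrow> real" and m :: "real \<Rightarrow> complex"
  assumes N: "prob_space N"
    and indep: "prob_space.indep_vars N (\<lambda>_. borel) X {1..}"
    and law: "\<And>k. k \<ge> 1 \<Longrightarrow> distr N borel (X k) = P"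
    and int: "integrable P (\<lambda>y. \<bar>y\<bar> powr (4 * \<gamma> - 4))" and \<gamma>: "1/2 < \<gamma>"
    and moment: "\<And>v. (\<integral>y. complex_of_real \<bar>y\<bar> powr (2 * Complex \<gamma> v - 2) \<partial>P)
      = m v * (2 powr (Complex \<gamma> v - 1) * Gamma (Complex \<gamma> v - 1/2) / of_real (sqrt pi))"
    and m: "m \<in> borel_measurable borel" and \<beta>: "\<beta> > 0" and L: "L > 0"
    and bound: "(\<integral>\<^sup>+v. ennreal (cmod (m v) * (1 + \<bar>v\<bar> powr \<beta>)) \<partial>lborel) < ennreal L"
    and p: "complex_of_real (p x) = mellin_inverse \<gamma> m x"
    and h: "h > 0" and x: "x > 0" and n: "n \<ge> 1"
  shows "integrable N (weighted_sq_error p X \<gamma> h n x)"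
    and "integral\<^sup>L N (weighted_sq_error p X \<gamma> h n x) \<le> 2 * L\<^sup>2 * h powr (2 * \<beta>)
      + 2 * (\<integral>y. \<bar>y\<bar> powr (4 * \<gamma> - 4) \<partial>P) * (LINT v:{-1/h..1/h}|lborel. cmod (rGamma (Complex (\<gamma> - 1/2) v)))\<^sup>2 / real n"
proof -
  interpret prob_space N by (rule N)
  have X[measurable]: "X k \<in> borel_measurable N" if "k \<ge> 1" for k
    using indep that by (auto simp: indep_vars_def)
  have P_sets: "sets P = sets borel" using law[of 1] by (metis le_refl sets_distr)
  interpret P: prob_space P using prob_space_distr[OF X[of 1]] law[of 1] by simp
  let ?V = "\<integral>y. \<bar>y\<bar> powr (4 * \<gamma> - 4) \<partial>P"
  let ?J = "LINT v:{-1/h..1/h}|lborel. cmod (rGamma (Complex (\<gamma> - 1/2) v))"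
  let ?S = "estimator_summand \<gamma> h x"
  let ?E = "\<lambda>\<omega>. (1 / of_nat n) * (\<Sum>k=1..n. ?S (X k \<omega>))"
  let ?\<mu> = "\<integral>y. ?S y \<partial>P"
  have V: "0 \<le> ?V" by (rule Bochner_Integration.integral_nonneg) simp
  have int2: "integrable P (\<lambda>y. \<bar>y\<bar> powr (2 * \<gamma> - 2))"
  proof (rule P.square_integrable_imp_integrable)
    have "(\<bar>y\<bar> powr (2 * \<gamma> - 2))\<^sup>2 = \<bar>y\<bar> powr (4 * \<gamma> - 4)" for y :: real
      unfolding power2_eq_square by (simp only: powr_add[symmetric]) simp
    then show "integrable P (\<lambda>y. (\<bar>y\<bar> powr (2 * \<gamma> - 2))\<^sup>2)" using int by simp
    show "(\<lambda>y. \<bar>y\<bar> powr (2 * \<gamma> - 2)) \<in> borel_measurable P"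
      using P_sets by (simp cong: measurable_cong_sets)
  qed
  have S_meas[measurable]: "?S \<in> borel_measurable borel" by (rule estimator_summand_measurable[OF h x])
  note S2 = estimator_summand_second_moment[OF h x P_sets int]
  note var = sample_mean_variance_complex[OF indep n law S_meas S2(1)]
  have mean: "?\<mu> = mellin_inverse \<gamma> (\<lambda>v. of_real (kernel (v * h)) * m v) x"
    by (rule estimator_summand_mean[OF h x P_sets P.prob_space_axioms int2 \<gamma> moment])
  have bias: "x powr \<gamma> * cmod (complex_of_real (p x) - ?\<mu>) \<le> L * h powr \<beta>"
    unfolding p mean by (rule truncation_bias[OF h x \<beta> L m bound])
  define b where "b \<omega> = 2 * (L * h powr \<beta>)\<^sup>2 + 2 * (x powr \<gamma>)\<^sup>2 * (cmod (?E \<omega> - ?\<mu>))\<^sup>2" for \<omega>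
  have b_int: "integrable N b"
    unfolding b_def[abs_def] by (intro Bochner_Integration.integrable_add integrable_mult_right var(1)) simp
  have err: "weighted_sq_error p X \<gamma> h n x \<omega> = (x powr \<gamma> * cmod (complex_of_real (p x) - ?E \<omega>))\<^sup>2" for \<omega>
    unfolding weighted_sq_error_def estimator_eq_sample_mean[OF h x] ..
  have le: "weighted_sq_error p X \<gamma> h n x \<omega> \<le> b \<omega>" for \<omega>
  proof -
    have "cmod (complex_of_real (p x) - ?E \<omega>) \<le> cmod (complex_of_real (p x) - ?\<mu>) + cmod (?E \<omega> - ?\<mu>)"
      using norm_triangle_ineq4[of "complex_of_real (p x) - ?\<mu>" "?E \<omega> - ?\<mu>"] by simp
    then have "x powr \<gamma> * cmod (complex_of_real (p x) - ?E \<omega>)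
      \<le> x powr \<gamma> * cmod (complex_of_real (p x) - ?\<mu>) + x powr \<gamma> * cmod (?E \<omega> - ?\<mu>)"
      by (simp add: distrib_left[symmetric] mult_left_mono)
    also have "\<dots> \<le> L * h powr \<beta> + x powr \<gamma> * cmod (?E \<omega> - ?\<mu>)" using bias by simp
    finally have "weighted_sq_error p X \<gamma> h n x \<omega> \<le> (L * h powr \<beta> + x powr \<gamma> * cmod (?E \<omega> - ?\<mu>))\<^sup>2"
      unfolding err by (intro power_mono) auto
    also have "\<dots> \<le> 2 * (L * h powr \<beta>)\<^sup>2 + 2 * (x powr \<gamma> * cmod (?E \<omega> - ?\<mu>))\<^sup>2"
      using sum_squares_bound[of "L * h powr \<beta>" "x powr \<gamma> * cmod (?E \<omega> - ?\<mu>)"] unfolding power2_sum by simp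
    finally show ?thesis by (simp add: b_def power_mult_distrib)
  qed
  have err_meas: "weighted_sq_error p X \<gamma> h n x \<in> borel_measurable N"
    unfolding err[abs_def] by (intro borel_measurable_power borel_measurable_times borel_measurable_const
      borel_measurable_norm borel_measurable_diff borel_measurable_sum) measurable
  show I: "integrable N (weighted_sq_error p X \<gamma> h n x)"
    by (rule Bochner_Integration.integrable_bound[OF b_int err_meas])
      (use le in \<open>auto simp: err intro: order.trans[OF _ abs_ge_self]\<close>)
  have "integral\<^sup>L N (weighted_sq_error p X \<gamma> h n x) \<le> integral\<^sup>L N b"
    by (rule integral_mono[OF I b_int le])
  also have "\<dots> = 2 * (L * h powr \<beta>)\<^sup>2 + 2 * (x powr \<gamma>)\<^sup>2 * expectation (\<lambda>\<omega>. (cmod (?E \<omega> - ?\<mu>))\<^sup>2)"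
    unfolding b_def[abs_def] using var(1)
    by (subst Bochner_Integration.integral_add) (simp_all only: integral_mult_right_zero integrable_mult_right integrable_const lebesgue_integral_const prob_space real_scaleR_def mult_1)
  also have "\<dots> \<le> 2 * (L * h powr \<beta>)\<^sup>2 + 2 * (x powr \<gamma>)\<^sup>2 * ((x powr (- \<gamma>) * ?J)\<^sup>2 * ?V / real n)"
  proof (intro add_left_mono mult_left_mono)
    have "expectation (\<lambda>\<omega>. (cmod (?E \<omega> - ?\<mu>))\<^sup>2) \<le> (\<integral>y. (cmod (?S y))\<^sup>2 \<partial>P) / real n"
      by (rule var(2))
    also have "\<dots> \<le> (1 / pi * (LBINT v. cmod (estimator_weight \<gamma> h x v))\<^sup>2 * ?V) / real n"
      by (rule divide_right_mono[OF S2(2)]) simp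
    also have "\<dots> \<le> ((x powr (- \<gamma>) * ?J)\<^sup>2 * ?V) / real n"
    proof (intro divide_right_mono mult_right_mono)
      have "1 / pi * (LBINT v. cmod (estimator_weight \<gamma> h x v))\<^sup>2 \<le> 1 * (LBINT v. cmod (estimator_weight \<gamma> h x v))\<^sup>2"
        using pi_ge_two by (intro mult_right_mono) auto
      also have "\<dots> \<le> (x powr (- \<gamma>) * ?J)\<^sup>2"
        unfolding mult_1
      proof (rule power_mono)
        have J: "0 \<le> ?J" unfolding set_lebesgue_integral_def by (rule Bochner_Integration.integral_nonneg) simp
        have "1 \<le> 2 powr \<gamma>" using \<gamma> by (intro ge_one_powr_ge_zero) auto
        then have "x powr (- \<gamma>) / 2 powr \<gamma> \<le> x powr (- \<gamma>)" by (simp add: divide_le_eq mult_le_cancel_left1)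
        then show "(LBINT v. cmod (estimator_weight \<gamma> h x v)) \<le> x powr (- \<gamma>) * ?J"
          unfolding estimator_weight_integrable(2)[OF h x] by (rule mult_right_mono[OF _ J])
      qed (rule Bochner_Integration.integral_nonneg, simp)
      finally show "1 / pi * (LBINT v. cmod (estimator_weight \<gamma> h x v))\<^sup>2 \<le> (x powr (- \<gamma>) * ?J)\<^sup>2" .
    qed (use V in auto)
    finally show "expectation (\<lambda>\<omega>. (cmod (?E \<omega> - ?\<mu>))\<^sup>2) \<le> (x powr (- \<gamma>) * ?J)\<^sup>2 * ?V / real n" .
  qed simp
  also have "2 * (x powr \<gamma>)\<^sup>2 * ((x powr (- \<gamma>) * ?J)\<^sup>2 * ?V / real n) = 2 * ?V * ?J\<^sup>2 / real n"
  proof -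
    have "x powr \<gamma> * x powr (- \<gamma>) = 1" using x by (simp add: powr_minus)
    moreover have "2 * a\<^sup>2 * ((b * J)\<^sup>2 * V / k) = 2 * V * J\<^sup>2 / k" if "a * b = 1" for a b J V k :: real
    proof -
      have "2 * a\<^sup>2 * ((b * J)\<^sup>2 * V / k) = (a * b)\<^sup>2 * (2 * V * J\<^sup>2 / k)"
        by (simp add: power_mult_distrib)
      then show ?thesis unfolding that by simp
    qed
    ultimately show ?thesis by blast
  qed
  also have "2 * (L * h powr \<beta>)\<^sup>2 = 2 * L\<^sup>2 * h powr (2 * \<beta>)"
  proof -
    have "(h powr \<beta>)\<^sup>2 = h powr (2 * \<beta>)"
      unfolding power2_eq_square by (simp only: powr_add[symmetric] mult_2)
    then show ?thesis by (simp add: power_mult_distrib)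
  qed
  finally show "integral\<^sup>L N (weighted_sq_error p X \<gamma> h n x) \<le> 2 * L\<^sup>2 * h powr (2 * \<beta>) + 2 * ?V * ?J\<^sup>2 / real n" .
qed

text \<open>With $q = \max(0, 1-\gamma)$ and $\kappa = \beta + q$ both cases read
  $h = \pi / (l - 2\kappa \ln l)$, where $l = \ln n$. Then $e^{\pi/h}/n = l^{-2\kappa}$, and
  $\pi/l \le h \le 2\pi/l$ for large \<open>n\<close>, so the variance term is at most
  $l^{2q} l^{-2\kappa} = l^{-2\beta}$.\<close>

lemma chosen_bandwidth_rate:
  fixes \<beta> \<gamma> :: real
  assumes \<beta>: "\<beta> > 0"
  shows "\<forall>\<^sub>F n in sequentially. chosen_bandwidth \<beta> \<gamma> n > 0 \<and>
    risk_rate \<beta> \<gamma> (chosen_bandwidth \<beta> \<gamma> n) n \<le> ((2 * pi) powr (2 * \<beta>) + 1) * ln (real n) powr (- (2 * \<beta>))"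
proof -
  define q where "q = max 0 (1 - \<gamma>)"
  define \<kappa> where "\<kappa> = \<beta> + q"
  have q: "q \<ge> 0" and \<kappa>: "\<kappa> > 0" using \<beta> by (auto simp: q_def \<kappa>_def)
  have ln_top: "filterlim (\<lambda>n. ln (real n)) at_top sequentially"
    by (rule filterlim_compose[OF ln_at_top filterlim_real_sequentially])
  have "((\<lambda>l. ln l / l) \<longlongrightarrow> 0) (at_top :: real filter)" by (rule ln_x_over_x_tendsto_0)
  then have "\<forall>\<^sub>F l in at_top. \<bar>ln l / l\<bar> < 1 / (4 * \<kappa>)"
    using \<kappa> by (auto simp: tendsto_iff dist_real_def)
  then have ev: "\<forall>\<^sub>F l in at_top. ln l / l < 1 / (4 * \<kappa>) \<and> 1 < (l::real)"
    using eventually_gt_at_top[of 1] by eventually_elim auto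
  show ?thesis
    using eventually_compose_filterlim[OF ev ln_top] eventually_gt_at_top[of 0]
  proof eventually_elim
    case (elim n)
    define l where "l = ln (real n)"
    define d where "d = l - 2 * \<kappa> * ln l"
    define h where "h = chosen_bandwidth \<beta> \<gamma> n"
    have l: "l > 1" "ln l / l < 1 / (4 * \<kappa>)" using elim by (auto simp: l_def)
    have "ln l < l / (4 * \<kappa>)" using l by (simp add: divide_less_eq)
    then have "2 * \<kappa> * ln l < 2 * \<kappa> * (l / (4 * \<kappa>))" using \<kappa> by (intro mult_strict_left_mono) auto
    also have "\<dots> = l / 2" using \<kappa> by simp
    finally have "2 * \<kappa> * ln l < l / 2" .
    moreover have "0 \<le> 2 * \<kappa> * ln l" using \<kappa> l by simp
    ultimately have d: "l / 2 \<le> d" "d \<le> l" "d > 0" using l by (auto simp: d_def)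
    have h_eq: "h = pi / d"
    proof (cases "\<gamma> < 1")
      case True
      then have "\<kappa> = \<beta> + 1 - \<gamma>" by (simp add: \<kappa>_def q_def)
      then show ?thesis using True by (simp add: h_def chosen_bandwidth_def d_def l_def)
    next
      case False
      then have "\<kappa> = \<beta>" by (simp add: \<kappa>_def q_def)
      then show ?thesis using False by (simp add: h_def chosen_bandwidth_def d_def l_def)
    qed
    have "pi / d \<le> pi / (l / 2)" "pi / l \<le> pi / d"
      using d l by (intro divide_left_mono mult_pos_pos; simp)+
    then have h: "h > 0" "h \<le> 2 * pi / l" "pi / l \<le> h"
      using d(3) by (simp_all add: h_eq mult.commute)
    have n: "real n = exp l" using elim by (simp add: l_def)
    have "exp (pi / h) = exp d" using d by (simp add: h_eq)
    also have "\<dots> = real n * l powr (- (2 * \<kappa>))"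
    proof -
      have "l powr (- (2 * \<kappa>)) = exp (- (2 * \<kappa>) * ln l)" using l by (simp add: powr_def)
      moreover have "d = l + - (2 * \<kappa>) * ln l" by (simp add: d_def)
      ultimately show ?thesis unfolding n by (simp only: exp_add)
    qed
    finally have e: "1 / real n * exp (pi / h) = l powr (- (2 * \<kappa>))" using elim by simp
    have rr: "risk_rate \<beta> \<gamma> h n = h powr (2 * \<beta>) + h powr (- (2 * q)) * (1 / real n * exp (pi / h))"
    proof (cases "\<gamma> < 1")
      case True
      then have "- (2 * q) = 2 * (\<gamma> - 1)" by (simp add: q_def)
      then show ?thesis using True by (simp add: risk_rate_def)
    next
      case False
      then have "q = 0" by (simp add: q_def)
      then show ?thesis using False h by (simp add: risk_rate_def)
    qed
    have "h powr (2 * \<beta>) \<le> (2 * pi / l) powr (2 * \<beta>)"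
      using h \<beta> by (intro powr_mono2) auto
    also have "\<dots> = (2 * pi) powr (2 * \<beta>) * l powr (- (2 * \<beta>))"
      using l by (simp add: powr_divide powr_minus_divide)
    finally have 1: "h powr (2 * \<beta>) \<le> (2 * pi) powr (2 * \<beta>) * l powr (- (2 * \<beta>))" .
    have "h powr (- (2 * q)) \<le> (pi / l) powr (- (2 * q))"
      using h l q by (intro powr_mono2') auto
    also have "\<dots> \<le> (1 / l) powr (- (2 * q))"
      using l q pi_ge_two by (intro powr_mono2') (auto simp: divide_right_mono)
    also have "\<dots> = l powr (2 * q)" using l by (simp add: powr_divide powr_minus_divide)
    finally have "h powr (- (2 * q)) * l powr (- (2 * \<kappa>)) \<le> l powr (2 * q) * l powr (- (2 * \<kappa>))"
      by (intro mult_right_mono) auto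
    also have "\<dots> = l powr (- (2 * \<beta>))"
      by (simp only: powr_add[symmetric]) (simp add: \<kappa>_def algebra_simps)
    finally have 2: "h powr (- (2 * q)) * l powr (- (2 * \<kappa>)) \<le> l powr (- (2 * \<beta>))" .
    have "risk_rate \<beta> \<gamma> h n \<le> ((2 * pi) powr (2 * \<beta>) + 1) * l powr (- (2 * \<beta>))"
      unfolding rr e distrib_right using 1 2 by simp
    with h(1) show ?case by (simp add: h_def l_def)
  qed
qed

text \<open>The version \<open>p\<close> is the inversion integral. The constant is $2L^2 + 2VC$, where $V$ is the moment
  $E|X|^{4\gamma-4}$ and $C$ comes from the bound for $J(h)^2$; neither involves $\beta$. At $x = 0$
  the weight makes the error vanish.\<close>

theorem theorem2p6:
  fixes M :: "'a measure" and N :: "'b measure"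
    and B :: "real \<Rightarrow> 'a \<Rightarrow> real" and T :: "'a \<Rightarrow> real" and X :: "nat \<Rightarrow> 'b \<Rightarrow> real"
    and p\<^sub>T :: "real \<Rightarrow> real" and a\<^sub>T b\<^sub>T \<gamma> L :: real
  assumes "prob_space M" and "prob_space N"
    and "standard_brownian_motion M B"
    and "\<forall>\<omega>\<in>space M. 0 \<le> T \<omega>"
    and "\<forall>x. 0 \<le> p\<^sub>T x" and "distributed M lborel T (\<lambda>x. ennreal (p\<^sub>T x))"
    and "independent_of_process M T B"
    and "prob_space.indep_vars N (\<lambda>_. borel) X {1..}"
    and "\<forall>k\<ge>1. distr N borel (X k) = distr M borel (\<lambda>\<omega>. B (T \<omega>) \<omega>)"
    and "0 \<le> a\<^sub>T" and "a\<^sub>T < 1" and "1 \<le> b\<^sub>T"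
    and "{z. a\<^sub>T < Re z \<and> Re z < b\<^sub>T} \<subseteq> mellin_domain M T"
    and "L > 0"
    and "max ((a\<^sub>T + 1) / 2) (3 / 4) < \<gamma>" and "\<gamma> < b\<^sub>T"
    and "1 < \<gamma> \<longrightarrow> complex_of_real (2 * \<gamma> - 1) \<in> mellin_domain M T"
  shows "\<exists>D. \<forall>\<beta>>0. p\<^sub>T \<in> mellin_class \<beta> \<gamma> L \<longrightarrow>
    (\<exists>p. continuous_version p\<^sub>T p \<and>
      (\<forall>h. (\<forall>n. h n > 0) \<and> h \<longlonglongrightarrow> 0 \<longrightarrow>
        (\<forall>n\<ge>1. \<forall>x\<ge>0.
           integrable N (weighted_sq_error p X \<gamma> (h n) n x) \<and>
           integral\<^sup>L N (weighted_sq_error p X \<gamma> (h n) n x) \<le> D * risk_rate \<beta> \<gamma> (h n) n)) \<and>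
      (\<exists>C. \<forall>\<^sub>F n in sequentially. \<forall>x\<ge>0.
         integrable N (weighted_sq_error p X \<gamma> (chosen_bandwidth \<beta> \<gamma> n) n x) \<and>
         sqrt (integral\<^sup>L N (weighted_sq_error p X \<gamma> (chosen_bandwidth \<beta> \<gamma> n) n x))
           \<le> C * ln (real n) powr (- \<beta>)))"
proof -
  note BM = \<open>standard_brownian_motion M B\<close> and T0 = \<open>\<forall>\<omega>\<in>space M. 0 \<le> T \<omega>\<close>
    and dist = \<open>distributed M lborel T (\<lambda>x. ennreal (p\<^sub>T x))\<close> and indep = \<open>independent_of_process M T B\<close>
    and p0 = \<open>\<forall>x. 0 \<le> p\<^sub>T x\<close>
  have T[measurable]: "T \<in> borel_measurable M"
    using distributed_measurable[OF dist] by simp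
  have pT[measurable]: "p\<^sub>T \<in> borel_measurable borel"
    using distributed_real_measurable[OF _ dist] p0 by simp
  have g34: "3 / 4 < \<gamma>" and ga: "(a\<^sub>T + 1) / 2 < \<gamma>"
    using \<open>max ((a\<^sub>T + 1) / 2) (3 / 4) < \<gamma>\<close> by auto
  define P where "P = distr M borel (\<lambda>\<omega>. B (T \<omega>) \<omega>)"
  have law: "distr N borel (X k) = P" if "k \<ge> 1" for k
    using \<open>\<forall>k\<ge>1. distr N borel (X k) = distr M borel (\<lambda>\<omega>. B (T \<omega>) \<omega>)\<close> that by (simp add: P_def)
  have strip: "integrable M (\<lambda>\<omega>. T \<omega> powr (s - 1))" if "a\<^sub>T < s" "s < b\<^sub>T" for s
    using \<open>{z. a\<^sub>T < Re z \<and> Re z < b\<^sub>T} \<subseteq> mellin_domain M T\<close> that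
    by (auto simp: mellin_domain_def subset_iff dest!: spec[of _ "complex_of_real s"])
  have int1: "integrable M (\<lambda>\<omega>. T \<omega> powr (\<gamma> - 1))"
    using ga \<open>a\<^sub>T < 1\<close> \<open>\<gamma> < b\<^sub>T\<close> by (intro strip) auto
  \<comment> \<open>For $\gamma \le 1$ the point $2\gamma-1$ lies in the strip $(a_T, b_T)$, since
    $a_T < 2\gamma - 1 \le \gamma$.\<close>
  have int2: "integrable M (\<lambda>\<omega>. T \<omega> powr (2 * \<gamma> - 1 - 1))"
  proof (cases "1 < \<gamma>")
    case True
    then show ?thesis
      using \<open>1 < \<gamma> \<longrightarrow> complex_of_real (2 * \<gamma> - 1) \<in> mellin_domain M T\<close> by (simp add: mellin_domain_def)
  next
    case False
    then show ?thesis using ga \<open>\<gamma> < b\<^sub>T\<close> by (intro strip) auto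
  qed
  have moment: "(\<integral>y. complex_of_real \<bar>y\<bar> powr (2 * Complex \<gamma> v - 2) \<partial>P)
      = mellin p\<^sub>T (Complex \<gamma> v) * (2 powr (Complex \<gamma> v - 1) * Gamma (Complex \<gamma> v - 1/2) / of_real (sqrt pi))" for v
    using time_changed_brownian_motion_moment[OF BM T T0 indep, of "Complex \<gamma> v"] g34 int1
    unfolding expectation_powr_eq_mellin[OF T0 p0 dist] P_def by (auto simp: has_bochner_integral_iff)
  have int4: "integrable P (\<lambda>y. \<bar>y\<bar> powr (4 * \<gamma> - 4))"
  proof -
    have "integrable P (\<lambda>y. complex_of_real \<bar>y\<bar> powr (2 * complex_of_real (2 * \<gamma> - 1) - 2))"
      using time_changed_brownian_motion_moment[OF BM T T0 indep, of "complex_of_real (2 * \<gamma> - 1)"] g34 int2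
      unfolding P_def by (auto simp: has_bochner_integral_iff)
    then have "integrable P (\<lambda>y. cmod (complex_of_real \<bar>y\<bar> powr (2 * complex_of_real (2 * \<gamma> - 1) - 2)))"
      by (rule integrable_norm)
    moreover have "cmod (complex_of_real \<bar>y\<bar> powr (2 * complex_of_real (2 * \<gamma> - 1) - 2)) = \<bar>y\<bar> powr (4 * \<gamma> - 4)" for y
      by (subst norm_powr_real_powr) (auto simp: algebra_simps)
    ultimately show ?thesis by simp
  qed
  define m where "m v = mellin p\<^sub>T (Complex \<gamma> v)" for v
  define p where "p x = Re (mellin_inverse \<gamma> m x)" for x
  have m_meas: "m \<in> borel_measurable borel"
    unfolding m_def[abs_def] by (rule mellin_on_line_measurable[OF pT])
  have p_eq: "complex_of_real (p x) = mellin_inverse \<gamma> m x" if "x > 0" for x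
    unfolding p_def m_def[abs_def] using mellin_inverse_mellin_real[OF that] by simp
  obtain C where C: "C > 0" "\<And>h. h > 0 \<Longrightarrow> (LINT v:{-1/h..1/h}|lborel. cmod (rGamma (Complex (\<gamma> - 1/2) v)))\<^sup>2
       \<le> C * (if \<gamma> < 1 then h powr (2 * (\<gamma> - 1)) * exp (pi / h) else exp (pi / h))"
    using rGamma_line_integral_bound[of \<gamma>] g34 by auto
  define V where "V = (\<integral>y. \<bar>y\<bar> powr (4 * \<gamma> - 4) \<partial>P)"
  have V: "V \<ge> 0" unfolding V_def by (rule Bochner_Integration.integral_nonneg) simp
  define D where "D = 2 * L\<^sup>2 + 2 * V * C"
  have D: "D \<ge> 0" using V C(1) by (simp add: D_def)
  have rate_nonneg: "0 \<le> risk_rate \<beta> \<gamma> h n" for \<beta> h n by (simp add: risk_rate_def)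
  have risk: "integrable N (weighted_sq_error p X \<gamma> h n x) \<and>
      integral\<^sup>L N (weighted_sq_error p X \<gamma> h n x) \<le> D * risk_rate \<beta> \<gamma> h n"
    if \<beta>: "\<beta> > 0" and mc: "p\<^sub>T \<in> mellin_class \<beta> \<gamma> L" and h: "h > 0" and n: "n \<ge> 1" and x: "x \<ge> 0" for \<beta> h n x
  proof (cases "x = 0")
    case True
    then have "weighted_sq_error p X \<gamma> h n x = (\<lambda>_. 0)" by (simp add: weighted_sq_error_def fun_eq_iff)
    then show ?thesis using mult_nonneg_nonneg[OF D rate_nonneg[of \<beta> h n]] by simp
  next
    case False
    with x have x: "x > 0" by simp
    have "1/2 < \<gamma>" using g34 by simp
    have bound: "(\<integral>\<^sup>+v. ennreal (cmod (m v) * (1 + \<bar>v\<bar> powr \<beta>)) \<partial>lborel) < ennreal L"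
      using mc by (simp add: mellin_class_def m_def)
    note R = weighted_risk_bound[where p=p and x=x, OF \<open>prob_space N\<close> \<open>prob_space.indep_vars N (\<lambda>_. borel) X {1..}\<close> law int4 \<open>1/2 < \<gamma>\<close>
        moment[folded m_def] m_meas \<beta> \<open>L > 0\<close> bound p_eq[OF x] h x n, folded V_def]
    define J where "J = (LINT v:{-1/h..1/h}|lborel. cmod (rGamma (Complex (\<gamma> - 1/2) v)))\<^sup>2"
    define E where "E = (if \<gamma> < 1 then h powr (2 * (\<gamma> - 1)) * exp (pi / h) else exp (pi / h))"
    have E: "0 \<le> E" by (simp add: E_def)
    have rr: "risk_rate \<beta> \<gamma> h n = h powr (2 * \<beta>) + E / real n"
      by (simp add: risk_rate_def E_def)
    have "integral\<^sup>L N (weighted_sq_error p X \<gamma> h n x) \<le> 2 * L\<^sup>2 * h powr (2 * \<beta>) + 2 * V * J / real n"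
      using R(2) by (simp add: J_def)
    also have "\<dots> \<le> 2 * L\<^sup>2 * h powr (2 * \<beta>) + 2 * V * (C * E) / real n"
      using C(2)[OF h] V by (intro add_left_mono divide_right_mono mult_left_mono) (auto simp: J_def E_def)
    also have "\<dots> = 2 * L\<^sup>2 * h powr (2 * \<beta>) + 2 * V * C * (E / real n)" by simp
    also have "\<dots> \<le> D * h powr (2 * \<beta>) + D * (E / real n)"
      using V C(1) E by (intro add_mono mult_right_mono) (auto simp: D_def)
    finally show ?thesis using R(1) by (simp add: rr distrib_left)
  qed
  show ?thesis
  proof (intro exI[of _ D] allI impI)
    fix \<beta> :: real assume \<beta>: "\<beta> > 0" and mc: "p\<^sub>T \<in> mellin_class \<beta> \<gamma> L"
    have bound: "(\<integral>\<^sup>+v. ennreal (cmod (m v) * (1 + \<bar>v\<bar> powr \<beta>)) \<partial>lborel) < ennreal L"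
      and pint: "set_integrable lborel {0<..} (\<lambda>x. p\<^sub>T x * x powr (\<gamma> - 1))"
      using mc by (auto simp: mellin_class_def m_def)
    have m_int: "integrable lborel m"
      by (rule integrable_of_weighted_norm(2)[OF m_meas bound])
    have "continuous_on {0<..} p"
      unfolding p_def[abs_def] by (intro continuous_on_Re continuous_on_mellin_inverse m_int)
    moreover have "AE x in lborel. 0 < x \<longrightarrow> p x = p\<^sub>T x"
      using mellin_inversion[OF pT _ pint, folded m_def] m_int p0
      by (auto simp: p_def elim!: eventually_mono dest: arg_cong[where f=Re])
    ultimately have version: "continuous_version p\<^sub>T p" by (simp add: continuous_version_def)
    let ?h = "chosen_bandwidth \<beta> \<gamma>"
    let ?K = "(2 * pi) powr (2 * \<beta>) + 1"
    have "\<forall>\<^sub>F n in sequentially. \<forall>x\<ge>0. integrable N (weighted_sq_error p X \<gamma> (?h n) n x) \<and>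
         sqrt (integral\<^sup>L N (weighted_sq_error p X \<gamma> (?h n) n x)) \<le> sqrt (D * ?K) * ln (real n) powr (- \<beta>)"
      using chosen_bandwidth_rate[OF \<beta>, of \<gamma>] eventually_ge_at_top[of 1]
    proof (eventually_elim, intro allI impI conjI)
      fix n :: nat and x :: real
      assume hn: "?h n > 0 \<and> risk_rate \<beta> \<gamma> (?h n) n \<le> ?K * ln (real n) powr (- (2 * \<beta>))" and n: "1 \<le> n" and x: "0 \<le> x"
      note r = risk[OF \<beta> mc _ n x, of "?h n"]
      show "integrable N (weighted_sq_error p X \<gamma> (?h n) n x)" using r hn by simp
      have "integral\<^sup>L N (weighted_sq_error p X \<gamma> (?h n) n x) \<le> D * risk_rate \<beta> \<gamma> (?h n) n" using r hn by simp
      also have "\<dots> \<le> D * (?K * ln (real n) powr (- (2 * \<beta>)))" using hn D by (intro mult_left_mono) auto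
      also have "\<dots> = D * ?K * (ln (real n) powr (- \<beta>))\<^sup>2"
        unfolding power2_eq_square by (simp only: powr_add[symmetric] mult.assoc) simp
      finally have "sqrt (integral\<^sup>L N (weighted_sq_error p X \<gamma> (?h n) n x)) \<le> sqrt (D * ?K * (ln (real n) powr (- \<beta>))\<^sup>2)"
        by (rule real_sqrt_le_mono)
      then show "sqrt (integral\<^sup>L N (weighted_sq_error p X \<gamma> (?h n) n x)) \<le> sqrt (D * ?K) * ln (real n) powr (- \<beta>)"
        by (simp add: real_sqrt_mult)
    qed
    with version risk[OF \<beta> mc] show "\<exists>p. continuous_version p\<^sub>T p \<and>
      (\<forall>h. (\<forall>n. h n > 0) \<and> h \<longlonglongrightarrow> 0 \<longrightarrow>
        (\<forall>n\<ge>1. \<forall>x\<ge>0.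
           integrable N (weighted_sq_error p X \<gamma> (h n) n x) \<and>
           integral\<^sup>L N (weighted_sq_error p X \<gamma> (h n) n x) \<le> D * risk_rate \<beta> \<gamma> (h n) n)) \<and>
      (\<exists>C. \<forall>\<^sub>F n in sequentially. \<forall>x\<ge>0.
         integrable N (weighted_sq_error p X \<gamma> (chosen_bandwidth \<beta> \<gamma> n) n x) \<and>
         sqrt (integral\<^sup>L N (weighted_sq_error p X \<gamma> (chosen_bandwidth \<beta> \<gamma> n) n x))
           \<le> C * ln (real n) powr (- \<beta>))"
      by (intro exI[of _ p] conjI allI impI exI[of _ "sqrt (D * ?K)"]) auto
  qed
qed

end
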